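(* Let $(\mathcal T,d)$ be an edge positive 2-dimensional duality triangulation. Then the edge flip algorithm, applied to $(\mathcal T,d)$, finds a regular triangulation. Here the edge flip algorithm is: look for a flippable edge which is not regular, and flip it; continue until the triangulation is regular.
   Context: $\mathcal T$ is a triangulation of a surface (2-dimensional manifold). A duality triangulation $(\mathcal T,d)$ is a real function $d$ on the directed edges $(i,j)$ of $\mathcal T$ such that $d_{ij}^2+d_{jk}^2+d_{ki}^2=d_{ji}^2+d_{ik}^2+d_{kj}^2$ for each triangle $\{i,j,k\}$, and such that $\ell_{ij}=d_{ij}+d_{ji}>0$ are the edge lengths of a nondegenerate Euclidean triangle for each triangle of $\mathcal T$. The center $C(\{i,j\})$ of an edge is the point of the line through the edge at signed distance $d_{ij}$ from $i$ in the direction of $j$ (hence signed distance $d_{ji}$ from $j$ in the direction of $i$). The condition on $d$ ensures that the three perpendiculars to the edges of a triangle through the edge centers meet in one point, the center $C(\{i,j,k\})$ of the triangle. A hinge is a pair of triangles $\{i,j,k\}$, $\{i,j,l\}$ with a common edge $\{i,j\}$; it can be embedded isometrically in $\mathbb R^2$. The (signed) dual length is $|\bigstar\{i,j\}|=h_k+h_l$, where $h_k$ is the distance from $C(\{i,j,k\})$ to $C(\{i,j\})$, with positive sign if $C(\{i,j,k\})$ is on the same side of the line through $\{i,j\}$ as the triangle $\{i,j,k\}$ and negative sign if it is on the other side; $h_l$ is defined likewise with $l$ in place of $k$. The edge $\{i,j\}$ (or its hinge) is regular, meaning locally regular, if $|\bigstar\{i,j\}|>0$; the duality triangulation is regular,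 meaning locally regular, if $|\bigstar\{i,j\}|>0$ for every edge $\{i,j\}$. The edge $\{i,j\}$ is flippable if the quadrilateral defined by its hinge, when embedded in $\mathbb R^2$, is convex. The flip at $\{i,j\}$ replaces the triangles $\{i,j,k\},\{i,j,l\}$ by $\{i,k,l\},\{j,k,l\}$, keeps $d$ on all other edges, and defines $d_{kl},d_{lk}$ on the new edge as the solution of the flip system $d_{kl}+d_{lk}=d(k,l)$ and $d_{kl}-d_{lk}=\dfrac{d_{ki}^2+d_{il}^2-d_{li}^2-d_{ik}^2}{d(k,l)}$, where $d(k,l)$ is the Euclidean distance between $k$ and $l$ in the embedded hinge; the result is again a duality triangulation. A 2-dimensional duality triangulation is edge positive if $d_{ij}>0$ for every directed edge $(i,j)$ of the triangulation and also for any possible flip, i.e. for any solution of the flip system (so the center of each edge is inside the edge, and the center of the new edge after any flip is also inside that edge).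
   Formalization: Termination with strict regularity assumes no edge of dual length exactly 0 is ever met (a square flat torus flips forever); otherwise only dual lengths >= 0 are reached. Surfaces are finite and closed; edge positivity is required after any sequence of flips. *)

theory Defs
  imports "HOL-Analysis.Analysis"
begin

text \<open>
  A triangulation is encoded by its flags: a flag is a triangle together with an ordering
  \<open>(i, j, k)\<close> of its three corners, so every triangle has six flags.  The three involutions
  change one cell of the flag and keep the other two:
  \<open>chg_vertex (i, j, k) = (j, i, k)\<close>, \<open>chg_edge (i, j, k) = (i, k, j)\<close>, and
  \<open>chg_triangle (i, j, k) = (i, j, l)\<close>, where \<open>{i, j, l}\<close> is the other triangle at the
  edge \<open>{i, j}\<close>.  A flag \<open>(i, j, k)\<close> also stands for the directed edge \<open>(i, j)\<close>, seen from
  the triangle \<open>{i, j, k}\<close>.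

  Gluings that are not simplicial complexes (several edges with the same end points, loops, two
  sides of one triangle glued together) are included: a flip at \<open>{i, j}\<close> may create a second
  edge between \<open>k\<close> and \<open>l\<close>.  Orientability is not required.
\<close>

record 'f triangulation =
  chg_vertex :: "'f \<Rightarrow> 'f"
  chg_edge :: "'f \<Rightarrow> 'f"
  chg_triangle :: "'f \<Rightarrow> 'f"

text \<open>\<open>(i, j, k) \<mapsto> (j, k, i)\<close>\<close>

definition rot :: "'f triangulation \<Rightarrow> 'f \<Rightarrow> 'f" where
  "rot T x = chg_edge T (chg_vertex T x)"

text \<open>
  The conditions on \<open>rot\<close> make the orbits of \<open>chg_vertex\<close> and \<open>chg_edge\<close> triangles with
  exactly six flags; the conditions on \<open>chg_vertex\<close> and \<open>chg_triangle\<close> say that every edge is a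
  side of exactly two triangles (or twice a side of the same triangle) and is not folded onto
  itself.  As there are finitely many flags, the triangles around a vertex then form a cycle, so
  the result is a closed surface.
\<close>

definition surface_triangulation :: "'f::finite triangulation \<Rightarrow> bool" where
  "surface_triangulation T \<longleftrightarrow>
     (\<forall>x. chg_vertex T (chg_vertex T x) = x \<and> chg_vertex T x \<noteq> x) \<and>
     (\<forall>x. chg_edge T (chg_edge T x) = x \<and> chg_edge T x \<noteq> x) \<and>
     (\<forall>x. chg_triangle T (chg_triangle T x) = x \<and> chg_triangle T x \<noteq> x) \<and>
     (\<forall>x. rot T (rot T (rot T x)) = x \<and> rot T x \<noteq> x) \<and>
     (\<forall>x. chg_vertex T (chg_triangle T x) = chg_triangle T (chg_vertex T x) \<and>
          chg_vertex T (chg_triangle T x) \<noteq> x)"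

definition edge_length :: "'f triangulation \<Rightarrow> ('f \<Rightarrow> real) \<Rightarrow> 'f \<Rightarrow> real" where
  "edge_length T d x = d x + d (chg_vertex T x)"

text \<open>
  The first condition says that \<open>d\<close> is a function of the directed edge.  In the second one,
  for \<open>x = (i, j, k)\<close>, the flags on the left are the directed edges \<open>(i, j)\<close>, \<open>(j, k)\<close>,
  \<open>(k, i)\<close>, those on the right are \<open>(j, i)\<close>, \<open>(k, j)\<close>, \<open>(i, k)\<close>.
\<close>

definition duality_triangulation :: "'f::finite triangulation \<Rightarrow> ('f \<Rightarrow> real) \<Rightarrow> bool" where
  "duality_triangulation T d \<longleftrightarrow>
     surface_triangulation T \<and>
     (\<forall>x. d (chg_triangle T x) = d x) \<and>
     (\<forall>x. (d x)\<^sup>2 + (d (rot T x))\<^sup>2 + (d (rot T (rot T x)))\<^sup>2 =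
          (d (chg_vertex T x))\<^sup>2 + (d (chg_vertex T (rot T x)))\<^sup>2
            + (d (chg_vertex T (rot T (rot T x))))\<^sup>2) \<and>
     (\<forall>x. 0 < edge_length T d x) \<and>
     (\<forall>x. edge_length T d x < edge_length T d (rot T x) + edge_length T d (rot T (rot T x)))"

text \<open>
  For a flag \<open>(i, j, k)\<close> the hinge at \<open>{i, j}\<close> is embedded in the complex plane with \<open>i\<close> at
  \<open>0\<close>, \<open>j\<close> on the positive real axis and \<open>k\<close> in the upper half plane, at the point given by
  the law of cosines.  The corner \<open>l\<close> of the other triangle lies in the lower half plane.
\<close>

definition pos_i :: complex where
  "pos_i = 0"

definition pos_j :: "'f triangulation \<Rightarrow> ('f \<Rightarrow> real) \<Rightarrow> 'f \<Rightarrow> complex" where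
  "pos_j T d x = complex_of_real (edge_length T d x)"

definition pos_k :: "'f triangulation \<Rightarrow> ('f \<Rightarrow> real) \<Rightarrow> 'f \<Rightarrow> complex" where
  "pos_k T d x =
     (let ij = edge_length T d x; jk = edge_length T d (rot T x); ik = edge_length T d (chg_edge T x);
          u = (ij\<^sup>2 + ik\<^sup>2 - jk\<^sup>2) / (2 * ij)
      in Complex u (sqrt (ik\<^sup>2 - u\<^sup>2)))"

definition pos_l :: "'f triangulation \<Rightarrow> ('f \<Rightarrow> real) \<Rightarrow> 'f \<Rightarrow> complex" where
  "pos_l T d x = cnj (pos_k T d (chg_triangle T x))"

text \<open>The point of the line through \<open>p\<close> and \<open>q\<close> at signed distance \<open>t\<close> from \<open>p\<close> towards \<open>q\<close>.\<close>

definition point_at :: "complex \<Rightarrow> complex \<Rightarrow> real \<Rightarrow> complex" where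
  "point_at p q t = p + t *\<^sub>R sgn (q - p)"

definition edge_center :: "'f triangulation \<Rightarrow> ('f \<Rightarrow> real) \<Rightarrow> 'f \<Rightarrow> complex" where
  "edge_center T d x = point_at pos_i (pos_j T d x) (d x)"

definition triangle_center :: "'f triangulation \<Rightarrow> ('f \<Rightarrow> real) \<Rightarrow> 'f \<Rightarrow> complex" where
  "triangle_center T d x =
     (let p = pos_i; q = pos_j T d x; r = pos_k T d x
      in THE c. inner (c - point_at p q (d x)) (q - p) = 0 \<and>
                inner (c - point_at q r (d (rot T x))) (r - q) = 0 \<and>
                inner (c - point_at r p (d (rot T (rot T x)))) (p - r) = 0)"

text \<open>
  The sign is that of the imaginary part, because \<open>i\<close> and \<open>j\<close> lie on the real axis and \<open>k\<close>
  in the upper half plane.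
\<close>

definition signed_height :: "'f triangulation \<Rightarrow> ('f \<Rightarrow> real) \<Rightarrow> 'f \<Rightarrow> real" where
  "signed_height T d x =
     sgn (Im (triangle_center T d x)) * dist (triangle_center T d x) (edge_center T d x)"

definition dual_length :: "'f triangulation \<Rightarrow> ('f \<Rightarrow> real) \<Rightarrow> 'f \<Rightarrow> real" where
  "dual_length T d x = signed_height T d x + signed_height T d (chg_triangle T x)"

definition regular_edge :: "'f triangulation \<Rightarrow> ('f \<Rightarrow> real) \<Rightarrow> 'f \<Rightarrow> bool" where
  "regular_edge T d x \<longleftrightarrow> dual_length T d x > 0"

definition weakly_regular_edge :: "'f triangulation \<Rightarrow> ('f \<Rightarrow> real) \<Rightarrow> 'f \<Rightarrow> bool" where
  "weakly_regular_edge T d x \<longleftrightarrow> dual_length T d x \<ge> 0"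

definition triangle_flags :: "'f triangulation \<Rightarrow> 'f \<Rightarrow> 'f set" where
  "triangle_flags T x =
     {x, rot T x, rot T (rot T x),
      chg_vertex T x, chg_vertex T (rot T x), chg_vertex T (rot T (rot T x))}"

text \<open>
  The two triangles of the hinge have to be different, as otherwise the edge to be removed is
  itself a side of the quadrilateral.  Convexity is strict (all four corners are extreme points):
  with a straight angle at \<open>i\<close> the triangle \<open>{i, k, l}\<close> would be degenerate.
\<close>

definition flippable :: "'f triangulation \<Rightarrow> ('f \<Rightarrow> real) \<Rightarrow> 'f \<Rightarrow> bool" where
  "flippable T d x \<longleftrightarrow>
     chg_triangle T x \<notin> triangle_flags T x \<and>
     (let Q = {pos_i, pos_j T d x, pos_k T d x, pos_l T d x}
      in \<forall>p\<in>Q. p extreme_point_of (convex hull Q))"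

text \<open>
  The flags are reused.  Of the flags of the old diagonal, \<open>(i, j, k)\<close>, \<open>(j, i, k)\<close>,
  \<open>(i, j, l)\<close>, \<open>(j, i, l)\<close> become \<open>(k, l, i)\<close>, \<open>(l, k, i)\<close>, \<open>(k, l, j)\<close>,
  \<open>(l, k, j)\<close>.  A flag on one of the four sides of the quadrilateral keeps its directed edge and
  gets a new third corner; for instance \<open>(i, k, j)\<close> becomes \<open>(i, k, l)\<close>.
  With this choice only \<open>chg_edge\<close> changes.
\<close>

definition flip_triangulation :: "'f triangulation \<Rightarrow> 'f \<Rightarrow> 'f triangulation" where
  "flip_triangulation T x =
     (let ij = x; ji = chg_vertex T x; ij' = chg_triangle T x; ji' = chg_vertex T ij';
          ik = chg_edge T ij; ki = chg_vertex T ik;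
          jk = chg_edge T ji; kj = chg_vertex T jk;
          il = chg_edge T ij'; li = chg_vertex T il;
          jl = chg_edge T ji'; lj = chg_vertex T jl;
          kl = ij; lk = ji; kl' = ij'; lk' = ji'
      in T\<lparr>chg_edge := (chg_edge T)
             (ik := il, il := ik, ki := kl, kl := ki, li := lk, lk := li,
              jk := jl, jl := jk, kj := kl', kl' := kj, lj := lk', lk' := lj)\<rparr>)"

text \<open>
  The new values are the solution of the linear system
  \<open>d\<^sub>k\<^sub>l + d\<^sub>l\<^sub>k = s\<close>, \<open>d\<^sub>k\<^sub>l - d\<^sub>l\<^sub>k = \<delta>\<close>.
\<close>

definition flip_d :: "'f triangulation \<Rightarrow> ('f \<Rightarrow> real) \<Rightarrow> 'f \<Rightarrow> 'f \<Rightarrow> real" where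
  "flip_d T d x =
     (let ij = x; ji = chg_vertex T x; ij' = chg_triangle T x; ji' = chg_vertex T ij';
          ik = chg_edge T ij; ki = chg_vertex T ik;
          il = chg_edge T ij'; li = chg_vertex T il;
          s = dist (pos_k T d x) (pos_l T d x);
          \<delta> = ((d ki)\<^sup>2 + (d il)\<^sup>2 - (d li)\<^sup>2 - (d ik)\<^sup>2) / s
      in d(ij := (s + \<delta>) / 2, ij' := (s + \<delta>) / 2, ji := (s - \<delta>) / 2, ji' := (s - \<delta>) / 2))"

type_synonym 'f weighted = "'f triangulation \<times> ('f \<Rightarrow> real)"

definition flip_step :: "'f weighted \<Rightarrow> 'f weighted \<Rightarrow> bool" where
  "flip_step = (\<lambda>(T, d) S. \<exists>x. flippable T d x \<and> S = (flip_triangulation T x, flip_d T d x))"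

text \<open>
  ``Any possible flip'' includes flips of triangulations that arise from earlier flips.
\<close>

definition edge_positive :: "'f triangulation \<Rightarrow> ('f \<Rightarrow> real) \<Rightarrow> bool" where
  "edge_positive T d \<longleftrightarrow> (\<forall>T' d'. flip_step\<^sup>*\<^sup>* (T, d) (T', d') \<longrightarrow> (\<forall>x. d' x > 0))"

text \<open>
  One step of the edge flip algorithm; \<open>reg\<close> is the notion of regularity of an edge that is used.
\<close>

definition algorithm_step ::
  "('f triangulation \<Rightarrow> ('f \<Rightarrow> real) \<Rightarrow> 'f \<Rightarrow> bool) \<Rightarrow> 'f weighted \<Rightarrow> 'f weighted \<Rightarrow> bool" where
  "algorithm_step reg = (\<lambda>(T, d) S. \<exists>x. flippable T d x \<and> \<not> reg T d x \<and>
     S = (flip_triangulation T x, flip_d T d x))"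

definition algorithm_terminates ::
  "('f triangulation \<Rightarrow> ('f \<Rightarrow> real) \<Rightarrow> 'f \<Rightarrow> bool) \<Rightarrow> 'f weighted \<Rightarrow> bool" where
  "algorithm_terminates reg S \<longleftrightarrow>
     \<not> (\<exists>run. run 0 = S \<and> (\<forall>n::nat. algorithm_step reg (run n) (run (Suc n))))"

definition algorithm_stops_only_if_regular ::
  "('f triangulation \<Rightarrow> ('f \<Rightarrow> real) \<Rightarrow> 'f \<Rightarrow> bool) \<Rightarrow> 'f weighted \<Rightarrow> bool" where
  "algorithm_stops_only_if_regular reg S \<longleftrightarrow>
     (\<forall>T' d'. (algorithm_step reg)\<^sup>*\<^sup>* S (T', d') \<and> \<not> (\<exists>S'. algorithm_step reg (T', d') S')
        \<longrightarrow> (\<forall>x. reg T' d' x))"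

text \<open>
  An edge with dual length \<open>0\<close> is not regular, and its flip again has dual length \<open>0\<close>, so the
  algorithm may flip it back and forth forever.  For instance, a flat square torus with one vertex
  and \<open>d\<close> half the edge length has no regular triangulation.
\<close>

definition no_degenerate_hinges :: "'f triangulation \<Rightarrow> ('f \<Rightarrow> real) \<Rightarrow> bool" where
  "no_degenerate_hinges T d \<longleftrightarrow>
     (\<forall>T' d'. (algorithm_step regular_edge)\<^sup>*\<^sup>* (T, d) (T', d') \<longrightarrow> (\<forall>x. dual_length T' d' x \<noteq> 0))"

end

theory Submission
  imports Defs
begin

text \<open>
  An edge with \<open>d > 0\<close> and nonpositive dual length is flippable: the height of the center over the
  edge \<open>{i, j}\<close> in the triangle \<open>{i, j, k}\<close> exceeds \<open>- d\<^sub>i\<^sub>j\<close> times the cotangent of the angle at \<open>i\<close>, so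
  the dual length is positive if the two angles at \<open>i\<close> add up to \<open>\<pi>\<close> or more.

  The sum of (height over the edge) / (edge length) over all flags strictly decreases in every flip of
  an edge with negative dual length (for the diagonals cutting each other in the ratios \<open>s\<close> and \<open>t\<close>, the
  change is a negative multiple of \<open>1 - s (1 - s) - t (1 - t)\<close>), so no triangulation occurs twice.
  Therefore the algorithm terminates if only finitely many triangulations can be reached.

  Such flips do not increase the supremum of the inner products of unit vectors pointing into a
  triangle from a corner with the vector from this corner to the center.  Hence \<open>d\<close> and the edge
  lengths stay bounded.  Moreover, every edge is a geodesic segment between vertices of the initial
  triangulation, as such segments remain geodesic when a flip is undone.  A segment of bounded length
  crosses a bounded number of triangles of the initial triangulation, which leaves finitely many
  values for its length \<open>\<ell>\<close> and the difference of the weights at its ends, and these determine \<open>d\<close>.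
\<close>

section \<open>Flags and heights\<close>

text \<open>Vertices are cone points, and the differences
  \<open>d\<^sub>i\<^sub>j\<^sup>2 - d\<^sub>j\<^sub>i\<^sup>2\<close> come from weights only
  locally, as their sum along a closed path around a handle may be nonzero. Hence all geometry is
  done with single triangles laid out in the plane, up to a motion and a common shift of the
  weights. A flip keeps the four corners of its hinge and their weights. What it changes is governed
  by one number, the \<open>gap\<close> of the two diagonals, whose sign is opposite to that of the
  dual length; it drives both the decrease of the energy and the bound on \<open>d\<close>.

  The energy alone does not bound the number of flips, since a closed surface may have infinitely
  many geodesic triangulations with the same vertices, with arbitrarily long edges. Segments are
  counted in the initial triangulation because its smallest area and longest edge are fixed, whereas
  later triangles may become thin. A segment is kept as the set of developed triangles that it
  touches, not as a sequence, because then undoing a flip is a local replacement in this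
  set.\<close>

locale flag_surface =
  fixes T :: "'f::finite triangulation"
  assumes surface: "surface_triangulation T"
begin

abbreviation "V \<equiv> chg_vertex T"
abbreviation "E \<equiv> chg_edge T"
abbreviation "F \<equiv> chg_triangle T"

lemma VV [simp]: "V (V x) = x" and EE [simp]: "E (E x) = x" and FF [simp]: "F (F x) = x"
  and FV [simp]: "F (V x) = V (F x)"
  and V_ne [simp]: "V x \<noteq> x" and E_ne [simp]: "E x \<noteq> x"
  and F_ne [simp]: "F x \<noteq> x" and VF_ne [simp]: "V (F x) \<noteq> x"
  and EV_ne [simp]: "E (V x) \<noteq> x"
proof -
  note surf = surface[unfolded surface_triangulation_def rot_def]
  note c1 = surf[THEN conjunct1, THEN spec, of x]
  note c2 = surf[THEN conjunct2, THEN conjunct1, THEN spec, of x]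
  note c3 = surf[THEN conjunct2, THEN conjunct2, THEN conjunct1, THEN spec, of x]
  note c4 = surf[THEN conjunct2, THEN conjunct2, THEN conjunct2, THEN conjunct1, THEN spec, of x]
  note c5 = surf[THEN conjunct2, THEN conjunct2, THEN conjunct2, THEN conjunct2, THEN spec, of x]
  show "V (V x) = x" "V x \<noteq> x" by (rule c1[THEN conjunct1], rule c1[THEN conjunct2])
  show "E (E x) = x" "E x \<noteq> x" by (rule c2[THEN conjunct1], rule c2[THEN conjunct2])
  show "F (F x) = x" "F x \<noteq> x" by (rule c3[THEN conjunct1], rule c3[THEN conjunct2])
  show "E (V x) \<noteq> x" by (rule c4[THEN conjunct2])
  show "F (V x) = V (F x)" "V (F x) \<noteq> x" by (rule c5[THEN conjunct1, symmetric], rule c5[THEN conjunct2])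
qed

lemmas ne_sym [simp] = V_ne[THEN not_sym] E_ne[THEN not_sym] F_ne[THEN not_sym] VF_ne[THEN not_sym]
  EV_ne[THEN not_sym]

text \<open>The order three of \<open>rot\<close> as a braid relation. As a rewrite rule it brings
  every word in \<open>V\<close> and \<open>E\<close> to one of the six in
  \<open>triangle_flags_eq\<close>.\<close>

lemma EVE [simp]: "E (V (E x)) = V (E (V x))"
proof -
  have "E (V (E (V (E (V (V x)))))) = V x"
    by (rule surface[unfolded surface_triangulation_def rot_def, THEN conjunct2, THEN conjunct2,
          THEN conjunct2, THEN conjunct1, THEN spec, THEN conjunct1])
  then have "E (E (V (E (V (E x))))) = E (V x)" by (simp only: VV)
  then have "V (V (E (V (E x)))) = V (E (V x))" by (simp only: EE)
  then show ?thesis by (simp only: VV)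
qed

lemma rot_eq: "rot T x = E (V x)" "rot T (rot T x) = V (E x)"
  by (simp_all add: rot_def)

lemma V_eq_iff: "V x = y \<longleftrightarrow> x = V y"
  and F_eq_iff: "F x = y \<longleftrightarrow> x = F y"
  by auto

lemma triangle_ne [simp]: "V (E x) \<noteq> x" "E x \<noteq> V x" "V (E (V x)) \<noteq> x"
proof -
  have 1: "E x \<noteq> V x" for x
  proof
    assume "E x = V x"
    then have "E (E x) = E (V x)" by (rule arg_cong)
    then have "x = E (V x)" by (simp only: EE)
    with EV_ne[of x] show False by metis
  qed
  then show "E x \<noteq> V x" .
  show "V (E x) \<noteq> x"
  proof
    assume "V (E x) = x"
    then have "V (V (E x)) = V x" by (rule arg_cong)
    with 1[of x] show False by (simp only: VV)
  qed
  show "V (E (V x)) \<noteq> x"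
  proof
    assume "V (E (V x)) = x"
    then have "V (V (E (V x))) = V x" by (rule arg_cong)
    with E_ne[of "V x"] show False by (simp only: VV)
  qed
qed

lemmas triangle_ne_sym [simp] = triangle_ne[THEN not_sym]

lemma triangle_flags_eq:
  "triangle_flags T x = {x, V x, E x, V (E x), E (V x), V (E (V x))}"
  by (auto simp: triangle_flags_def rot_eq)

lemma triangle_flags_closed:
  assumes "y \<in> triangle_flags T x"
  shows "V y \<in> triangle_flags T x" "E y \<in> triangle_flags T x"
  using assms unfolding triangle_flags_eq by (elim insertE emptyE; simp)+

lemma triangle_flags_closed_iff [simp]:
  "V y \<in> triangle_flags T x \<longleftrightarrow> y \<in> triangle_flags T x"
  "E y \<in> triangle_flags T x \<longleftrightarrow> y \<in> triangle_flags T x"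
  using triangle_flags_closed[of "V y" x] triangle_flags_closed[of "E y" x] triangle_flags_closed[of y x]
  unfolding VV EE by (rule_tac [!] iffI)

end

text \<open>
  Corners of triangles are placed in the plane together with a weight, such that
  \<open>w\<^sub>i - w\<^sub>j = d\<^sub>i\<^sub>j\<^sup>2 - d\<^sub>j\<^sub>i\<^sup>2\<close>; the weights exist locally because the right-hand sides sum up to \<open>0\<close>
  around a triangle.  The moment of an edge is then \<open>\<ell>\<^sub>i\<^sub>j d\<^sub>i\<^sub>j\<close>, the inner product of the edge with
  the vector from its first corner to the center of the triangle.
\<close>

type_synonym lifted = "complex \<times> real"

definition moment :: "lifted \<Rightarrow> lifted \<Rightarrow> real" where
  "moment P Q = ((dist (fst P) (fst Q))\<^sup>2 + snd P - snd Q) / 2"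

definition edge_moment :: "'f triangulation \<Rightarrow> ('f \<Rightarrow> real) \<Rightarrow> 'f \<Rightarrow> real" where
  "edge_moment T d x = edge_length T d x * d x"

definition cross :: "complex \<Rightarrow> complex \<Rightarrow> real" where
  "cross z w = Re z * Im w - Im z * Re w"

locale duality =
  fixes T :: "'f::finite triangulation" and d :: "'f \<Rightarrow> real"
  assumes duality: "duality_triangulation T d"

sublocale duality \<subseteq> flag_surface
  using duality unfolding duality_triangulation_def by unfold_locales (elim conjE)

context duality begin

abbreviation "len \<equiv> edge_length T d"
abbreviation "em \<equiv> edge_moment T d"
definition "uu x = Re (pos_k T d x)"
definition "vv x = Im (pos_k T d x)"
text \<open>Solution \<open>h\<close> of \<open>uu x * d x + vv x * h = em (E x)\<close>, which puts
  the point at height \<open>h\<close> over the center of \<open>ij\<close> onto the perpendicular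
  through the center of \<open>ik\<close>.\<close>

definition "hh x = (em (E x) - uu x * d x) / vv x"
definition "om x = (d x)\<^sup>2 - (d (V x))\<^sup>2"

lemma dF [simp]: "d (F x) = d x"
  using duality unfolding duality_triangulation_def by blast

lemma dVF [simp]: "d (V (F x)) = d (V x)"
  using dF[of "V x"] by simp

lemma len_V [simp]: "len (V x) = len x" and len_F [simp]: "len (F x) = len x"
  by (simp_all add: edge_length_def)

lemma om_V [simp]: "om (V x) = - om x"
  by (simp add: om_def)

lemma om_F [simp]: "om (F x) = om x"
  by (simp add: om_def)

lemma len_pos [simp]: "0 < len x"
  using duality unfolding duality_triangulation_def by blast

lemma len_ne [simp]: "len x \<noteq> 0"
  using len_pos[of x] by linarith

lemma len_ineq: "len x < len (E (V x)) + len (E x)"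
proof -
  have "len x < len (rot T x) + len (rot T (rot T x))"
    using duality unfolding duality_triangulation_def by blast
  then show ?thesis by (simp add: rot_eq)
qed

lemma om_sum: "om x + om (E (V x)) = om (E x)"
proof -
  have "(d x)\<^sup>2 + (d (rot T x))\<^sup>2 + (d (rot T (rot T x)))\<^sup>2 =
          (d (V x))\<^sup>2 + (d (V (rot T x)))\<^sup>2 + (d (V (rot T (rot T x))))\<^sup>2"
    using duality unfolding duality_triangulation_def by blast
  then show ?thesis by (simp add: rot_eq om_def)
qed

lemma em_eq: "em x = ((len x)\<^sup>2 + om x) / 2"
  by (simp add: edge_moment_def om_def edge_length_def power2_eq_square field_simps)

lemma em_V: "em x + em (V x) = (len x)\<^sup>2" "em x - em (V x) = om x"
  by (simp_all add: em_eq field_simps)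

lemma uu_eq: "uu x = ((len x)\<^sup>2 + (len (E x))\<^sup>2 - (len (E (V x)))\<^sup>2) / (2 * len x)"
  by (simp add: uu_def pos_k_def Let_def rot_eq)

text \<open>Heron's formula: multiplied by \<open>(2 * a)\<^sup>2\<close>, the difference is the
  perimeter times the three excesses in the triangle inequalities.\<close>

lemma heron:
  fixes a b c :: real
  assumes "0 < a" "0 < b" "0 < c" "a < b + c" "b < a + c" "c < a + b"
  shows "0 < b\<^sup>2 - ((a\<^sup>2 + b\<^sup>2 - c\<^sup>2) / (2 * a))\<^sup>2"
proof -
  have "0 < (a + b - c) * (a + b + c) * ((c - a + b) * (c + a - b))"
    using assms by (intro mult_pos_pos) auto
  also have "\<dots> = (2 * a)\<^sup>2 * b\<^sup>2 - (a\<^sup>2 + b\<^sup>2 - c\<^sup>2)\<^sup>2"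
    by (simp add: power2_eq_square algebra_simps)
  also have "\<dots> = (2 * a)\<^sup>2 * (b\<^sup>2 - ((a\<^sup>2 + b\<^sup>2 - c\<^sup>2) / (2 * a))\<^sup>2)"
    using assms by (simp add: power_divide right_diff_distrib)
  finally show ?thesis
    using assms by (simp add: zero_less_mult_iff)
qed

lemma vv_pos [simp]: "0 < vv x" and vv_sq: "(uu x)\<^sup>2 + (vv x)\<^sup>2 = (len (E x))\<^sup>2"
proof -
  have "len (E x) < len (V (E (V x))) + len x" "len (E (V x)) < len x + len (V (E x))"
    using len_ineq[of "E x"] len_ineq[of "E (V x)"] len_V[of "E (V x)"] by simp_all
  then have "0 < (len (E x))\<^sup>2 - (uu x)\<^sup>2"
    unfolding uu_eq using len_ineq[of x] by (intro heron) (simp_all add: add.commute)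
  moreover have "vv x = sqrt ((len (E x))\<^sup>2 - (uu x)\<^sup>2)"
    unfolding vv_def uu_def by (simp add: pos_k_def Let_def)
  ultimately show "0 < vv x" "(uu x)\<^sup>2 + (vv x)\<^sup>2 = (len (E x))\<^sup>2"
    by simp_all
qed

lemma vv_ne [simp]: "vv x \<noteq> 0"
  using vv_pos[of x] by linarith

lemma pos_k_eq: "pos_k T d x = Complex (uu x) (vv x)"
  by (simp add: uu_def vv_def)

lemma pos_l_eq: "pos_l T d x = Complex (uu (F x)) (- vv (F x))"
  by (simp add: pos_l_def pos_k_eq complex_eq_iff)

lemma len_uu: "2 * len x * uu x = (len x)\<^sup>2 + (len (E x))\<^sup>2 - (len (E (V x)))\<^sup>2"
  by (simp add: uu_eq)

lemma opp_sq: "(len x - uu x)\<^sup>2 + (vv x)\<^sup>2 = (len (E (V x)))\<^sup>2"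
  using len_uu[of x] vv_sq[of x] by (simp add: power2_eq_square algebra_simps)

lemma uu_V: "uu (V x) = len x - uu x"
  by (simp add: uu_eq field_simps power2_eq_square)

lemma vv_V [simp]: "vv (V x) = vv x"
proof -
  have "(vv (V x))\<^sup>2 = (vv x)\<^sup>2"
    using vv_sq[of "V x"] opp_sq[of x] by (simp add: uu_V)
  then show ?thesis by (smt (verit) power2_eq_imp_eq vv_pos)
qed

lemma uu_E: "len (E x) * uu (E x) = len x * uu x"
  by (simp add: uu_eq)

lemma vv_E: "len (E x) * vv (E x) = len x * vv x"
proof -
  have "(len (E x) * vv (E x))\<^sup>2 + (len (E x) * uu (E x))\<^sup>2 = (len x * vv x)\<^sup>2 + (len x * uu x)\<^sup>2"
    unfolding power_mult_distrib distrib_left[symmetric] add.commute[of "(vv _)\<^sup>2"]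
    using vv_sq[of "E x"] vv_sq[of x] by simp
  then have "(len (E x) * vv (E x))\<^sup>2 = (len x * vv x)\<^sup>2"
    by (simp only: uu_E)
  then show ?thesis
    by (smt (verit) power2_eq_imp_eq vv_pos len_pos mult_pos_pos)
qed

text \<open>This is the concurrence of the three perpendiculars: from the end \<open>j\<close> the
  height is computed with the perpendicular to \<open>jk\<close> instead of \<open>ik\<close>. The
  condition on \<open>d\<close> enters through \<open>om_sum\<close>.\<close>

lemma hh_V [simp]: "hh (V x) = hh x"
proof -
  have "em (E (V x)) - (len x - uu x) * d (V x) = em (E x) - uu x * d x"
    using om_sum[of x] len_uu[of x] em_eq[of "E x"] em_eq[of "E (V x)"]
      em_eq[of "x"] em_V[of x]
    by (simp add: edge_moment_def edge_length_def om_def power2_eq_square algebra_simps)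
  then show ?thesis by (simp add: hh_def uu_V)
qed

lemma triangle_center_eq: "triangle_center T d x = Complex (d x) (hh x)"
proof -
  define p q r where "p = pos_i" and "q = pos_j T d x" and "r = pos_k T d x"
  have p: "p = 0" and q: "q = Complex (len x) 0" and r: "r = Complex (uu x) (vv x)"
    by (simp_all add: p_def q_def r_def pos_i_def pos_j_def pos_k_eq complex_eq_iff)
  have nqp: "norm (q - p) = len x" using len_pos[of x] by (simp add: p q cmod_def abs_of_pos)
  have npr: "norm (p - r) = len (E x)"
    using len_pos[of "E x"] by (simp add: p r cmod_def vv_sq abs_of_pos)
  have nrq: "norm (r - q) = len (E (V x))"
    using len_pos[of "E (V x)"] opp_sq[of x] by (simp add: q r cmod_def power2_commute abs_of_pos)
  have pt: "inner (c - point_at a b t) (b - a) = inner (c - a) (b - a) - t * norm (b - a)" for a b c t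
  proof (cases "a = b")
    case False
    then show ?thesis
      by (simp add: point_at_def sgn_div_norm inner_diff_left inner_add_left dot_square_norm power2_eq_square)
  qed (simp add: point_at_def)
  have ecV: "em (V (E x)) = (len (E x))\<^sup>2 - em (E x)" using em_V[of "E x"] by simp
  have e1: "inner (c - point_at p q (d x)) (q - p) = 0 \<longleftrightarrow> Re c = d x" for c
    unfolding pt nqp by (simp add: p q inner_complex_def)
  have e3: "inner (c - point_at r p (d (rot T (rot T x)))) (p - r) = 0 \<longleftrightarrow> uu x * Re c + vv x * Im c = em (E x)" for c
    unfolding pt npr rot_eq
    using vv_sq[of x] ecV
    by (auto simp: p r inner_complex_def edge_moment_def power2_eq_square algebra_simps)
  \<comment> \<open>Two perpendiculars determine the point; that the one to \<open>jk\<close> passes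
    through it follows from \<open>om_sum\<close>.\<close>
  have e2: "inner (c - point_at q r (d (rot T x))) (r - q) = 0"
    if "Re c = d x" "uu x * Re c + vv x * Im c = em (E x)" for c
  proof -
    have "inner (c - q) (r - q) = em (E x) - em x - len x * uu x + (len x)\<^sup>2"
      using that by (simp add: q r inner_complex_def edge_moment_def power2_eq_square algebra_simps)
    also have "\<dots> = em (E (V x))"
      using len_uu[of x] om_sum[of x] em_eq[of x] em_eq[of "E x"] em_eq[of "E (V x)"]
      by (simp add: field_simps)
    finally show ?thesis
      unfolding pt nrq rot_eq by (simp add: edge_moment_def)
  qed
  have iff: "uu x * d x + vv x * y = em (E x) \<longleftrightarrow> y = hh x" for y
    by (auto simp: hh_def field_simps)
  show ?thesis
    unfolding triangle_center_def Let_def p_def[symmetric] q_def[symmetric] r_def[symmetric]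
  proof (rule the_equality)
    show "inner (Complex (d x) (hh x) - point_at p q (d x)) (q - p) = 0 \<and>
      inner (Complex (d x) (hh x) - point_at q r (d (rot T x))) (r - q) = 0 \<and>
      inner (Complex (d x) (hh x) - point_at r p (d (rot T (rot T x)))) (p - r) = 0"
      unfolding e1 e3 using iff by (auto intro!: e2)
  next
    fix c assume "inner (c - point_at p q (d x)) (q - p) = 0 \<and>
      inner (c - point_at q r (d (rot T x))) (r - q) = 0 \<and>
      inner (c - point_at r p (d (rot T (rot T x)))) (p - r) = 0"
    then have "Re c = d x" "uu x * Re c + vv x * Im c = em (E x)"
      unfolding e1 e3 by auto
    then show "c = Complex (d x) (hh x)"
      using iff by (auto simp: complex_eq_iff)
  qed
qed

lemma signed_height_eq: "signed_height T d x = hh x"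
proof -
  have "edge_center T d x = Complex (d x) 0"
    by (simp add: edge_center_def point_at_def pos_i_def pos_j_def sgn_div_norm complex_eq_iff abs_of_pos)
  then show ?thesis
    by (simp add: signed_height_def triangle_center_eq dist_norm cmod_def sgn_mult_abs)
qed

lemma dual_length_eq: "dual_length T d x = hh x + hh (F x)"
  by (simp add: dual_length_def signed_height_eq)

lemma dual_length_V: "dual_length T d (V x) = dual_length T d x"
  by (simp add: dual_length_eq)

end

section \<open>Edges that are not regular are flippable\<close>

lemma extreme_point_if_separated:
  fixes w :: "'a::euclidean_space"
  assumes "finite S" and "\<And>q. q \<in> S \<Longrightarrow> inner w p < inner w q"
  shows "p extreme_point_of (convex hull (insert p S))"
proof (rule extreme_point_of_convex_hull_insert)
  have "convex hull S \<subseteq> {z. inner w z > inner w p}"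
    using assms(2) by (intro hull_minimal convex_halfspace_gt) auto
  then show "p \<notin> convex hull S" by auto
qed (rule assms(1))

lemma not_extreme_pointI:
  assumes "p \<in> open_segment y z" "y \<in> convex hull S" "z \<in> convex hull S"
  shows "\<not> p extreme_point_of (convex hull S)"
  using assms by (auto simp: extreme_point_of_def)

text \<open>The two inequalities say \<open>0 < c < a\<close> for the point \<open>c\<close> where
  the segment between the upper and the lower corner meets the real axis. These two corners are
  always extreme, each being alone on its side of the axis.\<close>

lemma kite_extreme_iff:
  fixes a u v u' v' :: real
  assumes a: "0 < a" and v: "0 < v" and v': "0 < v'"
  defines "Q \<equiv> {0, complex_of_real a, Complex u v, Complex u' (- v')}"
  shows "(\<forall>p\<in>Q. p extreme_point_of (convex hull Q)) \<longleftrightarrow>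
    0 < u * v' + u' * v \<and> 0 < (a - u) * v' + (a - u') * v"
proof
  assume ext: "\<forall>p\<in>Q. p extreme_point_of (convex hull Q)"
  define c where "c = (u * v' + u' * v) / (v + v')"
  have vv: "0 < v + v'" "v + v' \<noteq> 0" using v v' by auto
  have c_seg: "complex_of_real c \<in> open_segment (Complex u v) (Complex u' (- v'))"
    unfolding in_segment
  proof (intro conjI exI[of _ "v / (v + v')"])
    show "complex_of_real c = (1 - v / (v + v')) *\<^sub>R Complex u v + (v / (v + v')) *\<^sub>R Complex u' (- v')"
    proof -
      have "1 - v / (v + v') = v' / (v + v')" using vv by (simp add: field_simps)
      then show ?thesis by (simp add: c_def complex_eq_iff add_divide_distrib mult.commute)
    qed
  qed (use v v' in \<open>auto simp: field_simps\<close>)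
  have c_hull: "complex_of_real c \<in> convex hull Q"
  proof -
    have "closed_segment (Complex u v) (Complex u' (- v')) \<subseteq> convex hull Q"
      by (intro closed_segment_subset hull_inc convex_convex_hull) (auto simp: Q_def)
    then show ?thesis using c_seg segment_open_subset_closed by blast
  qed
  have in_Q: "0 \<in> convex hull Q" "complex_of_real a \<in> convex hull Q"
    "Complex u v \<in> convex hull Q" "Complex u' (- v') \<in> convex hull Q"
    by (auto intro!: hull_inc simp: Q_def)
  have e0: "0 extreme_point_of (convex hull Q)" and ea: "complex_of_real a extreme_point_of (convex hull Q)"
    using ext by (auto simp: Q_def)
  have real_seg: "complex_of_real y \<in> open_segment (complex_of_real x) (complex_of_real z)" if "x < y" "y < z" for x y z
    unfolding in_segment
  proof (intro conjI exI[of _ "(y - x) / (z - x)"])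
    show "complex_of_real y = (1 - (y - x) / (z - x)) *\<^sub>R complex_of_real x + ((y - x) / (z - x)) *\<^sub>R complex_of_real z"
    proof -
      have "1 - (y - x) / (z - x) = (z - y) / (z - x)" using that by (simp add: field_simps)
      moreover have "(z - y) / (z - x) * x + (y - x) / (z - x) * z = ((z - x) * y) / (z - x)"
        by (simp add: algebra_simps add_divide_distrib diff_divide_distrib)
      ultimately show ?thesis using that by (simp add: complex_eq_iff)
    qed
  qed (use that in \<open>auto simp: field_simps\<close>)
  have "0 < c"
  proof (rule ccontr)
    assume "\<not> 0 < c"
    then consider "c < 0" | "c = 0" by linarith
    then show False
    proof cases
      case 1
      then have "0 \<in> open_segment (complex_of_real c) (complex_of_real a)"
        using real_seg[of c 0 a] a by simp
      then show ?thesis using not_extreme_pointI c_hull in_Q e0 by blast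
    next
      case 2
      then show ?thesis using not_extreme_pointI c_seg in_Q e0 by (metis of_real_0)
    qed
  qed
  moreover have "c < a"
  proof (rule ccontr)
    assume "\<not> c < a"
    then consider "c > a" | "c = a" by linarith
    then show False
    proof cases
      case 1
      then have "complex_of_real a \<in> open_segment 0 (complex_of_real c)"
        using real_seg[of 0 a c] a by simp
      then show ?thesis using not_extreme_pointI c_hull in_Q ea by blast
    next
      case 2
      then show ?thesis using not_extreme_pointI c_seg in_Q ea by metis
    qed
  qed
  ultimately show "0 < u * v' + u' * v \<and> 0 < (a - u) * v' + (a - u') * v"
    using vv by (simp add: c_def field_simps zero_less_divide_iff)
next
  assume sc: "0 < u * v' + u' * v \<and> 0 < (a - u) * v' + (a - u') * v"
  have ext: "p extreme_point_of (convex hull Q)"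
    if "Q = insert p S" "finite S" "\<And>q. q \<in> S \<Longrightarrow> inner w p < inner w q" for p S w
    using extreme_point_if_separated[of S w p] that by simp
  have "- u / v < u' / v'"
    using sc v v' by (simp add: field_simps)
  \<comment> \<open>For exactly these slopes the linear form \<open>Complex 1 m\<close> is positive
    at the other three corners.\<close>
  then obtain m where m: "- u / v < m" "m < u' / v'" using dense by blast
  have 0: "0 extreme_point_of (convex hull Q)"
    by (rule ext[where w = "Complex 1 m" and S = "{complex_of_real a, Complex u v, Complex u' (- v')}"])
      (use m a v v' in \<open>auto simp: Q_def inner_complex_def field_simps\<close>)
  have "- (a - u) / v < (a - u') / v'"
    using sc v v' by (simp add: field_simps)
  then obtain m where m: "- (a - u) / v < m" "m < (a - u') / v'" using dense by blast
  have 1: "complex_of_real a extreme_point_of (convex hull Q)"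
    by (rule ext[where w = "Complex (-1) m" and S = "{0, Complex u v, Complex u' (- v')}"])
      (use m a v v' in \<open>auto simp: Q_def inner_complex_def field_simps\<close>)
  have 2: "Complex u v extreme_point_of (convex hull Q)"
    by (rule ext[where w = "Complex 0 (-1)" and S = "{0, complex_of_real a, Complex u' (- v')}"])
      (use v v' in \<open>auto simp: Q_def inner_complex_def\<close>)
  have 3: "Complex u' (- v') extreme_point_of (convex hull Q)"
    by (rule ext[where w = "Complex 0 1" and S = "{0, complex_of_real a, Complex u v}"])
      (use v v' in \<open>auto simp: Q_def inner_complex_def\<close>)
  show "\<forall>p\<in>Q. p extreme_point_of (convex hull Q)"
    using 0 1 2 3 by (simp add: Q_def)
qed

context duality begin

text \<open>Divided by \<open>vv x * vv (F x)\<close>, the first inequality says that the cotangents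
  of the two angles at \<open>i\<close> have a positive sum, so that these angles add up to less
  than \<pi>. The second one says the same at \<open>j\<close>.\<close>

definition convex_hinge :: "'f \<Rightarrow> bool" where
  "convex_hinge x \<longleftrightarrow> 0 < uu x * vv (F x) + uu (F x) * vv x \<and>
     0 < (len x - uu x) * vv (F x) + (len x - uu (F x)) * vv x"

lemma flippable_iff: "flippable T d x \<longleftrightarrow> F x \<notin> triangle_flags T x \<and> convex_hinge x"
  unfolding flippable_def Let_def pos_i_def pos_j_def pos_k_eq pos_l_eq convex_hinge_def
  by (subst kite_extreme_iff) simp_all

lemma hh_E: "len (E x) = len x \<Longrightarrow> hh (E x) = (len x * d x - uu x * d (E x)) / vv x"
  using uu_E[of x] vv_E[of x] by (simp add: hh_def edge_moment_def)

lemma uu_less: "uu x < len (E x)"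
  using vv_sq[of x] vv_pos[of x] len_pos[of "E x"]
  by (smt (verit) power2_less_imp_less zero_less_power2)

text \<open>If \<open>ij\<close> is glued to \<open>ik\<close>, both heights belong to one isosceles
  triangle, and their sum is \<open>(len y - uu y) * (d y + d (E y)) / vv y\<close>, where
  \<open>uu y < len (E y) = len y\<close>.\<close>

lemma dual_length_pos_if_glued:
  assumes pos: "\<And>y. 0 < d y" and "F x \<in> triangle_flags T x"
  shows "0 < dual_length T d x"
proof -
  have *: "0 < dual_length T d y" if "F y = E y \<or> F y = V (E y)" for y
  proof -
    have len: "len (E y) = len y"
      using that by (elim disjE; metis len_F len_V)
    have "hh (F y) = hh (E y)" using that by (elim disjE) simp_all
    then have "dual_length T d y = (len y - uu y) * (d y + d (E y)) / vv y"
      using len by (simp add: dual_length_eq hh_E) (simp add: hh_def edge_moment_def field_simps)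
    moreover have "0 < d y + d (E y)" using pos[of y] pos[of "E y"] by simp
    ultimately show ?thesis
      using uu_less[of y] len by simp
  qed
  \<comment> \<open>An edge is not folded onto itself, so \<open>x\<close> and \<open>V x\<close>
    are excluded. A gluing of \<open>ij\<close> with \<open>jk\<close> becomes one with
    \<open>ik\<close> after passing to \<open>V x\<close>.\<close>
  have "F x = E x \<or> F x = V (E x) \<or> F x = E (V x) \<or> F x = V (E (V x))"
    using assms(2) F_ne[of x] VF_ne[of x] unfolding triangle_flags_eq by (metis VV empty_iff insert_iff)
  then consider "F x = E x \<or> F x = V (E x)" | "F (V x) = E (V x) \<or> F (V x) = V (E (V x))"
    unfolding FV by (elim disjE; simp)
  then show ?thesis
    by cases (use *[of x] *[of "V x"] in \<open>auto simp: dual_length_V\<close>)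
qed

lemma dual_length_pos_if_not_convex_at:
  assumes pos: "\<And>y. 0 < d y" and "uu x * vv (F x) + uu (F x) * vv x \<le> 0"
  shows "0 < dual_length T d x"
proof -
  have h: "- (uu y / vv y) * d y < hh y" for y
    using pos[of "E y"] by (simp add: hh_def edge_moment_def field_simps)
  have "0 \<le> - (uu x / vv x) * d x - (uu (F x) / vv (F x)) * d x"
  proof -
    have "uu x / vv x + uu (F x) / vv (F x) = (uu x * vv (F x) + uu (F x) * vv x) / (vv x * vv (F x))"
      by (simp add: field_simps)
    also have "\<dots> \<le> 0"
      using assms(2) by (intro divide_nonpos_pos mult_pos_pos) auto
    finally have "(uu x / vv x + uu (F x) / vv (F x)) * d x \<le> 0"
      using pos[of x] by (simp add: mult_nonpos_nonneg)
    then show ?thesis by (simp add: algebra_simps)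
  qed
  then show ?thesis
    using h[of x] h[of "F x"] by (simp add: dual_length_eq)
qed

lemma flippable_if_not_regular:
  assumes pos: "\<And>y. 0 < d y" and "dual_length T d x \<le> 0"
  shows "flippable T d x"
proof -
  have "\<not> (len x - uu x) * vv (F x) + (len x - uu (F x)) * vv x \<le> 0"
    using dual_length_pos_if_not_convex_at[OF pos, of "V x"] assms(2)
    unfolding FV vv_V uu_V dual_length_V len_F by linarith
  moreover have "\<not> uu x * vv (F x) + uu (F x) * vv x \<le> 0"
    using dual_length_pos_if_not_convex_at[OF pos, of x] assms(2) by linarith
  moreover have "F x \<notin> triangle_flags T x"
    using dual_length_pos_if_glued[OF pos, of x] assms(2) by linarith
  ultimately show ?thesis
    by (simp add: flippable_iff convex_hinge_def)
qed

end

section \<open>Placed triangles\<close>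

lemma cross_simps:
  "cross z (w1 + w2) = cross z w1 + cross z w2" "cross (w1 + w2) z = cross w1 z + cross w2 z"
  "cross z (w1 - w2) = cross z w1 - cross z w2" "cross (w1 - w2) z = cross w1 z - cross w2 z"
  "cross z (- w) = - cross z w" "cross (- z) w = - cross z w"
  "cross z (c *\<^sub>R w) = c * cross z w" "cross (c *\<^sub>R z) w = c * cross z w" "cross z z = 0"
  by (simp_all add: cross_def algebra_simps)

lemma norm_add_less_if_cross:
  assumes "cross z w \<noteq> 0"
  shows "norm (z + w) < norm z + norm w"
proof -
  have "norm (z + w) \<noteq> norm z + norm w"
  proof
    assume "norm (z + w) = norm z + norm w"
    then have eq: "norm z *\<^sub>R w = norm w *\<^sub>R z" by (simp add: norm_triangle_eq)
    then have "norm z * cross z w = cross z (norm w *\<^sub>R z)" by (metis cross_simps(7))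
    then have "norm z * cross z w = 0" by (simp add: cross_simps)
    then show False using assms by (auto simp: cross_def)
  qed
  then show ?thesis using norm_triangle_ineq[of z w] by linarith
qed

lemma dist_less_if_cross:
  assumes "cross (q - p) (r - p) \<noteq> 0"
  shows "dist p q < dist p r + dist r q"
proof -
  have "cross (r - p) (q - r) \<noteq> 0"
    using assms by (simp add: cross_def algebra_simps)
  then have "norm ((r - p) + (q - r)) < norm (r - p) + norm (q - r)"
    by (rule norm_add_less_if_cross)
  then show ?thesis by (simp add: dist_norm norm_minus_commute)
qed

lemma moment_self [simp]: "moment P P = 0"
  by (simp add: moment_def)

lemma moment_add: "moment P Q + moment Q P = (dist (fst P) (fst Q))\<^sup>2"
  and moment_diff: "moment P Q - moment Q P = snd P - snd Q"
  by (simp_all add: moment_def dist_commute field_simps)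

text \<open>Moments let the six flags of the triangle enter symmetrically; \<open>placed_iff\<close>
  translates them into distances and weight differences. The orientation and the absolute size of
  the weights are left open.\<close>

definition placed :: "'f triangulation \<Rightarrow> ('f \<Rightarrow> real) \<Rightarrow> 'f \<Rightarrow>
    lifted \<Rightarrow> lifted \<Rightarrow> lifted \<Rightarrow> bool" where
  "placed T d z P Q R \<longleftrightarrow>
     moment P Q = edge_moment T d z \<and>
     moment Q P = edge_moment T d (chg_vertex T z) \<and>
     moment P R = edge_moment T d (chg_edge T z) \<and>
     moment R P = edge_moment T d (chg_vertex T (chg_edge T z)) \<and>
     moment Q R = edge_moment T d (chg_edge T (chg_vertex T z)) \<and>
     moment R Q = edge_moment T d (chg_vertex T (chg_edge T (chg_vertex T z)))"

text \<open>Twice the signed area of the triangle.\<close>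

definition area :: "lifted \<Rightarrow> lifted \<Rightarrow> lifted \<Rightarrow> real" where
  "area P Q R = cross (fst Q - fst P) (fst R - fst P)"

lemma area_swap: "area Q P R = - area P Q R" "area P R Q = - area P Q R" "area R Q P = - area P Q R"
   "area Q R P = area P Q R" "area R P Q = area P Q R"
  by (simp_all add: area_def cross_def algebra_simps)

context duality begin

lemma moments_iff:
  "moment P Q = em z \<and> moment Q P = em (V z) \<longleftrightarrow> dist (fst P) (fst Q) = len z \<and> snd P - snd Q = om z"
proof -
  have "dist (fst P) (fst Q) = len z \<longleftrightarrow> (dist (fst P) (fst Q))\<^sup>2 = (len z)\<^sup>2"
    using len_pos[of z] by (simp add: power2_eq_iff_nonneg less_imp_le)
  also have "\<dots> \<longleftrightarrow> moment P Q + moment Q P = em z + em (V z)"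
    by (simp add: moment_add em_V)
  finally show ?thesis
    using moment_diff[of P Q] em_V(2)[of z] by auto
qed

lemma placed_iff: "placed T d z P Q R \<longleftrightarrow>
    dist (fst P) (fst Q) = len z \<and> dist (fst P) (fst R) = len (E z) \<and> dist (fst Q) (fst R) = len (E (V z)) \<and>
    snd P - snd Q = om z \<and> snd P - snd R = om (E z)"
  unfolding placed_def using moments_iff[of P Q z] moments_iff[of P R "E z"] moments_iff[of Q R "E (V z)"]
    om_sum[of z] by auto

lemma placed_V [intro]: "placed T d z P Q R \<Longrightarrow> placed T d (V z) Q P R"
  and placed_E [intro]: "placed T d z P Q R \<Longrightarrow> placed T d (E z) P R Q"
  by (auto simp: placed_def)

text \<open>The values \<open>1\<close> and \<open>-1\<close> of \<sigma> give the two candidates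
  for the third corner, to the left and to the right of \<open>PQ\<close>. The complex factor is the
  position of \<open>k\<close> (or its conjugate) when \<open>ij\<close> is scaled to length
  one.\<close>

definition third :: "real \<Rightarrow> 'f \<Rightarrow> lifted \<Rightarrow> lifted \<Rightarrow> lifted" where
  "third \<sigma> z P Q =
     (fst P + Complex (uu z / len z) (\<sigma> * vv z / len z) * (fst Q - fst P), snd P - om (E z))"

lemma area_third:
  assumes "dist (fst P) (fst Q) = len z"
  shows "area P Q (third \<sigma> z P Q) = \<sigma> * vv z * len z"
proof -
  have "cross e (Complex a b * e) = b * (norm e)\<^sup>2" for a b e
    unfolding cmod_power2 by (simp add: cross_def power2_eq_square algebra_simps)
  then show ?thesis
    using assms by (simp add: area_def third_def dist_norm norm_minus_commute power2_eq_square)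
qed

lemma placed_third:
  assumes "dist (fst P) (fst Q) = len z" "snd P - snd Q = om z" "\<sigma>\<^sup>2 = 1"
  shows "placed T d z P Q (third \<sigma> z P Q)"
proof -
  define \<kappa> where "\<kappa> = Complex (uu z / len z) (\<sigma> * vv z / len z)"
  have e: "norm (fst Q - fst P) = len z" using assms(1) by (simp add: dist_norm norm_minus_commute)
  have "(norm \<kappa> * len z)\<^sup>2 = (uu z)\<^sup>2 + (vv z)\<^sup>2"
    using assms(3) by (simp add: \<kappa>_def power_mult_distrib cmod_power2 power_divide field_simps)
  then have 1: "norm \<kappa> * len z = len (E z)"
    by (simp add: vv_sq power2_eq_iff_nonneg less_imp_le)
  have "(norm (1 - \<kappa>) * len z)\<^sup>2 = ((Re (1 - \<kappa>) * len z))\<^sup>2 + (Im (1 - \<kappa>) * len z)\<^sup>2"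
    by (simp add: power_mult_distrib cmod_power2 distrib_right)
  also have "Re (1 - \<kappa>) * len z = len z - uu z"
    by (simp add: \<kappa>_def field_simps)
  also have "(Im (1 - \<kappa>) * len z)\<^sup>2 = (vv z)\<^sup>2"
    using assms(3) by (simp add: \<kappa>_def power_mult_distrib)
  finally have 2: "norm (1 - \<kappa>) * len z = len (E (V z))"
    by (simp add: opp_sq power2_eq_iff_nonneg less_imp_le)
  have "fst Q - (fst P + \<kappa> * (fst Q - fst P)) = (1 - \<kappa>) * (fst Q - fst P)"
    by (simp add: algebra_simps)
  then show ?thesis
    unfolding placed_iff third_def \<kappa>_def[symmetric]
    using assms(1,2) 1 2 e by (simp add: dist_norm norm_mult)
qed

text \<open>For the ratio \<kappa> of the two sides at \<open>P\<close>, the law of cosines gives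
  the real part, the length of \<open>PR\<close> then gives the imaginary part up to sign, and the
  sign is that of the area.\<close>

lemma third_if_placed:
  assumes "placed T d z P Q R"
  shows "R = third (sgn (area P Q R)) z P Q" "area P Q R \<noteq> 0"
proof -
  have pl: "dist (fst P) (fst Q) = len z" "dist (fst P) (fst R) = len (E z)" "dist (fst Q) (fst R) = len (E (V z))"
    "snd P - snd Q = om z" "snd P - snd R = om (E z)"
    using assms by (auto simp: placed_iff)
  define e where "e = fst Q - fst P"
  define \<kappa> where "\<kappa> = (fst R - fst P) / e"
  have e: "norm e = len z" using pl by (simp add: e_def dist_norm norm_minus_commute)
  then have e0: "e \<noteq> 0" by auto
  then have R: "fst R = fst P + \<kappa> * e" by (simp add: \<kappa>_def)
  have "norm \<kappa> * len z = len (E z)"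
    using pl(2) e R by (simp add: dist_norm norm_mult)
  then have "(norm \<kappa> * len z)\<^sup>2 = (len (E z))\<^sup>2" by simp
  then have 1: "(Re \<kappa> * len z)\<^sup>2 + (Im \<kappa> * len z)\<^sup>2 = (len (E z))\<^sup>2"
    by (simp add: power_mult_distrib cmod_power2 algebra_simps)
  have "fst Q - fst R = (1 - \<kappa>) * e" unfolding R by (simp add: e_def algebra_simps)
  then have "norm (1 - \<kappa>) * len z = len (E (V z))"
    using pl(3) e by (simp add: dist_norm norm_mult)
  then have "(norm (1 - \<kappa>) * len z)\<^sup>2 = (len (E (V z)))\<^sup>2" by simp
  then have 2: "((1 - Re \<kappa>) * len z)\<^sup>2 + (Im \<kappa> * len z)\<^sup>2 = (len (E (V z)))\<^sup>2"
    by (simp add: power_mult_distrib cmod_power2 distrib_right)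
  have 3: "Re \<kappa> * len z = uu z"
  proof -
    have "2 * len z * (Re \<kappa> * len z) = 2 * len z * uu z"
      using 1 2 by (simp add: len_uu) (simp add: power2_eq_square algebra_simps)
    then show ?thesis by simp
  qed
  then have 4: "(Im \<kappa> * len z)\<^sup>2 = (vv z)\<^sup>2"
    using 1 vv_sq[of z] by simp
  have "cross e (k * e) = Im k * (norm e)\<^sup>2" for k
    unfolding cmod_power2 by (simp add: cross_def power2_eq_square algebra_simps)
  then have a: "area P Q R = Im \<kappa> * (len z)\<^sup>2"
    using e by (simp add: area_def R e_def)
  have i: "Im \<kappa> \<noteq> 0" using 4 by auto
  have "Im \<kappa> * len z = sgn (area P Q R) * vv z"
  proof -
    have "sgn (area P Q R) = sgn (Im \<kappa>)" unfolding a by (simp add: sgn_mult)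
    moreover have "\<bar>Im \<kappa> * len z\<bar> = \<bar>vv z\<bar>" using 4 by (simp only: power2_eq_iff abs_eq_iff)
    then have "\<bar>Im \<kappa>\<bar> * len z = vv z" by (simp add: abs_mult abs_of_pos)
    ultimately show ?thesis using i by (auto simp: sgn_real_def abs_if split: if_splits)
  qed
  then have "\<kappa> = Complex (uu z / len z) (sgn (area P Q R) * vv z / len z)"
    using 3 by (simp add: complex_eq_iff field_simps)
  then show "R = third (sgn (area P Q R)) z P Q"
    using R pl(5) by (simp add: third_def e_def prod_eq_iff)
  show "area P Q R \<noteq> 0" using a i by simp
qed

lemma placed_unique:
  assumes "placed T d z P Q R" "placed T d z P Q R'" "0 < area P Q R * area P Q R'"
  shows "R = R'"
proof -
  have "sgn (area P Q R) = sgn (area P Q R')"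
    using assms(3) by (auto simp: sgn_real_def zero_less_mult_iff)
  then show ?thesis using third_if_placed assms(1,2) by metis
qed

lemma placed_exists:
  assumes "dist (fst P) (fst Q) = len z" "snd P - snd Q = om z" "a \<noteq> 0"
  obtains R where "placed T d z P Q R" "0 < a * area P Q R"
proof
  have "(sgn a)\<^sup>2 = 1" using assms(3) by (simp add: sgn_real_def)
  then show "placed T d z P Q (third (sgn a) z P Q)"
    using placed_third assms by blast
  have "0 < \<bar>a\<bar> * (vv z * len z)" using assms(3) by simp
  then show "0 < a * area P Q (third (sgn a) z P Q)"
    unfolding area_third[OF assms(1)] by (simp add: mult.assoc flip: abs_sgn mult.assoc)
qed

lemma placed_opposite_exists:
  assumes "placed T d z P Q R"
  obtains R' where "placed T d (F z) P Q R'" "area P Q R * area P Q R' < 0"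
proof -
  have "dist (fst P) (fst Q) = len (F z)" "snd P - snd Q = om (F z)"
    using assms by (auto simp: placed_iff)
  moreover have "- area P Q R \<noteq> 0" using third_if_placed(2)[OF assms] by simp
  ultimately obtain R' where "placed T d (F z) P Q R'" "0 < - area P Q R * area P Q R'"
    by (rule placed_exists)
  then show ?thesis using that by auto
qed

end

section \<open>Hinges and the crossing of their diagonals\<close>

definition hinge :: "'f triangulation \<Rightarrow> ('f \<Rightarrow> real) \<Rightarrow> 'f \<Rightarrow>
    lifted \<Rightarrow> lifted \<Rightarrow> lifted \<Rightarrow> lifted \<Rightarrow> bool" where
  "hinge T d x I J K L \<longleftrightarrow> placed T d x I J K \<and> placed T d (chg_triangle T x) I J L \<and> area I J K * area I J L < 0"

definition crossing :: "lifted \<Rightarrow> lifted \<Rightarrow> lifted \<Rightarrow> lifted \<Rightarrow>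
    real \<Rightarrow> real \<Rightarrow> bool" where
  "crossing I J K L s t \<longleftrightarrow> 0 < s \<and> s < 1 \<and> 0 < t \<and> t < 1 \<and>
     (1 - s) *\<^sub>R fst I + s *\<^sub>R fst J = (1 - t) *\<^sub>R fst K + t *\<^sub>R fst L \<and>
     cross (fst J - fst I) (fst L - fst K) \<noteq> 0"

lemma crossing_swap: "crossing I J K L s t \<Longrightarrow> crossing K L I J t s"
   "crossing I J K L s t \<Longrightarrow> crossing J I K L (1 - s) t"
   "crossing I J K L s t \<Longrightarrow> crossing I J L K s (1 - t)"
  by (auto simp: crossing_def cross_def algebra_simps)

text \<open>\<open>S\<close> is, up to sign, twice the area of the quadrilateral. Each diagonal
  splits it in the ratio in which it cuts the other diagonal.\<close>

lemma area_crossing: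
  assumes "crossing I J K L s t"
  defines "S \<equiv> cross (fst J - fst I) (fst L - fst K)"
  shows "area I J K = - t * S" "area I J L = (1 - t) * S" "area K L I = s * S" "area K L J = - (1 - s) * S"
proof -
  obtain i1 i2 wi where I: "I = (Complex i1 i2, wi)" by (metis complex_surj prod.collapse)
  obtain j1 j2 wj where J: "J = (Complex j1 j2, wj)" by (metis complex_surj prod.collapse)
  obtain k1 k2 wk where K: "K = (Complex k1 k2, wk)" by (metis complex_surj prod.collapse)
  obtain l1 l2 wl where L: "L = (Complex l1 l2, wl)" by (metis complex_surj prod.collapse)
  have 1: "(1 - s) * i1 + s * j1 = (1 - t) * k1 + t * l1" "(1 - s) * i2 + s * j2 = (1 - t) * k2 + t * l2"
    using assms by (auto simp: crossing_def I J K L complex_eq_iff)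
  show "area I J K = - t * S" "area I J L = (1 - t) * S" "area K L I = s * S" "area K L J = - (1 - s) * S"
    unfolding S_def area_def cross_def I J K L using 1 by (simp; algebra)+
qed

text \<open>\<open>moment A X\<close> is a term in \<open>A\<close> alone, plus a term in
  \<open>X\<close> alone, minus the inner product of the two positions. The coefficients have sum
  zero and annihilate the positions, so that \<open>A\<close> drops out.\<close>

lemma moment_crossing:
  assumes "crossing I J K L s t"
  shows "(1 - s) * moment A I + s * moment A J - (1 - t) * moment A K - t * moment A L =
    (1 - s) * moment B I + s * moment B J - (1 - t) * moment B K - t * moment B L"
proof -
  obtain i1 i2 wi where I: "I = (Complex i1 i2, wi)" by (metis complex_surj prod.collapse)
  obtain j1 j2 wj where J: "J = (Complex j1 j2, wj)" by (metis complex_surj prod.collapse)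
  obtain k1 k2 wk where K: "K = (Complex k1 k2, wk)" by (metis complex_surj prod.collapse)
  obtain l1 l2 wl where L: "L = (Complex l1 l2, wl)" by (metis complex_surj prod.collapse)
  obtain a1 a2 wa where A: "A = (Complex a1 a2, wa)" by (metis complex_surj prod.collapse)
  obtain b1 b2 wb where B: "B = (Complex b1 b2, wb)" by (metis complex_surj prod.collapse)
  have 1: "(1 - s) * i1 + s * j1 = (1 - t) * k1 + t * l1" "(1 - s) * i2 + s * j2 = (1 - t) * k2 + t * l2"
    using assms by (auto simp: crossing_def I J K L complex_eq_iff)
  have "2 * ((1 - s) * moment A I + s * moment A J - (1 - t) * moment A K - t * moment A L) =
    2 * ((1 - s) * moment B I + s * moment B J - (1 - t) * moment B K - t * moment B L)"
    unfolding I J K L A B moment_def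
    using 1 apply (simp add: dist_norm cmod_power2) by algebra
  then show ?thesis by simp
qed

text \<open>
  The difference of the two linear interpolations of \<open>\<bar>p\<bar>\<^sup>2 - w\<close> at the crossing of the diagonals.
\<close>

definition gap where
  "gap I J K L s t = (1 - s) * moment I I + s * moment I J - (1 - t) * moment I K - t * moment I L"

lemma gap_eq:
  assumes "crossing I J K L s t"
  shows "gap I J K L s t = s * moment I J - (1 - t) * moment I K - t * moment I L"
    "gap I J K L s t = (1 - s) * moment J I - (1 - t) * moment J K - t * moment J L"
    "gap I J K L s t = (1 - s) * moment K I + s * moment K J - t * moment K L"
    "gap I J K L s t = (1 - s) * moment L I + s * moment L J - (1 - t) * moment L K"
  unfolding gap_def using moment_crossing[OF assms, of I J] moment_crossing[OF assms, of I K]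
    moment_crossing[OF assms, of I L] by simp_all

section \<open>The flip\<close>

context flag_surface begin

lemma V_inj [simp]: "V a = V b \<longleftrightarrow> a = b" and E_inj [simp]: "E a = E b \<longleftrightarrow> a = b"
  by (metis VV, metis EE)

lemma distinct_triangle: "distinct [x, V x, E x, V (E x), E (V x), V (E (V x))]"
proof -
  have 1: "V (E (V x)) \<noteq> E x"
    unfolding EVE[symmetric] E_inj by (rule triangle_ne)
  have 2: "E (V x) \<noteq> V (E x)"
  proof
    assume "E (V x) = V (E x)"
    then have "E (E (V x)) = E (V (E x))" by (rule arg_cong)
    then show False by simp
  qed
  show ?thesis using 1 2 1[THEN not_sym] 2[THEN not_sym] by simp
qed

end

locale flip = duality +
  fixes x
  assumes flip: "flippable T d x"
begin

definition hinge_flags :: "'a set" where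
  "hinge_flags = {x, V x, E x, V (E x), E (V x), V (E (V x)),
     F x, V (F x), E (F x), V (E (F x)), E (V (F x)), V (E (V (F x)))}"

lemma hinge_flags_eq: "hinge_flags = triangle_flags T x \<union> triangle_flags T (F x)"
  by (auto simp: hinge_flags_def triangle_flags_eq)

lemma not_same_triangle: "F x \<notin> triangle_flags T x" and convex: "convex_hinge x"
  using flip by (auto simp: flippable_iff)

lemma distinct_hinge: "distinct [x, V x, E x, V (E x), E (V x), V (E (V x)),
     F x, V (F x), E (F x), V (E (F x)), E (V (F x)), V (E (V (F x)))]"
proof -
  have "triangle_flags T x \<inter> triangle_flags T (F x) = {}"
  proof -
    have "b \<notin> triangle_flags T x" if "b \<in> triangle_flags T (F x)" for b
      using that unfolding triangle_flags_eq[of "F x"]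
      by (elim insertE emptyE) (simp_all add: not_same_triangle)
    then show ?thesis by blast
  qed
  then have "set [x, V x, E x, V (E x), E (V x), V (E (V x))] \<inter>
     set [F x, V (F x), E (F x), V (E (F x)), E (V (F x)), V (E (V (F x)))] = {}"
    unfolding triangle_flags_eq by simp
  then have "distinct ([x, V x, E x, V (E x), E (V x), V (E (V x))] @
     [F x, V (F x), E (F x), V (E (F x)), E (V (F x)), V (E (V (F x)))])"
    unfolding distinct_append using distinct_triangle[of x] distinct_triangle[of "F x"] by blast
  then show ?thesis by simp
qed

abbreviation "T' \<equiv> flip_triangulation T x"
abbreviation "d' \<equiv> flip_d T d x"
abbreviation "E' \<equiv> chg_edge T'"

lemma V' [simp]: "chg_vertex T' = V" and F' [simp]: "chg_triangle T' = F"
  by (simp_all add: flip_triangulation_def Let_def)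

lemma E'_eq: "E' = E (E x := E (F x), E (F x) := E x, V (E x) := x, x := V (E x),
  V (E (F x)) := V x, V x := V (E (F x)),
  E (V x) := E (V (F x)), E (V (F x)) := E (V x), V (E (V x)) := F x, F x := V (E (V x)),
  V (E (V (F x))) := V (F x), V (F x) := V (E (V (F x))))"
  by (simp add: flip_triangulation_def Let_def)

lemma E'_simps [simp]:
  "E' (E x) = E (F x)" "E' (E (F x)) = E x" "E' (V (E x)) = x" "E' x = V (E x)"
  "E' (V (E (F x))) = V x" "E' (V x) = V (E (F x))"
  "E' (E (V x)) = E (V (F x))" "E' (E (V (F x))) = E (V x)" "E' (V (E (V x))) = F x" "E' (F x) = V (E (V x))"
  "E' (V (E (V (F x)))) = V (F x)" "E' (V (F x)) = V (E (V (F x)))"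
  using distinct_hinge distinct_hinge[THEN distinct_rev[THEN iffD2]] unfolding E'_eq
  by (simp_all add: fun_upd_def del: distinct_rev)

lemma E'_other [simp]: "z \<notin> hinge_flags \<Longrightarrow> E' z = E z"
  unfolding E'_eq hinge_flags_def by simp

lemma hinge_flags_closed [simp]: "V z \<in> hinge_flags \<longleftrightarrow> z \<in> hinge_flags" "E z \<in> hinge_flags \<longleftrightarrow> z \<in> hinge_flags"
  unfolding hinge_flags_eq by simp_all

lemma hinge_flags_cases [consumes 1]:
  assumes "z \<in> hinge_flags"
  obtains "z = x" | "z = V x" | "z = F x" | "z = V (F x)"
    | "z = E x" | "z = V (E x)" | "z = E (V x)" | "z = V (E (V x))"
    | "z = E (F x)" | "z = V (E (F x))" | "z = E (V (F x))" | "z = V (E (V (F x)))"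
  using assms unfolding hinge_flags_def by blast

definition diag where "diag = {x, V x, F x, V (F x)}"

lemma diag_hinge: "z \<in> diag \<Longrightarrow> z \<in> hinge_flags"
  by (auto simp: diag_def hinge_flags_def)

lemma not_diag [simp]:
  "E x \<notin> diag" "V (E x) \<notin> diag" "E (V x) \<notin> diag" "V (E (V x)) \<notin> diag"
  "E (F x) \<notin> diag" "V (E (F x)) \<notin> diag" "E (V (F x)) \<notin> diag" "V (E (V (F x))) \<notin> diag"
  using distinct_hinge by (auto simp: diag_def)

lemma diag_closed [simp]: "V z \<in> diag \<longleftrightarrow> z \<in> diag" "F z \<in> diag \<longleftrightarrow> z \<in> diag"
  by (auto simp: diag_def V_eq_iff F_eq_iff)

definition "s_kl = dist (pos_k T d x) (pos_l T d x)"
text \<open>The weight difference between \<open>k\<close> and \<open>l\<close>, summed along the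
  path from \<open>k\<close> over \<open>i\<close> to \<open>l\<close>. The flip system thus
  prescribes the distance \<open>s_kl\<close> and the difference \<open>om_kl\<close> of the
  squares, which means that the weights of the corners are kept.\<close>

definition "om_kl = om (V (E x)) + om (E (F x))"

lemma d'_eq: "d' = d (x := (s_kl + om_kl / s_kl) / 2, F x := (s_kl + om_kl / s_kl) / 2,
     V x := (s_kl - om_kl / s_kl) / 2, V (F x) := (s_kl - om_kl / s_kl) / 2)"
proof -
  have "(d (V (E x)))\<^sup>2 + (d (E (F x)))\<^sup>2 - (d (V (E (F x))))\<^sup>2 - (d (E x))\<^sup>2 = om_kl"
    by (simp add: om_kl_def om_def)
  then show ?thesis by (simp add: flip_d_def Let_def s_kl_def)
qed

lemma d'_simps [simp]: "d' x = (s_kl + om_kl / s_kl) / 2" "d' (F x) = (s_kl + om_kl / s_kl) / 2"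
  "d' (V x) = (s_kl - om_kl / s_kl) / 2" "d' (V (F x)) = (s_kl - om_kl / s_kl) / 2"
  using distinct_hinge by (auto simp: d'_eq)

lemma d'_other [simp]: "z \<notin> diag \<Longrightarrow> d' z = d z"
  by (auto simp: d'_eq diag_def)

lemma surface': "surface_triangulation T'"
proof -
  have 1: "E' (E' z) = z \<and> E' z \<noteq> z" for z
  proof (cases "z \<in> hinge_flags")
    case True
    then show ?thesis using distinct_hinge by (cases rule: hinge_flags_cases) auto
  qed simp
  have 2: "E' (V (E' (V (E' (V z))))) = z \<and> E' (V z) \<noteq> z" for z
  proof (cases "z \<in> hinge_flags")
    case True
    then show ?thesis using distinct_hinge by (cases rule: hinge_flags_cases) auto
  qed simp
  show ?thesis
    unfolding surface_triangulation_def rot_def V' F' using 1 2 by simp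
qed

sublocale T': flag_surface T'
  by unfold_locales (rule surface')

lemma s_kl_pos: "0 < s_kl"
proof -
  have "vv x + vv (F x) \<noteq> 0" using vv_pos[of x] vv_pos[of "F x"] by linarith
  then have "pos_k T d x \<noteq> pos_l T d x"
    by (auto simp: pos_k_eq pos_l_eq complex_eq_iff)
  then show ?thesis by (simp add: s_kl_def)
qed

lemma len'_diag: "z \<in> diag \<Longrightarrow> edge_length T' d' z = s_kl"
  by (auto simp: diag_def edge_length_def field_simps)

lemma len'_other [simp]: "z \<notin> diag \<Longrightarrow> edge_length T' d' z = len z"
  by (auto simp: edge_length_def)

lemma em'_other [simp]: "z \<notin> diag \<Longrightarrow> edge_moment T' d' z = em z"
  by (auto simp: edge_moment_def)

lemma em'_diag:
  "edge_moment T' d' x = (s_kl\<^sup>2 + om_kl) / 2" "edge_moment T' d' (F x) = (s_kl\<^sup>2 + om_kl) / 2"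
  "edge_moment T' d' (V x) = (s_kl\<^sup>2 - om_kl) / 2" "edge_moment T' d' (V (F x)) = (s_kl\<^sup>2 - om_kl) / 2"
  using s_kl_pos len'_diag[of x] len'_diag[of "V x"] len'_diag[of "F x"] len'_diag[of "V (F x)"]
  by (simp_all add: edge_moment_def diag_def field_simps power2_eq_square)

lemma hinge_exists: obtains I J K L where "hinge T d x I J K L"
proof -
  define I J where "I = (0::complex, 0::real)" and "J = (complex_of_real (len x), - om x)"
  have "dist (fst I) (fst J) = len x" "snd I - snd J = om x"
    by (simp_all add: I_def J_def abs_of_pos)
  then have K: "placed T d x I J (third 1 x I J)"
    by (rule placed_third) simp
  then obtain L where "placed T d (F x) I J L" "area I J (third 1 x I J) * area I J L < 0"
    by (rule placed_opposite_exists)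
  then show ?thesis using K that unfolding hinge_def by blast
qed

lemma hinge_thirds:
  assumes "hinge T d x I J K L"
  obtains \<sigma> where "\<sigma> = 1 \<or> \<sigma> = -1" "K = third \<sigma> x I J" "L = third (- \<sigma>) (F x) I J" "dist (fst I) (fst J) = len x"
proof -
  have h: "placed T d x I J K" "placed T d (F x) I J L" "area I J K * area I J L < 0"
    using assms by (auto simp: hinge_def)
  have "sgn (area I J L) = - sgn (area I J K)" "area I J K \<noteq> 0"
    using h(3) by (auto simp: sgn_real_def mult_less_0_iff)
  then show ?thesis
    using that[of "sgn (area I J K)"] third_if_placed[OF h(1)] third_if_placed[OF h(2)] h(1)
    by (auto simp: sgn_real_def placed_iff)
qed

text \<open>The heights of \<open>k\<close> and \<open>l\<close> over the line through
  \<open>ij\<close> determine where \<open>kl\<close> meets it; \<open>s_ij\<close> is the abscissa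
  of this point in units of the edge. Convexity of the hinge amounts to
  \<open>0 < s_ij < 1\<close>.\<close>

definition "t_kl = vv x / (vv x + vv (F x))"
definition "s_ij = ((1 - t_kl) * uu x + t_kl * uu (F x)) / len x"

lemma s_ij_bounds: "0 < s_ij" "s_ij < 1" and t_kl_bounds: "0 < t_kl" "t_kl < 1"
  and t_kl_eq: "(1 - t_kl) * vv x = t_kl * vv (F x)"
proof -
  have v: "0 < vv x" "0 < vv (F x)" "0 < vv x + vv (F x)" by (simp_all add: add_pos_pos)
  show "0 < t_kl" "t_kl < 1" "(1 - t_kl) * vv x = t_kl * vv (F x)"
    using v by (simp_all add: t_kl_def field_simps)
  have "1 - t_kl = vv (F x) / (vv x + vv (F x))" using v by (simp add: t_kl_def field_simps)
  then have "s_ij = (uu x * vv (F x) + uu (F x) * vv x) / (vv x + vv (F x)) / len x"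
    by (simp add: s_ij_def t_kl_def add_divide_distrib mult.commute)
  moreover have "0 < uu x * vv (F x) + uu (F x) * vv x"
      "uu x * vv (F x) + uu (F x) * vv x < len x * (vv x + vv (F x))"
    using convex by (simp_all add: convex_hinge_def algebra_simps)
  ultimately show "0 < s_ij" "s_ij < 1"
    using v len_pos[of x] by (simp_all add: divide_less_eq mult.commute)
qed

lemma hinge_crossing:
  assumes "hinge T d x I J K L"
  shows "crossing I J K L s_ij t_kl"
proof -
  obtain \<sigma> where \<sigma>: "\<sigma> = 1 \<or> \<sigma> = -1" "K = third \<sigma> x I J" "L = third (- \<sigma>) (F x) I J" "dist (fst I) (fst J) = len x"
    using hinge_thirds[OF assms] by blast
  define e where "e = fst J - fst I"
  have "Complex s_ij 0 = (1 - t_kl) *\<^sub>R Complex (uu x / len x) (\<sigma> * vv x / len x) +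
      t_kl *\<^sub>R Complex (uu (F x) / len x) (- \<sigma> * vv (F x) / len x)"
  proof -
    have "(1 - t_kl) * (\<sigma> * vv x) = t_kl * (\<sigma> * vv (F x))"
      by (metis t_kl_eq mult.left_commute)
    then show ?thesis
      by (simp add: complex_eq_iff s_ij_def add_divide_distrib)
  qed
  then have "s_ij *\<^sub>R e = (1 - t_kl) *\<^sub>R (Complex (uu x / len x) (\<sigma> * vv x / len x) * e) +
      t_kl *\<^sub>R (Complex (uu (F x) / len x) (- \<sigma> * vv (F x) / len x) * e)"
    by (metis (no_types, lifting) complex_of_real_def distrib_right mult_scaleR_left scaleR_conv_of_real
        Complex_eq mult_zero_right add.right_neutral of_real_0)
  then have eq: "(1 - s_ij) *\<^sub>R fst I + s_ij *\<^sub>R fst J = (1 - t_kl) *\<^sub>R fst K + t_kl *\<^sub>R fst L"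
    using \<sigma> by (simp add: third_def e_def[symmetric] algebra_simps) (simp add: e_def algebra_simps)
  have "area I J L - area I J K \<noteq> 0"
    using assms by (auto simp: hinge_def mult_less_0_iff)
  then have "cross (fst J - fst I) (fst L - fst K) \<noteq> 0"
    by (simp add: area_def cross_def algebra_simps)
  then show ?thesis
    using eq s_ij_bounds t_kl_bounds by (simp add: crossing_def)
qed

lemma hinge_dist_kl:
  assumes "hinge T d x I J K L"
  shows "dist (fst K) (fst L) = s_kl"
proof -
  obtain \<sigma> where \<sigma>: "\<sigma> = 1 \<or> \<sigma> = -1" "K = third \<sigma> x I J" "L = third (- \<sigma>) (F x) I J" "dist (fst I) (fst J) = len x"
    using hinge_thirds[OF assms] by blast
  define m where "m = (fst J - fst I) / len x"
  have e: "fst J - fst I = m * len x" by (simp add: m_def)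
  have "norm m = 1" using \<sigma>(4) by (simp add: m_def norm_divide dist_norm norm_minus_commute abs_of_pos)
  have "fst K - fst L = Complex (uu x - uu (F x)) (\<sigma> * (vv x + vv (F x))) * m"
    unfolding \<sigma>(2,3) third_def e by (simp add: complex_eq_iff field_simps)
  then have "dist (fst K) (fst L) = norm (Complex (uu x - uu (F x)) (\<sigma> * (vv x + vv (F x))))"
    using \<open>norm m = 1\<close> by (simp add: dist_norm norm_mult)
  also have "\<dots> = s_kl"
    using \<sigma>(1) by (auto simp: s_kl_def dist_norm pos_k_eq pos_l_eq cmod_def power2_eq_square algebra_simps)
  finally show ?thesis .
qed

lemma placed_other:
  assumes "z \<notin> hinge_flags"
  shows "placed T' d' z P Q R \<longleftrightarrow> placed T d z P Q R"
proof -
  have "z \<notin> diag" "E z \<notin> diag" "E (V z) \<notin> diag"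
    using assms by (auto dest: diag_hinge)
  then show ?thesis using assms by (simp add: placed_def)
qed

text \<open>A flip moves no point and changes no weight: the same four lifted points, with the roles
  of the diagonals exchanged, are a hinge of the new triangulation.\<close>

lemma hinge_flip:
  assumes "hinge T d x I J K L"
  shows "hinge T' d' x K L I J"
proof -
  have h: "placed T d x I J K" "placed T d (F x) I J L"
    using assms by (auto simp: hinge_def)
  have om: "snd K - snd L = om_kl"
    using h by (simp add: placed_iff om_kl_def)
  have 1: "moment K L = (s_kl\<^sup>2 + om_kl) / 2" "moment L K = (s_kl\<^sup>2 - om_kl) / 2"
    using moment_add[of K L] moment_diff[of K L] om hinge_dist_kl[OF assms] by auto
  have 2: "area K L I * area K L J < 0"
    using area_crossing(3,4)[OF hinge_crossing[OF assms]] s_ij_bounds hinge_crossing[OF assms]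
    by (auto simp: crossing_def mult_less_0_iff zero_less_mult_iff)
  show ?thesis
    using h 1 2 unfolding hinge_def placed_def by (simp add: em'_diag)
qed

lemma om'_eq:
  shows "z \<in> diag \<Longrightarrow> (d' z)\<^sup>2 - (d' (V z))\<^sup>2 = (if z = x \<or> z = F x then om_kl else - om_kl)"
    and "z \<notin> diag \<Longrightarrow> (d' z)\<^sup>2 - (d' (V z))\<^sup>2 = om z"
proof -
  assume "z \<in> diag"
  then have "z = x \<or> z = V x \<or> z = F x \<or> z = V (F x)" by (simp add: diag_def)
  then show "(d' z)\<^sup>2 - (d' (V z))\<^sup>2 = (if z = x \<or> z = F x then om_kl else - om_kl)"
    using distinct_hinge s_kl_pos by (elim disjE) (simp_all add: power2_eq_square field_simps)
qed (simp add: om_def)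

lemma om'_sum:
  defines "om' z \<equiv> (d' z)\<^sup>2 - (d' (V z))\<^sup>2"
  shows "om' z + om' (E' (V z)) = om' (E' z)"
proof (cases "z \<in> hinge_flags")
  case True
  have [simp]: "om' x = om_kl" "om' (F x) = om_kl" "om' (V x) = - om_kl" "om' (V (F x)) = - om_kl"
    using om'_eq(1)[of x] om'_eq(1)[of "F x"] by (simp_all add: om'_def diag_def)
  have [simp]: "om' z = om z" if "z \<notin> diag" for z
    unfolding om'_def using that by (rule om'_eq(2))
  have *: "om_kl = om (E (F x)) - om (E x)" "om x + om (E (V x)) = om (E x)"
    "om x + om (E (V (F x))) = om (E (F x))"
    using om_sum[of x] om_sum[of "F x"] by (simp_all add: om_kl_def)
  show ?thesis
    using True
  proof (cases rule: hinge_flags_cases)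
  qed (use * in simp_all)
next
  case False
  then have "z \<notin> diag" "E (V z) \<notin> diag" "E z \<notin> diag"
    by (auto dest: diag_hinge)
  then show ?thesis using False om'_eq(2) om_sum[of z] by (simp add: om'_def)
qed

text \<open>The new triangles are realised by \<open>K L I\<close> and \<open>K L J\<close>, whose
  areas are nonzero because the crossing lies strictly between \<open>I\<close> and
  \<open>J\<close>.\<close>

lemma triangle_ineq': "edge_length T' d' z < edge_length T' d' (E' (V z)) + edge_length T' d' (E' z)"
proof (cases "z \<in> hinge_flags")
  case True
  obtain I J K L where h: "hinge T d x I J K L" by (rule hinge_exists)
  note cr = hinge_crossing[OF h]
  have a: "area K L I \<noteq> 0" "area K L J \<noteq> 0"
    using area_crossing(3,4)[OF cr] s_ij_bounds cr by (auto simp: crossing_def)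
  have p: "placed T d x I J K" "placed T d (F x) I J L" using h by (auto simp: hinge_def)
  have d: "dist (fst K) (fst L) = s_kl" "dist (fst K) (fst I) = len (E x)" "dist (fst K) (fst J) = len (E (V x))"
    "dist (fst L) (fst I) = len (E (F x))" "dist (fst L) (fst J) = len (E (V (F x)))"
    using hinge_dist_kl[OF h] p by (auto simp: placed_iff dist_commute)
  have tri: "dist (fst P) (fst Q) < dist (fst P) (fst R) + dist (fst R) (fst Q)" if "area P Q R \<noteq> 0" for P Q R
    using dist_less_if_cross that by (simp add: area_def)
  have ineqs: "s_kl < len (E x) + len (E (F x))" "len (E x) < s_kl + len (E (F x))" "len (E (F x)) < s_kl + len (E x)"
    "s_kl < len (E (V x)) + len (E (V (F x)))" "len (E (V x)) < s_kl + len (E (V (F x)))"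
    "len (E (V (F x))) < s_kl + len (E (V x))"
    using tri[of K L I] tri[of K I L] tri[of L I K] tri[of K L J] tri[of K J L] tri[of L J K] a d
      area_swap[where P = K and Q = L and R = I] area_swap[where P = K and Q = L and R = J]
    by (auto simp: dist_commute)
  have [simp]: "edge_length T' d' x = s_kl" "edge_length T' d' (V x) = s_kl" "edge_length T' d' (F x) = s_kl"
     "edge_length T' d' (V (F x)) = s_kl"
    using len'_diag by (simp_all add: diag_def)
  show ?thesis
    using True ineqs by (cases rule: hinge_flags_cases) simp_all
next
  case False
  then have "z \<notin> diag" "E (V z) \<notin> diag" "E z \<notin> diag"
    by (auto dest: diag_hinge)
  then show ?thesis using False len_ineq[of z] by simp
qed

lemma len'_pos: "0 < edge_length T' d' z"
  using s_kl_pos len'_diag[of z] by (cases "z \<in> diag") auto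

lemma len'_V: "edge_length T' d' (V z) = edge_length T' d' z"
  by (simp add: edge_length_def)

lemma d'_F: "d' (F z) = d' z"
proof (cases "z \<in> diag")
  case True
  then show ?thesis by (auto simp: diag_def)
next
  case False
  then have "F z \<notin> diag" by simp
  then show ?thesis using False by simp
qed

lemma E'VE' [simp]: "E' (V (E' z)) = V (E' (V z))"
  using T'.EVE[of z] by (simp only: V')

lemma duality': "duality_triangulation T' d'"
proof -
  have 1: "(d' z)\<^sup>2 + (d' (E' (V z)))\<^sup>2 + (d' (V (E' z)))\<^sup>2 =
     (d' (V z))\<^sup>2 + (d' (V (E' (V z))))\<^sup>2 + (d' (E' z))\<^sup>2" for z
  proof -
    have rearr: "a - b + (c - e) = f - g \<Longrightarrow> a + c + g = b + e + f" for a b c e f g :: real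
      by linarith
    show ?thesis by (rule rearr[OF om'_sum])
  qed
  have 2: "edge_length T' d' z < edge_length T' d' (E' (V z)) + edge_length T' d' (V (E' z))" for z
    using triangle_ineq'[of z] unfolding len'_V .
  show ?thesis
    unfolding duality_triangulation_def rot_def V' F' E'VE' VV
    by (intro conjI allI surface' d'_F len'_pos 1 2)
qed

sublocale T': duality T' d'
  by unfold_locales (rule duality')

end

section \<open>Bounded moments\<close>

definition orbit :: "'f triangulation \<Rightarrow> 'f \<Rightarrow> 'p \<Rightarrow> 'p \<Rightarrow> 'p \<Rightarrow> ('f \<times> 'p \<times> 'p \<times> 'p) set" where
  "orbit T z P Q R = (let V = chg_vertex T; E = chg_edge T in
     {(z, P, Q, R), (V z, Q, P, R), (E z, P, R, Q), (V (E z), R, P, Q), (E (V z), Q, R, P), (V (E (V z)), R, Q, P)})"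

text \<open>In a convex quadrilateral the other two corners lie on the same side of each side. This
  allows \<open>placed_unique\<close> to compare the triangles at a side before and after a
  flip.\<close>

lemma same_side_crossing:
  assumes "crossing I J K L s t"
  shows "0 < area I K J * area I K L" "0 < area I L J * area I L K"
    "0 < area J K I * area J K L" "0 < area J L I * area J L K"
proof -
  define S where "S = cross (fst J - fst I) (fst L - fst K)"
  note ar = area_crossing[OF assms, folded S_def]
  have st: "0 < s" "0 < 1 - s" "0 < t" "0 < 1 - t" "0 < S * S"
    using assms by (auto simp: crossing_def S_def zero_less_mult_iff linorder_neq_iff)
  have *: "area I K J = t * S" "area I K L = s * S" "area I L J = - (1 - t) * S" "area I L K = - s * S"
    "area J K I = - t * S" "area J K L = - (1 - s) * S" "area J L I = (1 - t) * S" "area J L K = (1 - s) * S"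
    using ar area_swap(1-5)[where P = I and Q = J and R = K] area_swap(1-5)[where P = I and Q = J and R = L]
      area_swap(1-5)[where P = K and Q = L and R = I] area_swap(1-5)[where P = K and Q = L and R = J]
    by (simp_all add: algebra_simps)
  have "0 < (t * s) * (S * S)" "0 < ((1 - t) * s) * (S * S)" "0 < (t * (1 - s)) * (S * S)" "0 < ((1 - t) * (1 - s)) * (S * S)"
    using st by (simp_all only: mult_pos_pos)
  then show "0 < area I K J * area I K L" "0 < area I L J * area I L K"
    "0 < area J K I * area J K L" "0 < area J L I * area J L K"
    unfolding * by (simp_all add: algebra_simps)
qed

context flip begin

text \<open>The old hinge is rebuilt from the side \<open>IK\<close>, which belongs to both
  triangulations. Its flip is a hinge of the new triangulation with the same \<open>I\<close> and
  \<open>K\<close>, and \<open>placed_unique\<close> identifies first \<open>L\<close> and then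
  \<open>J\<close>.\<close>

lemma hinge_flip_converse:
  assumes "hinge T' d' x K L I J"
  shows "hinge T d x I J K L"
proof -
  have h: "placed T' d' x K L I" "placed T' d' (F x) K L J" "area K L I * area K L J < 0"
    using assms by (auto simp: hinge_def)
  have mIK: "moment I K = em (E x)" "moment K I = em (V (E x))"
    using h(1) by (auto simp: placed_def)
  then have dIK: "dist (fst I) (fst K) = len (E x)" "snd I - snd K = om (E x)"
    using moments_iff[of I K "E x"] by auto
  have "area I K L \<noteq> 0"
    using h(3) area_swap(5)[of I K L] by (metis mult_zero_left less_irrefl area_swap(4))
  then obtain J' where J': "placed T d (E x) I K J'" "0 < area I K L * area I K J'"
    by (rule placed_exists[OF dIK])
  have "placed T d x I J' K"
    using placed_E[OF J'(1)] by simp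
  then obtain L' where "placed T d (F x) I J' L'" "area I J' K * area I J' L' < 0"
    by (rule placed_opposite_exists)
  then have h': "hinge T d x I J' K L'"
    using \<open>placed T d x I J' K\<close> by (simp add: hinge_def)
  have cr: "crossing I J' K L' s_ij t_kl" by (rule hinge_crossing[OF h'])
  have "hinge T' d' x K L' I J'" by (rule hinge_flip[OF h'])
  then have g: "placed T' d' x K L' I" "placed T' d' (F x) K L' J'" "area K L' I * area K L' J' < 0"
    by (auto simp: hinge_def)
  have "placed T' d' (E' x) K I L" "placed T' d' (E' x) K I L'"
    using T'.placed_E[OF h(1)] T'.placed_E[OF g(1)] by simp_all
  moreover have "0 < area K I L * area K I L'"
  proof -
    have "0 < area I K J' * area I K L'" by (rule same_side_crossing(1)[OF cr])
    then have "0 < area I K L * area I K L'"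
      using J'(2) by (auto simp: zero_less_mult_iff)
    then show ?thesis by (simp add: area_swap(1)[of K I])
  qed
  ultimately have L: "L = L'" by (rule T'.placed_unique)
  have "0 < area K L J * area K L J'"
    using h(3) g(3) unfolding L by (auto simp: zero_less_mult_iff mult_less_0_iff)
  then have "J = J'"
    using T'.placed_unique h(2) g(2) unfolding L by blast
  then show ?thesis using h' L by simp
qed

lemma orbit_T: "orbit T z P Q R =
  {(z, P, Q, R), (V z, Q, P, R), (E z, P, R, Q), (V (E z), R, P, Q), (E (V z), Q, R, P), (V (E (V z)), R, Q, P)}"
  by (simp add: orbit_def Let_def)

lemma orbit_T'_x: "orbit T' x K L I =
  {(x, K, L, I), (V x, L, K, I), (V (E x), K, I, L), (E x, I, K, L), (V (E (F x)), L, I, K), (E (F x), I, L, K)}"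
  by (simp add: orbit_def Let_def)

lemma orbit_T'_Fx: "orbit T' (F x) K L J =
  {(F x, K, L, J), (V (F x), L, K, J), (V (E (V x)), K, J, L), (E (V x), J, K, L),
   (V (E (V (F x))), L, J, K), (E (V (F x)), J, L, K)}"
  by (simp add: orbit_def Let_def)

text \<open>A placed new triangle is completed by the one across the new diagonal, and the resulting
  new hinge comes from an old one by \<open>hinge_flip_converse\<close>. The twelve cases only turn
  the flag into \<open>x\<close> or \<open>F x\<close>.\<close>

lemma placed_hinge_cases:
  assumes "placed T' d' z P Q R" "z \<in> hinge_flags"
  obtains I J K L where "hinge T d x I J K L" "(z, P, Q, R) \<in> orbit T' x K L I \<union> orbit T' (F x) K L J"
proof -
  note goal = that
  have V: "placed T' d' (V z) Q P R" if "placed T' d' z P Q R" for z P Q R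
    using T'.placed_V[OF that] by simp
  have E: "placed T' d' (E' z) P R Q" if "placed T' d' z P Q R" for z P Q R
    using T'.placed_E[OF that] .
  have ext_x: thesis if p: "placed T' d' x K L I" and o: "(z, P, Q, R) \<in> orbit T' x K L I" for K L I
  proof -
    obtain J where "placed T' d' (chg_triangle T' x) K L J" "area K L I * area K L J < 0"
      by (rule T'.placed_opposite_exists[OF p])
    then have "hinge T' d' x K L I J" using p by (simp add: hinge_def)
    from hinge_flip_converse[OF this] show ?thesis using o by (intro goal[of I J K L]) auto
  qed
  have ext_Fx: thesis if p: "placed T' d' (F x) K L J" and o: "(z, P, Q, R) \<in> orbit T' (F x) K L J" for K L J
  proof -
    obtain I where "placed T' d' (chg_triangle T' (F x)) K L I" "area K L J * area K L I < 0"
      by (rule T'.placed_opposite_exists[OF p])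
    then have "hinge T' d' x K L I J" using p by (simp add: hinge_def mult.commute)
    from hinge_flip_converse[OF this] show ?thesis using o by (intro goal[of I J K L]) auto
  qed
  note p = assms(1)
  note moves = p V[OF p] E[OF p] V[OF E[OF p]] E[OF V[OF p]] E[OF V[OF E[OF p]]]
  show ?thesis
    using assms(2)
  proof (cases rule: hinge_flags_cases)
    case 1 then show ?thesis using moves by (intro ext_x[of P Q R]) (simp_all add: orbit_T'_x)
  next
    case 2 then show ?thesis using moves by (intro ext_x[of Q P R]) (simp_all add: orbit_T'_x)
  next
    case 3 then show ?thesis using moves by (intro ext_Fx[of P Q R]) (simp_all add: orbit_T'_Fx)
  next
    case 4 then show ?thesis using moves by (intro ext_Fx[of Q P R]) (simp_all add: orbit_T'_Fx)
  next
    case 5 then show ?thesis using moves by (intro ext_x[of Q R P]) (simp_all add: orbit_T'_x)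
  next
    case 6 then show ?thesis using moves by (intro ext_x[of P R Q]) (simp_all add: orbit_T'_x)
  next
    case 7 then show ?thesis using moves by (intro ext_Fx[of Q R P]) (simp_all add: orbit_T'_Fx)
  next
    case 8 then show ?thesis using moves by (intro ext_Fx[of P R Q]) (simp_all add: orbit_T'_Fx)
  next
    case 9 then show ?thesis using moves by (intro ext_x[of R Q P]) (simp_all add: orbit_T'_x)
  next
    case 10 then show ?thesis using moves by (intro ext_x[of R P Q]) (simp_all add: orbit_T'_x)
  next
    case 11 then show ?thesis using moves by (intro ext_Fx[of R Q P]) (simp_all add: orbit_T'_Fx)
  next
    case 12 then show ?thesis using moves by (intro ext_Fx[of R P Q]) (simp_all add: orbit_T'_Fx)
  qed
qed

text \<open>Seen from \<open>I\<close>, the moments are inner products with the centers of the two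
  triangles, which have the same coordinate \<open>d x\<close> along the edge. At the crossing the
  terms with \<open>d x\<close> cancel, and \<open>t_kl_eq\<close> combines the two heights.\<close>

lemma gap_dual_length:
  assumes "hinge T d x I J K L"
  shows "gap I J K L s_ij t_kl = - ((1 - t_kl) * vv x * dual_length T d x)"
proof -
  have h: "placed T d x I J K" "placed T d (F x) I J L" using assms by (auto simp: hinge_def)
  have m: "moment I J = len x * d x" "moment I K = uu x * d x + vv x * hh x"
    "moment I L = uu (F x) * d x + vv (F x) * hh (F x)"
    using h by (simp_all add: placed_def hh_def) (simp add: edge_moment_def)
  have s: "s_ij * len x = (1 - t_kl) * uu x + t_kl * uu (F x)" by (simp add: s_ij_def)
  have "gap I J K L s_ij t_kl = (s_ij * len x) * d x - (1 - t_kl) * (uu x * d x + vv x * hh x)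
      - t_kl * (uu (F x) * d x) - (t_kl * vv (F x)) * hh (F x)"
    unfolding gap_eq(1)[OF hinge_crossing[OF assms]] m by (simp add: algebra_simps)
  also have "\<dots> = - ((1 - t_kl) * vv x * (hh x + hh (F x)))"
    unfolding s t_kl_eq[symmetric] by (simp add: algebra_simps)
  finally show ?thesis by (simp add: dual_length_eq)
qed

end

text \<open>
  In a triangle with corners \<open>P\<close>, \<open>P + e\<close>, \<open>P + f\<close> and moments \<open>a\<close>, \<open>b\<close> at \<open>P\<close> the linear form
  \<open>\<alpha> e + \<beta> f \<mapsto> \<alpha> a + \<beta> b\<close> is the inner product with the vector from \<open>P\<close> to the center.  On the
  sectors at a vertex these forms fit together to a piecewise linear function, which only decreases
  in a flip of an edge with nonpositive dual length.
\<close>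

definition cone_bound :: "real \<Rightarrow> lifted \<Rightarrow> lifted \<Rightarrow> lifted \<Rightarrow> bool" where
  "cone_bound C P Q R \<longleftrightarrow> (\<forall>\<alpha> \<beta>. 0 \<le> \<alpha> \<longrightarrow> 0 \<le> \<beta> \<longrightarrow> \<alpha> * moment P Q + \<beta> * moment P R \<le>
     C * norm (\<alpha> *\<^sub>R (fst Q - fst P) + \<beta> *\<^sub>R (fst R - fst P)))"

definition cone_bounded :: "real \<Rightarrow> 'f triangulation \<Rightarrow> ('f \<Rightarrow> real) \<Rightarrow> bool" where
  "cone_bounded C T d \<longleftrightarrow> (\<forall>z P Q R. placed T d z P Q R \<longrightarrow> cone_bound C P Q R)"

lemma cone_bound_swap: "cone_bound C P Q R \<Longrightarrow> cone_bound C P R Q"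
  unfolding cone_bound_def by (metis add.commute)

text \<open>At an end \<open>P\<close> of the old diagonal \<open>PJ\<close> two sectors merge. By
  \<open>le\<close> the new linear form is at most the old value on the ray towards
  \<open>J\<close>, hence at most the old piecewise linear function on both halves.\<close>

lemma cone_bound_across:
  assumes "cone_bound C P J K" "cone_bound C P J L" "0 < s" "0 < a" "0 < b"
    and eq: "s *\<^sub>R (fst J - fst P) = a *\<^sub>R (fst K - fst P) + b *\<^sub>R (fst L - fst P)"
    and le: "a * moment P K + b * moment P L \<le> s * moment P J"
  shows "cone_bound C P K L"
proof -
  have *: "\<alpha> * moment P K + \<beta> * moment P L \<le> C * norm (\<alpha> *\<^sub>R (fst K - fst P) + \<beta> *\<^sub>R (fst L - fst P))"
    if "cone_bound C P J K" "0 \<le> \<beta>" "\<beta> * a \<le> \<alpha> * b" "0 < a" "0 < b"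
      and eq: "s *\<^sub>R (fst J - fst P) = a *\<^sub>R (fst K - fst P) + b *\<^sub>R (fst L - fst P)"
      and le: "a * moment P K + b * moment P L \<le> s * moment P J" for \<alpha> \<beta> a b K L
  proof -
    \<comment> \<open>The relation \<open>eq\<close> trades the whole share of \<open>L\<close> for
      \<open>J\<close>. The rest \<delta> of the share of \<open>K\<close> is nonnegative in the
      half between \<open>J\<close> and \<open>K\<close>.\<close>
    define \<gamma> \<delta> where "\<gamma> = \<beta> / b * s" and "\<delta> = \<alpha> - \<beta> / b * a"
    have nonneg: "0 \<le> \<gamma>" "0 \<le> \<delta>"
      using that assms(3) by (auto simp: \<gamma>_def \<delta>_def field_simps)
    have "\<gamma> *\<^sub>R (fst J - fst P) = (\<beta> / b) *\<^sub>R (a *\<^sub>R (fst K - fst P) + b *\<^sub>R (fst L - fst P))"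
      unfolding eq[symmetric] by (simp add: \<gamma>_def)
    then have v: "\<gamma> *\<^sub>R (fst J - fst P) + \<delta> *\<^sub>R (fst K - fst P) = \<alpha> *\<^sub>R (fst K - fst P) + \<beta> *\<^sub>R (fst L - fst P)"
      using \<open>0 < b\<close> by (simp add: \<delta>_def scaleR_add_right scaleR_diff_left)
    have "\<alpha> * moment P K + \<beta> * moment P L = (\<beta> / b) * (a * moment P K + b * moment P L) + \<delta> * moment P K"
      using \<open>0 < b\<close> by (simp add: \<delta>_def field_simps)
    also have "\<dots> \<le> (\<beta> / b) * (s * moment P J) + \<delta> * moment P K"
      using le that(2) \<open>0 < b\<close> by (intro add_right_mono mult_left_mono) auto
    also have "\<dots> = \<gamma> * moment P J + \<delta> * moment P K" by (simp add: \<gamma>_def)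
    also have "\<dots> \<le> C * norm (\<gamma> *\<^sub>R (fst J - fst P) + \<delta> *\<^sub>R (fst K - fst P))"
      using that(1) nonneg by (simp add: cone_bound_def)
    finally show ?thesis unfolding v .
  qed
  show ?thesis
    unfolding cone_bound_def
  proof (intro allI impI)
    fix \<alpha> \<beta> :: real assume nn: "0 \<le> \<alpha>" "0 \<le> \<beta>"
    show "\<alpha> * moment P K + \<beta> * moment P L \<le> C * norm (\<alpha> *\<^sub>R (fst K - fst P) + \<beta> *\<^sub>R (fst L - fst P))"
    proof (cases "\<beta> * a \<le> \<alpha> * b")
      case True
      then show ?thesis using * assms nn by blast
    next
      case False
      then have "\<beta> * moment P L + \<alpha> * moment P K \<le> C * norm (\<beta> *\<^sub>R (fst L - fst P) + \<alpha> *\<^sub>R (fst K - fst P))"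
        using assms nn by (intro *[of L \<alpha> b \<beta> a K]) (simp_all add: add.commute)
      then show ?thesis by (simp add: add.commute)
    qed
  qed
qed

text \<open>At an end \<open>P\<close> of the new diagonal \<open>PL\<close> the sector
  \<open>IPJ\<close> is split. The new value on the ray towards \<open>L\<close> is at most that of
  the old linear form, so the same holds on the part between \<open>L\<close> and
  \<open>I\<close>.\<close>

lemma cone_bound_within:
  assumes "cone_bound C P I J" "0 < t" "0 \<le> a" "0 \<le> b"
    and eq: "t *\<^sub>R (fst L - fst P) = a *\<^sub>R (fst I - fst P) + b *\<^sub>R (fst J - fst P)"
    and le: "t * moment P L \<le> a * moment P I + b * moment P J"
  shows "cone_bound C P L I"
  unfolding cone_bound_def
proof (intro allI impI)
  fix \<alpha> \<beta> :: real assume nn: "0 \<le> \<alpha>" "0 \<le> \<beta>"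
  have "\<alpha> * moment P L + \<beta> * moment P I = (\<alpha> / t) * (t * moment P L) + \<beta> * moment P I"
    using assms(2) by simp
  also have "\<dots> \<le> (\<alpha> / t) * (a * moment P I + b * moment P J) + \<beta> * moment P I"
    using le nn assms(2) by (intro add_right_mono mult_left_mono) auto
  also have "\<dots> = (\<alpha> / t * a + \<beta>) * moment P I + (\<alpha> / t * b) * moment P J"
    by (simp add: algebra_simps)
  also have "\<dots> \<le> C * norm ((\<alpha> / t * a + \<beta>) *\<^sub>R (fst I - fst P) + (\<alpha> / t * b) *\<^sub>R (fst J - fst P))"
    using assms(2-4) nn by (intro assms(1)[unfolded cone_bound_def, rule_format]) auto
  also have "(\<alpha> / t * a + \<beta>) *\<^sub>R (fst I - fst P) + (\<alpha> / t * b) *\<^sub>R (fst J - fst P) =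
      (\<alpha> / t) *\<^sub>R (a *\<^sub>R (fst I - fst P) + b *\<^sub>R (fst J - fst P)) + \<beta> *\<^sub>R (fst I - fst P)"
    by (simp add: algebra_simps)
  also have "\<dots> = \<alpha> *\<^sub>R (fst L - fst P) + \<beta> *\<^sub>R (fst I - fst P)"
    unfolding eq[symmetric] using assms(2) by simp
  finally show "\<alpha> * moment P L + \<beta> * moment P I \<le> C * norm (\<alpha> *\<^sub>R (fst L - fst P) + \<beta> *\<^sub>R (fst I - fst P))" .
qed

lemma cone_bound_crossing:
  assumes cr: "crossing I J K L s t" and gap: "0 \<le> gap I J K L s t"
    and "cone_bound C I J K" "cone_bound C I J L" "cone_bound C J I K" "cone_bound C J I L"
      "cone_bound C K I J" "cone_bound C L I J"
  shows "cone_bound C I K L" "cone_bound C J K L" "cone_bound C K L I" "cone_bound C K L J"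
    "cone_bound C L K I" "cone_bound C L K J"
proof -
  have st: "0 < s" "0 < 1 - s" "0 < t" "0 < 1 - t"
    and eq: "(1 - s) *\<^sub>R fst I + s *\<^sub>R fst J = (1 - t) *\<^sub>R fst K + t *\<^sub>R fst L"
    using cr by (auto simp: crossing_def)
  note g = gap_eq[OF cr]
  have vec: "(1 - s) *\<^sub>R (fst I - p) + s *\<^sub>R (fst J - p) = (1 - t) *\<^sub>R (fst K - p) + t *\<^sub>R (fst L - p)" for p
    using eq by (simp add: algebra_simps)
  show "cone_bound C I K L"
    using st vec[of "fst I"] g(1) gap by (intro cone_bound_across[of C I J K L s "1 - t" t] assms) auto
  show "cone_bound C J K L"
    using st vec[of "fst J"] g(2) gap by (intro cone_bound_across[of C J I K L "1 - s" "1 - t" t] assms) auto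
  show "cone_bound C K L I"
    using st vec[of "fst K"] g(3) gap by (intro cone_bound_within[of C K I J t "1 - s" s L] assms) auto
  show "cone_bound C K L J"
    using st vec[of "fst K"] g(3) gap
    by (intro cone_bound_within[of C K J I t s "1 - s" L] assms cone_bound_swap[of C K I J])
      (auto simp: add.commute)
  show "cone_bound C L K I"
    using st vec[of "fst L"] g(4) gap by (intro cone_bound_within[of C L I J "1 - t" "1 - s" s K] assms) auto
  show "cone_bound C L K J"
    using st vec[of "fst L"] g(4) gap
    by (intro cone_bound_within[of C L J I "1 - t" s "1 - s" K] assms cone_bound_swap[of C L I J])
      (auto simp: add.commute)
qed

context duality begin

text \<open>Cramer's rule expresses \<alpha> and \<beta> as cross products with \<open>w\<close>
  divided by the area, which bounds them by multiples of the norm of \<open>w\<close> and yields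
  \<open>c z\<close>. The sum over all flags is a crude common bound.\<close>

lemma cone_bounded_exists: obtains C where "cone_bounded C T d"
proof
  define c where "c z = (len (E z) * \<bar>em z\<bar> + len z * \<bar>em (E z)\<bar>) / (vv z * len z)" for z
  have c_nonneg: "0 \<le> c z" for z by (simp add: c_def less_imp_le)
  show "cone_bounded (\<Sum>z\<in>UNIV. c z) T d"
    unfolding cone_bounded_def cone_bound_def
  proof (intro allI impI)
    fix z P Q R and \<alpha> \<beta> :: real
    assume p: "placed T d z P Q R" and nn: "0 \<le> \<alpha>" "0 \<le> \<beta>"
    define e f where "e = fst Q - fst P" and "f = fst R - fst P"
    define w where "w = \<alpha> *\<^sub>R e + \<beta> *\<^sub>R f"
    have ne: "norm e = len z" "norm f = len (E z)"
      using p by (auto simp: placed_iff e_def f_def dist_norm norm_minus_commute)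
    have m: "moment P Q = em z" "moment P R = em (E z)"
      using p by (auto simp: placed_def)
    define A where "A = vv z * len z"
    have A: "0 < A" by (simp add: A_def)
    have "\<bar>cross e f\<bar> = A"
    proof -
      have "area P Q R = sgn (area P Q R) * vv z * len z"
        using third_if_placed(1)[OF p] area_third[of P Q z] p by (metis placed_iff)
      moreover have "\<bar>sgn (area P Q R)\<bar> = 1" using third_if_placed(2)[OF p] by (simp add: sgn_real_def)
      ultimately have "\<bar>area P Q R\<bar> = A" by (metis A_def A abs_mult abs_of_pos mult.assoc mult_1)
      then show ?thesis by (simp add: area_def e_def f_def)
    qed
    have cross_le: "\<bar>cross a b\<bar> \<le> norm a * norm b" for a b
    proof -
      have "cross a b = inner (Complex (Re b) (Im b)) (Complex (- Im a) (Re a))"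
        by (simp add: cross_def inner_complex_def)
      then show ?thesis
        using Cauchy_Schwarz_ineq2[of "Complex (Re b) (Im b)" "Complex (- Im a) (Re a)"]
        by (simp add: cmod_def mult.commute add.commute)
    qed
    have "\<alpha> * A = \<bar>cross w f\<bar>" "\<beta> * A = \<bar>cross e w\<bar>"
      using nn \<open>\<bar>cross e f\<bar> = A\<close> by (simp_all add: w_def cross_simps abs_mult)
    then have "\<alpha> * A \<le> norm w * len (E z)" "\<beta> * A \<le> len z * norm w"
      using cross_le[of w f] cross_le[of e w] ne by simp_all
    then have "\<alpha> \<le> norm w * len (E z) / A" "\<beta> \<le> len z * norm w / A"
      using A by (simp_all add: field_simps)
    then have "\<alpha> * \<bar>em z\<bar> + \<beta> * \<bar>em (E z)\<bar> \<le> norm w * len (E z) / A * \<bar>em z\<bar> + len z * norm w / A * \<bar>em (E z)\<bar>"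
      by (intro add_mono mult_right_mono) auto
    also have "\<dots> = c z * norm w"
    proof -
      have "c z = (len (E z) * \<bar>em z\<bar> + len z * \<bar>em (E z)\<bar>) / A" by (simp only: c_def A_def)
      then show ?thesis by (simp add: add_divide_distrib algebra_simps)
    qed
    also have "\<dots> \<le> (\<Sum>z\<in>UNIV. c z) * norm w"
      by (intro mult_right_mono member_le_sum) (auto simp: c_nonneg)
    finally have 1: "\<alpha> * \<bar>em z\<bar> + \<beta> * \<bar>em (E z)\<bar> \<le> (\<Sum>z\<in>UNIV. c z) * norm w" .
    have "\<alpha> * em z \<le> \<alpha> * \<bar>em z\<bar>" "\<beta> * em (E z) \<le> \<beta> * \<bar>em (E z)\<bar>"
      using nn by (auto intro: mult_left_mono)
    then show "\<alpha> * moment P Q + \<beta> * moment P R \<le> (\<Sum>z\<in>UNIV. c z) * norm (\<alpha> *\<^sub>R (fst Q - fst P) + \<beta> *\<^sub>R (fst R - fst P))"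
      using 1 unfolding m w_def e_def f_def by linarith
  qed
qed

lemma placed_somewhere: obtains P Q R where "placed T d z P Q R"
proof -
  have "dist (fst (0::complex, 0::real)) (fst (complex_of_real (len z), - om z)) = len z"
    "snd (0::complex, 0::real) - snd (complex_of_real (len z), - om z) = om z"
    by (simp_all add: abs_of_pos)
  then have "placed T d z (0, 0) (complex_of_real (len z), - om z) (third 1 z (0, 0) (complex_of_real (len z), - om z))"
    by (rule placed_third) simp
  then show ?thesis by (rule that)
qed

text \<open>The edge is the boundary ray \<open>\<beta> = 0\<close> of its sector, and on its unit
  vector the linear form takes the value \<open>d z\<close>.\<close>

lemma d_le_if_cone_bounded:
  assumes "cone_bounded C T d"
  shows "d z \<le> C"
proof -
  obtain P Q R where p: "placed T d z P Q R" by (rule placed_somewhere)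
  then have "cone_bound C P Q R" using assms unfolding cone_bounded_def by blast
  then have "1 * moment P Q + 0 * moment P R \<le> C * norm (1 *\<^sub>R (fst Q - fst P) + 0 *\<^sub>R (fst R - fst P))"
    unfolding cone_bound_def by (metis le_numeral_extra(3) zero_le_one)
  moreover have "norm (fst Q - fst P) = len z" "moment P Q = len z * d z"
    using p by (simp add: placed_iff dist_norm norm_minus_commute)
      (use p in \<open>simp add: placed_def edge_moment_def\<close>)
  ultimately have "len z * d z \<le> len z * C" by (simp add: mult.commute)
  then show ?thesis by simp
qed

end

context flip begin

lemma cone_bounded_flip:
  assumes "cone_bounded C T d" and "dual_length T d x \<le> 0"
  shows "cone_bounded C T' d'"
  unfolding cone_bounded_def
proof (intro allI impI)
  fix z P Q R assume p: "placed T' d' z P Q R"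
  have cb: "cone_bound C P Q R" if "placed T d z P Q R" for z P Q R
    using assms(1) that unfolding cone_bounded_def by blast
  show "cone_bound C P Q R"
  proof (cases "z \<in> hinge_flags")
    case False
    then show ?thesis using cb p placed_other by blast
  next
    case True
    from p True obtain I J K L where h: "hinge T d x I J K L"
      and o: "(z, P, Q, R) \<in> orbit T' x K L I \<union> orbit T' (F x) K L J"
      by (rule placed_hinge_cases)
    have g: "0 \<le> gap I J K L s_ij t_kl"
      unfolding gap_dual_length[OF h] using assms(2) t_kl_bounds vv_pos[of x]
      by (simp add: mult_nonneg_nonpos less_imp_le)
    have p1: "placed T d x I J K" and p2: "placed T d (F x) I J L"
      using h by (auto simp: hinge_def)
    note new = cone_bound_crossing[OF hinge_crossing[OF h] g cb[OF p1] cb[OF p2]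
        cb[OF placed_V[OF p1]] cb[OF placed_V[OF p2]]
        cb[OF placed_V[OF placed_E[OF p1]], THEN cone_bound_swap, THEN cone_bound_swap]
        cb[OF placed_V[OF placed_E[OF p2]], THEN cone_bound_swap, THEN cone_bound_swap]]
    show ?thesis
      using o new new[THEN cone_bound_swap] unfolding orbit_T'_x orbit_T'_Fx by blast
  qed
qed

end

section \<open>The decreasing energy\<close>

text \<open>The ratio of the height of the center over the side \<open>P Q\<close> to the length of this side.\<close>

definition height_ratio :: "lifted \<Rightarrow> lifted \<Rightarrow> lifted \<Rightarrow> real" where
  "height_ratio P Q R = (moment P R - inner (fst R - fst P) (fst Q - fst P) / (norm (fst Q - fst P))\<^sup>2 * moment P Q)
     / \<bar>area P Q R\<bar>"

text \<open>If all centers are midpoints of their edges, a summand is half the cotangent of the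
  opposite angle, and the energy is the sum of the cotangents of all angles: up to a factor, the
  harmonic index of a triangulation.\<close>

definition dual_energy :: "'f::finite triangulation \<Rightarrow> ('f \<Rightarrow> real) \<Rightarrow> real" where
  "dual_energy T d = (\<Sum>z\<in>UNIV. signed_height T d z / edge_length T d z)"

text \<open>The numerator \<open>N\<close> is linear in the position and the moment of the third
  corner and vanishes at \<open>B\<close>, so \<open>c\<close> drops out. The area scales by the
  same factor, which leaves the sign of \<open>b\<close> and the defect \<open>r\<close> of the
  moments.\<close>

lemma height_ratio_combine:
  assumes nz: "fst B \<noteq> fst A" and X: "area A B X \<noteq> 0" and Y: "area A B Y \<noteq> 0" and "0 < a" "b \<noteq> 0"
    and eq: "a *\<^sub>R (fst Y - fst A) = b *\<^sub>R (fst X - fst A) + c *\<^sub>R (fst B - fst A)"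
    and m: "a * moment A Y = b * moment A X + c * moment A B + r"
  shows "height_ratio A B Y = sgn b * height_ratio A B X + r / (a * \<bar>area A B Y\<bar>)"
proof -
  define e where "e = fst B - fst A"
  define N where "N Z = moment A Z - inner (fst Z - fst A) e / (norm e)\<^sup>2 * moment A B" for Z
  have ne: "(norm e)\<^sup>2 \<noteq> 0" using nz by (simp add: e_def)
  have "a * N Y = a * moment A Y - inner (a *\<^sub>R (fst Y - fst A)) e / (norm e)\<^sup>2 * moment A B"
    by (simp add: N_def right_diff_distrib)
  also have "\<dots> = b * N X + r"
    unfolding eq m using ne
    by (simp add: N_def e_def[symmetric] inner_add_left add_divide_distrib distrib_right right_diff_distrib dot_square_norm)
  finally have N: "a * N Y = b * N X + r" .
  have "a * area A B Y = cross e (a *\<^sub>R (fst Y - fst A))"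
    by (simp add: area_def e_def cross_simps)
  also have "\<dots> = b * area A B X"
    unfolding eq by (simp add: area_def e_def cross_simps)
  finally have "\<bar>a * area A B Y\<bar> = \<bar>b * area A B X\<bar>" by simp
  then have ar: "a * \<bar>area A B Y\<bar> = \<bar>b\<bar> * \<bar>area A B X\<bar>"
    using \<open>0 < a\<close> by (simp add: abs_mult)
  have "height_ratio A B Y = (a * N Y) / (a * \<bar>area A B Y\<bar>)"
    using \<open>0 < a\<close> by (simp add: height_ratio_def N_def e_def)
  also have "\<dots> = b * N X / (\<bar>b\<bar> * \<bar>area A B X\<bar>) + r / (a * \<bar>area A B Y\<bar>)"
    unfolding N add_divide_distrib by (simp add: ar)
  also have "b * N X / (\<bar>b\<bar> * \<bar>area A B X\<bar>) = sgn b * height_ratio A B X"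
  proof -
    have "b * N X / (\<bar>b\<bar> * \<bar>area A B X\<bar>) = sgn b * (N X / \<bar>area A B X\<bar>)"
      using \<open>b \<noteq> 0\<close> by (cases "0 < b") (auto simp: sgn_real_def)
    then show ?thesis by (simp add: height_ratio_def N_def e_def)
  qed
  finally show ?thesis .
qed

text \<open>Over a side of the quadrilateral the flip exchanges two third corners on the same side,
  so the sign in \<open>height_ratio_combine\<close> is positive. Over a diagonal they lie on
  opposite sides, so the sign is negative and the sum of the two ratios is a multiple of
  \<open>g\<close>.\<close>

lemma height_ratio_crossing:
  assumes cr: "crossing I J K L s t"
  defines "g \<equiv> gap I J K L s t" and "A \<equiv> \<bar>cross (fst J - fst I) (fst L - fst K)\<bar>"
  shows "height_ratio I K L = height_ratio I K J - g / (t * s * A)"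
    "height_ratio I L K = height_ratio I L J - g / ((1 - t) * s * A)"
    "height_ratio J K L = height_ratio J K I - g / (t * (1 - s) * A)"
    "height_ratio J L K = height_ratio J L I - g / ((1 - t) * (1 - s) * A)"
    "height_ratio I J K + height_ratio I J L = - g / (t * (1 - t) * A)"
    "height_ratio K L I + height_ratio K L J = g / (s * (1 - s) * A)"
proof -
  define S where "S = cross (fst J - fst I) (fst L - fst K)"
  have st: "0 < s" "0 < 1 - s" "0 < t" "0 < 1 - t" and S: "S \<noteq> 0"
    and eq: "(1 - s) *\<^sub>R fst I + s *\<^sub>R fst J = (1 - t) *\<^sub>R fst K + t *\<^sub>R fst L"
    using cr by (auto simp: crossing_def S_def)
  have AS: "A = \<bar>S\<bar>" by (simp add: A_def S_def)
  note ar = area_crossing[OF cr, folded S_def]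
  have ar: "area I J K = - t * S" "area I J L = (1 - t) * S" "area K L I = s * S" "area K L J = - (1 - s) * S"
    "area I K J = t * S" "area I K L = s * S" "area I L J = - (1 - t) * S" "area I L K = - s * S"
    "area J K I = - t * S" "area J K L = - (1 - s) * S" "area J L I = (1 - t) * S" "area J L K = (1 - s) * S"
    using ar area_swap(1-5)[where P = I and Q = J and R = K] area_swap(1-5)[where P = I and Q = J and R = L]
      area_swap(1-5)[where P = K and Q = L and R = I] area_swap(1-5)[where P = K and Q = L and R = J]
    by (simp_all add: algebra_simps)
  have arnz: "area I K J \<noteq> 0" "area I K L \<noteq> 0" "area I L J \<noteq> 0" "area I L K \<noteq> 0" "area J K I \<noteq> 0"
    "area J K L \<noteq> 0" "area J L I \<noteq> 0" "area J L K \<noteq> 0" "area I J K \<noteq> 0" "area I J L \<noteq> 0" "area K L I \<noteq> 0"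
    "area K L J \<noteq> 0"
    unfolding ar using st S by auto
  have nz: "fst K \<noteq> fst I" "fst L \<noteq> fst I" "fst K \<noteq> fst J" "fst L \<noteq> fst J" "fst J \<noteq> fst I" "fst L \<noteq> fst K"
  proof -
    have *: "fst Q \<noteq> fst P" if "area P Q A' \<noteq> 0" for P Q A' :: "lifted"
      using that by (auto simp: area_def cross_def)
    show "fst K \<noteq> fst I" "fst L \<noteq> fst I" "fst K \<noteq> fst J" "fst L \<noteq> fst J" "fst J \<noteq> fst I" "fst L \<noteq> fst K"
      by (rule *[OF arnz(1)], rule *[OF arnz(3)], rule *[OF arnz(5)], rule *[OF arnz(7)],
          rule *[OF arnz(9)], rule *[OF arnz(11)])
  qed
  have vec: "(1 - s) *\<^sub>R (fst I - p) + s *\<^sub>R (fst J - p) = (1 - t) *\<^sub>R (fst K - p) + t *\<^sub>R (fst L - p)" for p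
    using eq by (simp add: algebra_simps)
  note G = gap_eq[OF cr, folded g_def]
have "t *\<^sub>R (fst L - fst I) = s *\<^sub>R (fst J - fst I) + (- (1 - t)) *\<^sub>R (fst K - fst I)"
    using vec[of "fst I"] by (simp add: algebra_simps)
  moreover have "t * moment I L = s * moment I J + (- (1 - t)) * moment I K + (- g)"
    using G(1) by (simp add: algebra_simps)
  ultimately have "height_ratio I K L = sgn (s) * height_ratio I K J + (- g) / (t * \<bar>area I K L\<bar>)"
    using st by (intro height_ratio_combine[where c = "- (1 - t)"] nz arnz) simp_all
  then show "height_ratio I K L = height_ratio I K J - g / (t * s * A)"
    using st by (simp add: ar abs_mult AS mult_ac)
  have "(1 - t) *\<^sub>R (fst K - fst I) = s *\<^sub>R (fst J - fst I) + (- t) *\<^sub>R (fst L - fst I)"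
    using vec[of "fst I"] by (simp add: algebra_simps)
  moreover have "(1 - t) * moment I K = s * moment I J + (- t) * moment I L + (- g)"
    using G(1) by (simp add: algebra_simps)
  ultimately have "height_ratio I L K = sgn (s) * height_ratio I L J + (- g) / ((1 - t) * \<bar>area I L K\<bar>)"
    using st by (intro height_ratio_combine[where c = "- t"] nz arnz) simp_all
  then show "height_ratio I L K = height_ratio I L J - g / ((1 - t) * s * A)"
    using st by (simp add: ar abs_mult AS mult_ac)
  have "t *\<^sub>R (fst L - fst J) = (1 - s) *\<^sub>R (fst I - fst J) + (- (1 - t)) *\<^sub>R (fst K - fst J)"
    using vec[of "fst J"] by (simp add: algebra_simps)
  moreover have "t * moment J L = (1 - s) * moment J I + (- (1 - t)) * moment J K + (- g)"
    using G(2) by (simp add: algebra_simps)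
  ultimately have "height_ratio J K L = sgn ((1 - s)) * height_ratio J K I + (- g) / (t * \<bar>area J K L\<bar>)"
    using st by (intro height_ratio_combine[where c = "- (1 - t)"] nz arnz) simp_all
  then show "height_ratio J K L = height_ratio J K I - g / (t * (1 - s) * A)"
    using st by (simp add: ar abs_mult AS mult_ac)
  have "(1 - t) *\<^sub>R (fst K - fst J) = (1 - s) *\<^sub>R (fst I - fst J) + (- t) *\<^sub>R (fst L - fst J)"
    using vec[of "fst J"] by (simp add: algebra_simps)
  moreover have "(1 - t) * moment J K = (1 - s) * moment J I + (- t) * moment J L + (- g)"
    using G(2) by (simp add: algebra_simps)
  ultimately have "height_ratio J L K = sgn ((1 - s)) * height_ratio J L I + (- g) / ((1 - t) * \<bar>area J L K\<bar>)"
    using st by (intro height_ratio_combine[where c = "- t"] nz arnz) simp_all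
  then show "height_ratio J L K = height_ratio J L I - g / ((1 - t) * (1 - s) * A)"
    using st by (simp add: ar abs_mult AS mult_ac)
  have "t *\<^sub>R (fst L - fst I) = (- (1 - t)) *\<^sub>R (fst K - fst I) + s *\<^sub>R (fst J - fst I)"
    using vec[of "fst I"] by (simp add: algebra_simps)
  moreover have "t * moment I L = (- (1 - t)) * moment I K + s * moment I J + (- g)"
    using G(1) by (simp add: algebra_simps)
  ultimately have "height_ratio I J L = sgn ((- (1 - t))) * height_ratio I J K + (- g) / (t * \<bar>area I J L\<bar>)"
    using st by (intro height_ratio_combine[where c = "s"] nz arnz) simp_all
  then show "height_ratio I J K + height_ratio I J L = - g / (t * (1 - t) * A)"
    using st by (simp add: ar abs_mult AS mult_ac)
  have "(1 - s) *\<^sub>R (fst I - fst K) = (- s) *\<^sub>R (fst J - fst K) + t *\<^sub>R (fst L - fst K)"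
    using vec[of "fst K"] by (simp add: algebra_simps)
  moreover have "(1 - s) * moment K I = (- s) * moment K J + t * moment K L + g"
    using G(3) by (simp add: algebra_simps)
  ultimately have "height_ratio K L I = sgn ((- s)) * height_ratio K L J + g / ((1 - s) * \<bar>area K L I\<bar>)"
    using st by (intro height_ratio_combine[where c = "t"] nz arnz) simp_all
  then show "height_ratio K L I + height_ratio K L J = g / (s * (1 - s) * A)"
    using st by (simp add: ar abs_mult AS mult_ac)
qed

text \<open>The right-hand side factors into \<open>1 / (a * b)\<close>, the left-hand side is
  \<open>(a + b) / (a * b)\<close>, and neither \<open>a\<close> nor \<open>b\<close> exceeds
  \<open>1/4\<close>.\<close>

lemma reciprocal_less:
  fixes s t :: real
  assumes "0 < s" "s < 1" "0 < t" "t < 1"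
  shows "1 / (s * (1 - s)) + 1 / (t * (1 - t)) <
    1 / (t * s) + 1 / ((1 - t) * s) + 1 / (t * (1 - s)) + 1 / ((1 - t) * (1 - s))"
proof -
  define a b where "a = s * (1 - s)" and "b = t * (1 - t)"
  have pos: "0 < a" "0 < b" using assms by (auto simp: a_def b_def)
  have "a = 1/4 - (s - 1/2)\<^sup>2" "b = 1/4 - (t - 1/2)\<^sup>2"
    by (simp_all add: a_def b_def power2_eq_square algebra_simps)
  then have "a + b < 1" using zero_le_power2[of "s - 1/2"] zero_le_power2[of "t - 1/2"] by linarith
  have "1 / a + 1 / b = (a + b) / (a * b)" using pos by (simp add: field_simps)
  also have "\<dots> < 1 / (a * b)" using pos \<open>a + b < 1\<close> by (intro divide_strict_right_mono) auto
  also have "\<dots> = (1 / t + 1 / (1 - t)) * (1 / s + 1 / (1 - s))"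
  proof -
    have "1 / t + 1 / (1 - t) = 1 / b" "1 / s + 1 / (1 - s) = 1 / a"
      using assms by (simp_all add: a_def b_def field_simps)
    then show ?thesis by simp
  qed
  also have "\<dots> = 1 / (t * s) + 1 / ((1 - t) * s) + 1 / (t * (1 - s)) + 1 / ((1 - t) * (1 - s))"
    by (simp add: distrib_left distrib_right add_divide_distrib)
  finally show ?thesis by (simp add: a_def b_def)
qed

context duality begin

lemma abs_area_placed:
  assumes "placed T d z P Q R"
  shows "\<bar>area P Q R\<bar> = vv z * len z"
proof -
  have "area P Q R = sgn (area P Q R) * (vv z * len z)"
    using third_if_placed(1)[OF assms] area_third[of P Q z] assms by (metis placed_iff mult.assoc)
  moreover have "\<bar>sgn (area P Q R)\<bar> = 1" using third_if_placed(2)[OF assms] by (simp add: sgn_real_def)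
  ultimately have "\<bar>area P Q R\<bar> = \<bar>vv z * len z\<bar>" by (metis abs_mult mult_1)
  then show ?thesis by (simp add: abs_mult abs_of_pos)
qed

lemma height_ratio_placed:
  assumes p: "placed T d z P Q R"
  shows "signed_height T d z / len z = height_ratio P Q R"
proof -
  define e f where "e = fst Q - fst P" and "f = fst R - fst P"
  have n: "norm e = len z" "norm f = len (E z)" "norm (f - e) = len (E (V z))"
    using p by (auto simp: placed_iff e_def f_def dist_norm norm_minus_commute)
  have "2 * inner f e = (norm f)\<^sup>2 + (norm e)\<^sup>2 - (norm (f - e))\<^sup>2"
    by (simp add: power2_norm_eq_inner inner_diff_left inner_diff_right inner_commute)
  then have i: "inner f e = len z * uu z"
    using len_uu[of z] n by simp
  have m: "moment P Q = len z * d z" "moment P R = em (E z)"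
    using p by (auto simp: placed_def edge_moment_def)
  have "inner f e / (norm e)\<^sup>2 * moment P Q = uu z * d z"
    unfolding i m n by (simp add: power2_eq_square)
  then show ?thesis
    unfolding height_ratio_def signed_height_eq hh_def abs_area_placed[OF p] m e_def[symmetric] f_def[symmetric]
    by simp
qed

lemma height_ratio_V: "signed_height T d (V z) / len (V z) = signed_height T d z / len z"
  by (simp add: signed_height_eq)

end

context flip begin

lemma dual_energy_split:
  fixes h :: "'a \<Rightarrow> real"
  assumes "\<And>z. h (V z) = h z"
  shows "(\<Sum>z\<in>UNIV. h z) = 2 * (h x + h (E x) + h (E (V x)) + h (F x) + h (E (F x)) + h (E (V (F x)))) +
    (\<Sum>z\<in>- hinge_flags. h z)"
proof -
  have "(\<Sum>z\<in>UNIV. h z) = (\<Sum>z\<in>hinge_flags. h z) + (\<Sum>z\<in>- hinge_flags. h z)"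
    by (metis finite_class.finite_UNIV Compl_eq_Diff_UNIV sum.subset_diff subset_UNIV add.commute)
  moreover have "hinge_flags = set [x, V x, E x, V (E x), E (V x), V (E (V x)),
     F x, V (F x), E (F x), V (E (F x)), E (V (F x)), V (E (V (F x)))]"
    by (simp add: hinge_flags_def)
  then have "(\<Sum>z\<in>hinge_flags. h z) = sum_list (map h [x, V x, E x, V (E x), E (V x), V (E (V x)),
     F x, V (F x), E (F x), V (E (F x)), E (V (F x)), V (E (V (F x)))])"
    using distinct_hinge by (metis sum.distinct_set_conv_list)
  ultimately show ?thesis
    by (simp add: assms)
qed

lemma dual_energy_decreases:
  assumes neg: "dual_length T d x < 0"
  shows "dual_energy T' d' < dual_energy T d"
proof -
  obtain I J K L where h: "hinge T d x I J K L" by (rule hinge_exists)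
  have cr: "crossing I J K L s_ij t_kl" by (rule hinge_crossing[OF h])
  define g A where "g = gap I J K L s_ij t_kl" and "A = \<bar>cross (fst J - fst I) (fst L - fst K)\<bar>"
  have "0 < - ((1 - t_kl) * vv x * dual_length T d x)"
    using neg t_kl_bounds vv_pos[of x] by (simp add: mult_pos_neg)
  then have g: "0 < g" unfolding g_def gap_dual_length[OF h] .
  have A: "0 < A" using cr by (simp add: A_def crossing_def)
  have p: "placed T d x I J K" "placed T d (F x) I J L" using h by (auto simp: hinge_def)
  have p': "placed T' d' x K L I" "placed T' d' (F x) K L J" using hinge_flip[OF h] by (auto simp: hinge_def)
  define \<kappa> \<kappa>' where "\<kappa> z = signed_height T d z / len z" and "\<kappa>' z = signed_height T' d' z / edge_length T' d' z" for z
  have k: "\<kappa> x = height_ratio I J K" "\<kappa> (E x) = height_ratio I K J" "\<kappa> (E (V x)) = height_ratio J K I"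
    "\<kappa> (F x) = height_ratio I J L" "\<kappa> (E (F x)) = height_ratio I L J" "\<kappa> (E (V (F x))) = height_ratio J L I"
    unfolding \<kappa>_def by (intro height_ratio_placed p placed_E placed_V)+
  have V': "placed T' d' (V z) Q P R" if "placed T' d' z P Q R" for z P Q R
    using T'.placed_V[OF that] by simp
  have E': "placed T' d' (E' z) P R Q" if "placed T' d' z P Q R" for z P Q R
    using T'.placed_E[OF that] .
  have q: "placed T' d' (E x) I K L" "placed T' d' (E (F x)) I L K" "placed T' d' (E (V x)) J K L"
    "placed T' d' (E (V (F x))) J L K"
    using V'[OF E'[OF p'(1)]] V'[OF E'[OF V'[OF p'(1)]]] V'[OF E'[OF p'(2)]] V'[OF E'[OF V'[OF p'(2)]]] by simp_all
  have k': "\<kappa>' x = height_ratio K L I" "\<kappa>' (E x) = height_ratio I K L" "\<kappa>' (E (V x)) = height_ratio J K L"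
    "\<kappa>' (F x) = height_ratio K L J" "\<kappa>' (E (F x)) = height_ratio I L K" "\<kappa>' (E (V (F x))) = height_ratio J L K"
    unfolding \<kappa>'_def by (rule T'.height_ratio_placed, fact p' q)+
  have other: "\<kappa>' z = \<kappa> z" if "z \<in> - hinge_flags" for z
  proof -
    obtain P Q R where "placed T d z P Q R" by (rule placed_somewhere)
    then show ?thesis
      using that placed_other height_ratio_placed T'.height_ratio_placed unfolding \<kappa>_def \<kappa>'_def by (metis ComplD)
  qed
  have sV: "\<kappa> (V z) = \<kappa> z" "\<kappa>' (V z) = \<kappa>' z" for z
    unfolding \<kappa>_def \<kappa>'_def using height_ratio_V T'.height_ratio_V by simp_all
  have "dual_energy T' d' - dual_energy T d = 2 * (\<kappa>' x + \<kappa>' (F x) - (\<kappa> x + \<kappa> (F x)) + (\<kappa>' (E x) - \<kappa> (E x)) +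
     (\<kappa>' (E (V x)) - \<kappa> (E (V x))) + (\<kappa>' (E (F x)) - \<kappa> (E (F x))) + (\<kappa>' (E (V (F x))) - \<kappa> (E (V (F x)))))"
    unfolding dual_energy_def \<kappa>_def[symmetric] \<kappa>'_def[symmetric]
    unfolding dual_energy_split[of \<kappa>, OF sV(1)] dual_energy_split[of \<kappa>', OF sV(2)]
    using sum.cong[of "- hinge_flags" "- hinge_flags" \<kappa>' \<kappa>, OF refl other] by (simp add: algebra_simps)
  \<comment> \<open>The first two reciprocals come from the new and the old diagonal, the other four
    from the sides of the quadrilateral.\<close>
  also have "\<dots> = 2 * (g / A) * (1 / (s_ij * (1 - s_ij)) + 1 / (t_kl * (1 - t_kl)) -
    (1 / (t_kl * s_ij) + 1 / ((1 - t_kl) * s_ij) + 1 / (t_kl * (1 - s_ij)) + 1 / ((1 - t_kl) * (1 - s_ij))))"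
    unfolding k k' height_ratio_crossing[OF cr, folded g_def A_def] by (simp add: algebra_simps)
  also have "\<dots> < 0"
    using reciprocal_less[OF s_ij_bounds t_kl_bounds] g A by (intro mult_pos_neg) auto
  finally show ?thesis by simp
qed

end

section \<open>Geodesic segments\<close>

definition tri :: "lifted \<Rightarrow> lifted \<Rightarrow> lifted \<Rightarrow> complex set" where
  "tri P Q R = convex hull {fst P, fst Q, fst R}"

lemma tri_perm: "tri Q P R = tri P Q R" "tri P R Q = tri P Q R" "tri R Q P = tri P Q R"
  "tri Q R P = tri P Q R" "tri R P Q = tri P Q R"
  by (simp_all add: tri_def insert_commute)

lemma tri_iff: "p \<in> tri P Q R \<longleftrightarrow> (\<exists>u v w. 0 \<le> u \<and> 0 \<le> v \<and> 0 \<le> w \<and> u + v + w = 1 \<and>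
    p = u *\<^sub>R fst P + v *\<^sub>R fst Q + w *\<^sub>R fst R)"
  by (auto simp: tri_def convex_hull_3)

lemma convex_tri: "convex (tri P Q R)"
  by (simp add: tri_def)

lemma side_subset_tri: "closed_segment (fst P) (fst Q) \<subseteq> tri P Q R"
  unfolding tri_def by (intro closed_segment_subset hull_inc convex_convex_hull) auto

lemma corner_in_tri: "fst P \<in> tri P Q R" "fst Q \<in> tri P Q R" "fst R \<in> tri P Q R"
  by (simp_all add: tri_def hull_inc)

text \<open>The crossing relation allows shifting coefficients from \<open>K\<close> and
  \<open>L\<close> to \<open>I\<close> and \<open>J\<close>. This is done until the smaller one of
  \<open>\<gamma> / (1 - t)\<close> and \<open>\<delta> / t\<close> is used up.\<close>

lemma quadrilateral_split:
  assumes cr: "crossing I J K L s t"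
    and c: "0 \<le> \<alpha>" "0 \<le> \<beta>" "0 \<le> \<gamma>" "0 \<le> \<delta>" "\<alpha> + \<beta> + \<gamma> + \<delta> = 1"
    and p: "p = \<alpha> *\<^sub>R fst I + \<beta> *\<^sub>R fst J + \<gamma> *\<^sub>R fst K + \<delta> *\<^sub>R fst L"
  shows "p \<in> tri I J K \<or> p \<in> tri I J L"
proof -
  have st: "0 < s" "s < 1" "0 < t" "t < 1"
    and eq: "(1 - s) *\<^sub>R fst I + s *\<^sub>R fst J = (1 - t) *\<^sub>R fst K + t *\<^sub>R fst L"
    using cr by (auto simp: crossing_def)
  have shift: "p = (\<alpha> + r * (1 - s)) *\<^sub>R fst I + (\<beta> + r * s) *\<^sub>R fst J + (\<gamma> - r * (1 - t)) *\<^sub>R fst K + (\<delta> - r * t) *\<^sub>R fst L" for r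
  proof -
    have "r *\<^sub>R ((1 - s) *\<^sub>R fst I + s *\<^sub>R fst J) = r *\<^sub>R ((1 - t) *\<^sub>R fst K + t *\<^sub>R fst L)"
      using eq by simp
    then show ?thesis unfolding p by (simp add: algebra_simps)
  qed
  show ?thesis
  proof (cases "\<gamma> * t \<le> \<delta> * (1 - t)")
    case True
    define r where "r = \<gamma> / (1 - t)"
    have r: "0 \<le> r" "\<gamma> - r * (1 - t) = 0" "r * t \<le> \<delta>"
      using st c True by (auto simp: r_def field_simps)
    have "p \<in> tri I J L"
      unfolding tri_iff
    proof (intro exI conjI)
      show "p = (\<alpha> + r * (1 - s)) *\<^sub>R fst I + (\<beta> + r * s) *\<^sub>R fst J + (\<delta> - r * t) *\<^sub>R fst L"
        using shift[of r] r(2) by simp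
      show "\<alpha> + r * (1 - s) + (\<beta> + r * s) + (\<delta> - r * t) = 1"
        using r(2) c(5) by (simp add: algebra_simps)
    qed (use r st c in auto)
    then show ?thesis ..
  next
    case False
    define r where "r = \<delta> / t"
    have r: "0 \<le> r" "\<delta> - r * t = 0" "r * (1 - t) \<le> \<gamma>"
      using st c False by (auto simp: r_def field_simps)
    have "p \<in> tri I J K"
      unfolding tri_iff
    proof (intro exI conjI)
      show "p = (\<alpha> + r * (1 - s)) *\<^sub>R fst I + (\<beta> + r * s) *\<^sub>R fst J + (\<gamma> - r * (1 - t)) *\<^sub>R fst K"
        using shift[of r] r(2) by simp
      show "\<alpha> + r * (1 - s) + (\<beta> + r * s) + (\<gamma> - r * (1 - t)) = 1"
        using r(2) c(5) by (simp add: algebra_simps)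
    qed (use r st c in auto)
    then show ?thesis ..
  qed
qed

lemma quadrilateral_other_diagonal:
  assumes cr: "crossing I J K L s t" and p: "p \<in> tri I J K \<or> p \<in> tri I J L"
  shows "p \<in> tri K L I \<or> p \<in> tri K L J"
proof -
  note cr' = crossing_swap(1)[OF cr]
  from p show ?thesis
  proof
    assume "p \<in> tri I J K"
    then obtain u v w where "0 \<le> u" "0 \<le> v" "0 \<le> w" "u + v + w = 1" "p = u *\<^sub>R fst I + v *\<^sub>R fst J + w *\<^sub>R fst K"
      unfolding tri_iff by blast
    then show ?thesis by (intro quadrilateral_split[OF cr', of w 0 u v]) (auto simp: algebra_simps)
  next
    assume "p \<in> tri I J L"
    then obtain u v w where "0 \<le> u" "0 \<le> v" "0 \<le> w" "u + v + w = 1" "p = u *\<^sub>R fst I + v *\<^sub>R fst J + w *\<^sub>R fst L"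
      unfolding tri_iff by blast
    then show ?thesis by (intro quadrilateral_split[OF cr', of 0 w u v]) (auto simp: algebra_simps)
  qed
qed

lemma cross_tri:
  assumes "p = u *\<^sub>R fst P + v *\<^sub>R fst Q + w *\<^sub>R fst R" "u + v + w = 1"
  shows "cross (fst Q - fst P) (p - fst P) = w * area P Q R"
proof -
  have "p - fst P = v *\<^sub>R (fst Q - fst P) + w *\<^sub>R (fst R - fst P)"
  proof -
    have u: "u = 1 - v - w" using assms(2) by simp
    show ?thesis unfolding assms(1) u by (simp add: algebra_simps)
  qed
  then show ?thesis by (simp add: area_def cross_simps)
qed

lemma not_in_opposite_tri:
  assumes "area P Q R * area P Q R' < 0"
  shows "fst R' \<notin> tri P Q R"
proof
  assume "fst R' \<in> tri P Q R"
  then obtain u v w where w: "0 \<le> w" and "u + v + w = 1" "fst R' = u *\<^sub>R fst P + v *\<^sub>R fst Q + w *\<^sub>R fst R"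
    unfolding tri_iff by blast
  then have "area P Q R' = w * area P Q R"
    using cross_tri unfolding area_def[of P Q R'] by blast
  then have "area P Q R * area P Q R' = w * (area P Q R)\<^sup>2" by (simp add: power2_eq_square)
  then have "0 \<le> area P Q R * area P Q R'" using w by simp
  then show False using assms by linarith
qed

text \<open>\<open>f\<close> vanishes on the line through \<open>I\<close> and \<open>J\<close> and
  does not have the same strict sign at \<open>p\<close> and \<open>q\<close>. Its zero
  \<open>m\<close> between them lies in the quadrilateral by convexity, and there the line is the
  diagonal.\<close>

lemma segment_meets_diagonal:
  assumes cr: "crossing I J K L s t" and p: "p \<in> tri I J K" and q: "q \<in> tri I J L"
  shows "\<exists>m. m \<in> closed_segment p q \<and> m \<in> closed_segment (fst I) (fst J)"
proof -
  obtain u v w where p': "0 \<le> u" "0 \<le> v" "0 \<le> w" "u + v + w = 1" "p = u *\<^sub>R fst I + v *\<^sub>R fst J + w *\<^sub>R fst K"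
    using p unfolding tri_iff by blast
  obtain u' v' w' where q': "0 \<le> u'" "0 \<le> v'" "0 \<le> w'" "u' + v' + w' = 1" "q = u' *\<^sub>R fst I + v' *\<^sub>R fst J + w' *\<^sub>R fst L"
    using q unfolding tri_iff by blast
  define f where "f z = cross (fst J - fst I) (z - fst I)" for z
  define S where "S = cross (fst J - fst I) (fst L - fst K)"
  have st: "0 < t" "t < 1" and S: "S \<noteq> 0" using cr by (auto simp: crossing_def S_def)
  have fp: "f p = - (w * t * S)" and fq: "f q = w' * (1 - t) * S"
    using cross_tri[OF p'(5,4)] cross_tri[OF q'(5,4)] area_crossing[OF cr, folded S_def] by (simp_all add: f_def)
  have on_line: "z \<in> closed_segment (fst I) (fst J)" if "z \<in> tri I J K \<or> z \<in> tri I J L" "f z = 0" for z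
  proof -
    define R where "R = (if z \<in> tri I J K then K else L)"
    have R: "R = K \<or> R = L" and zR: "z \<in> tri I J R" using that(1) by (auto simp: R_def)
    obtain u v w where z: "0 \<le> u" "0 \<le> v" "u + v + w = 1" "z = u *\<^sub>R fst I + v *\<^sub>R fst J + w *\<^sub>R fst R"
      using zR unfolding tri_iff by blast
    have "w * area I J R = 0" using cross_tri[OF z(4,3)] that(2) by (simp add: f_def)
    moreover have "area I J K \<noteq> 0" "area I J L \<noteq> 0"
      unfolding area_crossing(1,2)[OF cr, folded S_def] using st S by simp_all
    then have "area I J R \<noteq> 0" using R by (elim disjE) simp_all
    ultimately have "w = 0" by simp
    then have u: "u = 1 - v" using z(3) by simp
    show ?thesis
      unfolding in_segment
    proof (intro exI conjI)
      show "z = (1 - v) *\<^sub>R fst I + v *\<^sub>R fst J" using z(4) unfolding u \<open>w = 0\<close> by simp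
    qed (use z(1,2) u in simp_all)
  qed
  show ?thesis
  proof (cases "w * t + w' * (1 - t) = 0")
    \<comment> \<open>Here \<open>p\<close> and \<open>q\<close> are both on the diagonal and the
      ratio \<open>r\<close> of the other case would be \<open>0 / 0\<close>; \<open>p\<close>
      itself serves.\<close>
    case True
    moreover have "0 \<le> w * t" "0 \<le> w' * (1 - t)" using p' q' st by auto
    ultimately have "w * t = 0" by linarith
    then have "f p = 0" using fp by simp
    with p have "p \<in> closed_segment (fst I) (fst J)" by (intro on_line) simp_all
    moreover have "p \<in> closed_segment p q" by simp
    ultimately show ?thesis by (intro exI conjI)
  next
    case False
    have nn: "0 \<le> w * t" "0 \<le> w' * (1 - t)" using p' q' st by auto
    define r where "r = w * t / (w * t + w' * (1 - t))"
    define m where "m = (1 - r) *\<^sub>R p + r *\<^sub>R q"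
    have pos: "0 < w * t + w' * (1 - t)" using nn False by linarith
    have r: "0 \<le> r" "r \<le> 1"
      using nn pos by (simp_all add: r_def divide_le_eq)
    have "1 - r = (w * t + w' * (1 - t) - w * t) / (w * t + w' * (1 - t))"
      unfolding diff_divide_distrib r_def using False by simp
    then have r3: "1 - r = w' * (1 - t) / (w * t + w' * (1 - t))" by simp
    have m_seg: "m \<in> closed_segment p q"
      unfolding in_segment m_def using r by auto
    have "f m = (1 - r) * f p + r * f q"
      by (simp add: f_def m_def cross_def algebra_simps)
    also have "\<dots> = 0" unfolding fp fq r3 by (simp add: r_def)
    finally have "f m = 0" .
    moreover have "m \<in> tri I J K \<or> m \<in> tri I J L"
    proof (rule quadrilateral_split[OF cr, of "(1 - r) * u + r * u'" "(1 - r) * v + r * v'" "(1 - r) * w" "r * w'"])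
      have "(1 - r) * (u + v + w) + r * (u' + v' + w') = 1" unfolding p'(4) q'(4) by simp
      then show "(1 - r) * u + r * u' + ((1 - r) * v + r * v') + (1 - r) * w + r * w' = 1"
        by (simp add: algebra_simps)
      show "m = ((1 - r) * u + r * u') *\<^sub>R fst I + ((1 - r) * v + r * v') *\<^sub>R fst J + ((1 - r) * w) *\<^sub>R fst K + (r * w') *\<^sub>R fst L"
        unfolding m_def p'(5) q'(5) by (simp add: algebra_simps)
    qed (use r p'(1-3) q'(1-3) in \<open>auto intro!: add_nonneg_nonneg mult_nonneg_nonneg\<close>)
    ultimately have "m \<in> closed_segment (fst I) (fst J)" by (intro on_line)
    then show ?thesis using m_seg by blast
  qed
qed

section \<open>Geodesic segments developed onto the real axis\<close>

definition touches :: "real \<Rightarrow> lifted \<Rightarrow> lifted \<Rightarrow> lifted \<Rightarrow> bool" where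
  "touches l P Q R \<longleftrightarrow> (\<exists>t. 0 < t \<and> t < l \<and> of_real t \<in> tri P Q R)"

text \<open>The weights travel with the end points, so that \<open>a - b\<close> can be read off in
  any triangulation. Inner points of the segment are kept off the corners, since there is no
  well-defined straight continuation through a vertex.\<close>

definition ends_at_corners where
  "ends_at_corners l a b t P Q R \<longleftrightarrow> (t = 0 \<longrightarrow> (0, a) \<in> {P, Q, R}) \<and>
     (t = l \<longrightarrow> (complex_of_real l, b) \<in> {P, Q, R}) \<and>
     (0 < t \<longrightarrow> t < l \<longrightarrow> of_real t \<notin> {fst P, fst Q, fst R})"

text \<open>\<open>S\<close> contains the placed triangles that the segment from \<open>0\<close> to \<open>l\<close> on the real axis traverses;
  the segment is required to be a geodesic between two vertices, at the lifted points \<open>(0, a)\<close> and \<open>(l, b)\<close>.\<close>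

definition track :: "'f triangulation \<Rightarrow> ('f \<Rightarrow> real) \<Rightarrow> real \<Rightarrow> real \<Rightarrow> real \<Rightarrow>
    ('f \<times> lifted \<times> lifted \<times> lifted) set \<Rightarrow> bool" where
  "track T d l a b S \<longleftrightarrow>
     (\<forall>z P Q R. (z, P, Q, R) \<in> S \<longrightarrow> placed T d z P Q R \<and> (chg_vertex T z, Q, P, R) \<in> S \<and>
        (chg_edge T z, P, R, Q) \<in> S \<and> touches l P Q R) \<and>
     (\<forall>z P Q R R' t. (z, P, Q, R) \<in> S \<longrightarrow> 0 < t \<longrightarrow> t < l \<longrightarrow>
        of_real t \<in> closed_segment (fst P) (fst Q) \<longrightarrow>
        placed T d (chg_triangle T z) P Q R' \<longrightarrow> area P Q R * area P Q R' < 0 \<longrightarrow> (chg_triangle T z, P, Q, R') \<in> S) \<and>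
     (\<forall>z P Q R t. (z, P, Q, R) \<in> S \<longrightarrow> 0 \<le> t \<longrightarrow> t \<le> l \<longrightarrow> of_real t \<in> tri P Q R \<longrightarrow>
        ends_at_corners l a b t P Q R) \<and>
     (\<exists>z P Q R t. (z, P, Q, R) \<in> S \<and> 0 < t \<and> t \<le> l \<and> 0 \<in> tri P Q R \<and> of_real t \<in> tri P Q R)"

lemma trackI:
  assumes "\<And>z P Q R. (z, P, Q, R) \<in> S \<Longrightarrow> placed T d z P Q R \<and> (chg_vertex T z, Q, P, R) \<in> S \<and>
        (chg_edge T z, P, R, Q) \<in> S \<and> touches l P Q R"
    and "\<And>z P Q R R' t. \<lbrakk>(z, P, Q, R) \<in> S; 0 < t; t < l; of_real t \<in> closed_segment (fst P) (fst Q);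
        placed T d (chg_triangle T z) P Q R'; area P Q R * area P Q R' < 0\<rbrakk> \<Longrightarrow> (chg_triangle T z, P, Q, R') \<in> S"
    and "\<And>z P Q R t. \<lbrakk>(z, P, Q, R) \<in> S; 0 \<le> t; t \<le> l; of_real t \<in> tri P Q R\<rbrakk> \<Longrightarrow>
        ends_at_corners l a b t P Q R"
    and "\<exists>z P Q R t. (z, P, Q, R) \<in> S \<and> 0 < t \<and> t \<le> l \<and> 0 \<in> tri P Q R \<and> of_real t \<in> tri P Q R"
  shows "track T d l a b S"
  unfolding track_def
  by (rule conjI, intro allI impI, rule assms(1), assumption, rule conjI, intro allI impI, rule assms(2), assumption+,
      rule conjI, intro allI impI, rule assms(3), assumption+, rule assms(4))

lemma trackD:
  assumes "track T d l a b S" "(z, P, Q, R) \<in> S"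
  shows "placed T d z P Q R" "(chg_vertex T z, Q, P, R) \<in> S" "(chg_edge T z, P, R, Q) \<in> S"
    "touches l P Q R"
    "\<And>t R'. \<lbrakk>0 < t; t < l; of_real t \<in> closed_segment (fst P) (fst Q); placed T d (chg_triangle T z) P Q R';
      area P Q R * area P Q R' < 0\<rbrakk> \<Longrightarrow> (chg_triangle T z, P, Q, R') \<in> S"
    "0 \<le> l \<Longrightarrow> 0 \<in> tri P Q R \<Longrightarrow> (0, a) \<in> {P, Q, R}"
    "0 \<le> l \<Longrightarrow> of_real l \<in> tri P Q R \<Longrightarrow> (complex_of_real l, b) \<in> {P, Q, R}"
    "\<And>t. \<lbrakk>0 < t; t < l; of_real t \<in> tri P Q R\<rbrakk> \<Longrightarrow> of_real t \<notin> {fst P, fst Q, fst R}"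
proof -
  note tr = assms(1)[unfolded track_def]
  show "placed T d z P Q R" "(chg_vertex T z, Q, P, R) \<in> S" "(chg_edge T z, P, R, Q) \<in> S"
    "touches l P Q R"
    using tr[THEN conjunct1] assms(2) by blast+
  show "(chg_triangle T z, P, Q, R') \<in> S" if "0 < t" "t < l" "of_real t \<in> closed_segment (fst P) (fst Q)"
    "placed T d (chg_triangle T z) P Q R'" "area P Q R * area P Q R' < 0" for t R'
    using tr[THEN conjunct2, THEN conjunct1] assms(2) that by blast
  note tr3 = tr[THEN conjunct2, THEN conjunct2, THEN conjunct1, rule_format, OF assms(2), unfolded ends_at_corners_def]
  show "(0, a) \<in> {P, Q, R}" if "0 \<le> l" "0 \<in> tri P Q R" using tr3[of 0] that by simp
  show "(complex_of_real l, b) \<in> {P, Q, R}" if "0 \<le> l" "of_real l \<in> tri P Q R" using tr3[of l] that by simp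
  show "of_real t \<notin> {fst P, fst Q, fst R}" if "0 < t" "t < l" "of_real t \<in> tri P Q R" for t
    using tr3[of t] that by simp
qed

lemma real_segment:
  assumes "m \<in> closed_segment (complex_of_real r) (complex_of_real s)"
  obtains y where "m = complex_of_real y" "min r s \<le> y" "y \<le> max r s"
proof -
  obtain u where u: "0 \<le> u" "u \<le> 1" "m = (1 - u) *\<^sub>R complex_of_real r + u *\<^sub>R complex_of_real s"
    using assms by (auto simp: in_segment)
  have m: "m = complex_of_real ((1 - u) * r + u * s)" using u(3) by (simp add: scaleR_conv_of_real)
  have "(1 - u) * r + u * s \<in> closed_segment r s" using u by (auto simp: in_segment)
  then show ?thesis using that[OF m] by (auto simp: closed_segment_eq_real_ivl split: if_splits)
qed

text \<open>The way from an inner point of the segment to \<open>t\<close> meets the common side in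
  some \<open>y\<close>. If \<open>y\<close> is an inner point as well, the triangle behind the side
  belongs to the track; otherwise \<open>y\<close> is an end of the segment and equals
  \<open>t\<close>.\<close>

lemma track_across:
  assumes tr: "track T d l a b S" and mem: "(z, P, Q, R) \<in> S" and cr: "crossing P Q R R' s u"
    and p: "placed T d (chg_triangle T z) P Q R'" "area P Q R * area P Q R' < 0"
    and t: "0 \<le> t" "t \<le> l" "of_real t \<in> tri P Q R'"
  shows "(chg_triangle T z, P, Q, R') \<in> S \<or> (of_real t \<in> tri P Q R \<and> (t = 0 \<or> t = l))"
proof -
  obtain r where r: "0 < r" "r < l" "of_real r \<in> tri P Q R"
    using trackD(4)[OF tr mem] unfolding touches_def by blast
  obtain m where m: "m \<in> closed_segment (complex_of_real r) (complex_of_real t)" "m \<in> closed_segment (fst P) (fst Q)"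
    using segment_meets_diagonal[OF cr r(3) t(3)] by blast
  obtain y where y: "m = complex_of_real y" "min r t \<le> y" "y \<le> max r t"
    using real_segment[OF m(1)] .
  show ?thesis
  proof (cases "0 < y \<and> y < l")
    case True
    then show ?thesis using trackD(5)[OF tr mem _ _ _ p] m(2) y(1) by blast
  next
    case False
    then have "y = t" "t = 0 \<or> t = l" using y r t by auto
    then show ?thesis using m(2) y(1) side_subset_tri by blast
  qed
qed

context flag_surface begin

lemma orbit_closed:
  assumes "(z', P', Q', R') \<in> orbit T z P Q R"
  shows "(V z', Q', P', R') \<in> orbit T z P Q R" "(E z', P', R', Q') \<in> orbit T z P Q R"
  using assms unfolding orbit_def Let_def by (elim insertE emptyE; simp)+

lemma orbit_subset:
  assumes cl: "\<And>z P Q R. (z, P, Q, R) \<in> S \<Longrightarrow> (V z, Q, P, R) \<in> S \<and> (E z, P, R, Q) \<in> S"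
    and "(z', P', Q', R') \<in> orbit T z P Q R" "(z', P', Q', R') \<in> S"
  shows "orbit T z P Q R \<subseteq> S"
proof -
  have sub: "orbit T z P Q R \<subseteq> S" if mem: "(z, P, Q, R) \<in> S" for z P Q R
  proof -
    have "(V z, Q, P, R) \<in> S" "(E z, P, R, Q) \<in> S" using cl[OF mem] by blast+
    moreover from this have "(E (V z), Q, R, P) \<in> S" "(V (E z), R, P, Q) \<in> S" using cl by blast+
    moreover from this have "(V (E (V z)), R, Q, P) \<in> S" using cl by blast
    ultimately show ?thesis using mem unfolding orbit_def Let_def by (intro insert_subsetI empty_subsetI)
  qed
  have "(z, P, Q, R) \<in> orbit T z' P' Q' R'"
    using assms(2) unfolding orbit_def Let_def by (elim insertE emptyE; simp)
  then have "(z, P, Q, R) \<in> S" using sub[OF assms(3)] by blast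
  then show ?thesis by (rule sub)
qed

end

lemma orbit_tri:
  assumes "(z', P', Q', R') \<in> orbit T z P Q R"
  shows "tri P' Q' R' = tri P Q R" "{P', Q', R'} = {P, Q, R}" "{fst P', fst Q', fst R'} = {fst P, fst Q, fst R}"
  using assms unfolding orbit_def Let_def
  by (elim insertE emptyE; simp add: tri_def insert_commute)+

context duality begin

lemma orbit_placed:
  assumes "placed T d z P Q R" "(z', P', Q', R') \<in> orbit T z P Q R"
  shows "placed T d z' P' Q' R'"
proof -
  have "orbit T z P Q R \<subseteq> {(z, P, Q, R). placed T d z P Q R}"
    using assms(1) by (intro orbit_subset[of _ z P Q R]) (auto simp: orbit_def Let_def)
  then show ?thesis using assms(2) by auto
qed

end

section \<open>Segments when a flip is undone\<close>

context flip begin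

text \<open>The segment may visit several developed copies of the quadrilateral. In each of them the
  new triangles are replaced by those old ones that the segment touches (\<open>S2\<close>); the
  triangles outside the hinge stay (\<open>S1\<close>).\<close>

lemma track_flip:
  assumes tr: "track T' d' l a b S'" and l: "0 < l"
  obtains S where "track T d l a b S"
proof -
  \<comment> \<open>A copy counts as visited if at least one of its new triangles is on the track;
    the segment may miss the other one.\<close>
  define HQ where "HQ I J K L \<longleftrightarrow> hinge T d x I J K L \<and> ((x, K, L, I) \<in> S' \<or> (F x, K, L, J) \<in> S')" for I J K L
  define S1 where "S1 = {(z, P, Q, R). (z, P, Q, R) \<in> S' \<and> z \<notin> hinge_flags}"
  define S2 where "S2 = {\<sigma>. \<exists>I J K L. HQ I J K L \<and> (\<sigma> \<in> orbit T x I J K \<and> touches l I J K \<or> \<sigma> \<in> orbit T (F x) I J L \<and> touches l I J L)}"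
  define S where "S = S1 \<union> S2"
  have closed': "(V z, Q, P, R) \<in> S' \<and> (E' z, P, R, Q) \<in> S'" if "(z, P, Q, R) \<in> S'" for z P Q R
    using trackD(2,3)[OF tr that] by simp
  have HQ_hinge: "hinge T d x I J K L" if "HQ I J K L" for I J K L using that by (simp add: HQ_def)
  have HQ_cr: "crossing I J K L s_ij t_kl" "crossing K L I J t_kl s_ij" "crossing K L J I t_kl (1 - s_ij)" if "HQ I J K L" for I J K L
  proof -
    show c: "crossing I J K L s_ij t_kl" by (rule hinge_crossing[OF HQ_hinge[OF that]])
    show "crossing K L I J t_kl s_ij" by (rule crossing_swap(1)[OF c])
    then show "crossing K L J I t_kl (1 - s_ij)" by (rule crossing_swap(3))
  qed
  have HQ_new: "placed T' d' x K L I" "placed T' d' (F x) K L J" "area K L I * area K L J < 0" if "HQ I J K L" for I J K L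
    using hinge_flip[OF HQ_hinge[OF that]] by (auto simp: hinge_def)
  have HQ_old: "placed T d x I J K" "placed T d (F x) I J L" "area I J K * area I J L < 0" if "HQ I J K L" for I J K L
    using HQ_hinge[OF that] by (auto simp: hinge_def)
  \<comment> \<open>If only one of the two new triangles is on the track, then by
    \<open>track_across\<close> a point of the segment in the other one is an end of the segment and
    lies in the first one as well.\<close>
  have reach: "((x, K, L, I) \<in> S' \<and> of_real t \<in> tri K L I \<or> (F x, K, L, J) \<in> S' \<and> of_real t \<in> tri K L J) \<and>
      (0 < t \<longrightarrow> t < l \<longrightarrow> of_real t \<in> tri K L I \<longrightarrow> (x, K, L, I) \<in> S') \<and>
      (0 < t \<longrightarrow> t < l \<longrightarrow> of_real t \<in> tri K L J \<longrightarrow> (F x, K, L, J) \<in> S')"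
    if HQ: "HQ I J K L" and t: "0 \<le> t" "t \<le> l" and q: "of_real t \<in> tri K L I \<or> of_real t \<in> tri K L J" for I J K L t
  proof -
    note n = HQ_new[OF HQ]
    have n3: "area K L J * area K L I < 0" using n(3) by (simp add: mult.commute)
    have A: "(F x, K, L, J) \<in> S' \<or> of_real t \<in> tri K L I \<and> (t = 0 \<or> t = l)"
      if "(x, K, L, I) \<in> S'" "of_real t \<in> tri K L J"
      using track_across[OF tr that(1) HQ_cr(2)[OF HQ] _ n(3) t that(2)] n(2) by simp
    have B: "(x, K, L, I) \<in> S' \<or> of_real t \<in> tri K L J \<and> (t = 0 \<or> t = l)"
      if "(F x, K, L, J) \<in> S'" "of_real t \<in> tri K L I"
      using track_across[OF tr that(1) HQ_cr(3)[OF HQ] _ n3 t that(2)] n(1) by simp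
    have or: "(x, K, L, I) \<in> S' \<or> (F x, K, L, J) \<in> S'" using HQ by (simp add: HQ_def)
    have "(x, K, L, I) \<in> S' \<and> of_real t \<in> tri K L I \<or> (F x, K, L, J) \<in> S' \<and> of_real t \<in> tri K L J"
      using or A B q by auto
    moreover have "(x, K, L, I) \<in> S'" if "0 < t" "t < l" "of_real t \<in> tri K L I"
      using or B that by auto
    moreover have "(F x, K, L, J) \<in> S'" if "0 < t" "t < l" "of_real t \<in> tri K L J"
      using or A that by auto
    ultimately show ?thesis by blast
  qed
  have reach_old: "((x, K, L, I) \<in> S' \<and> of_real t \<in> tri K L I \<or> (F x, K, L, J) \<in> S' \<and> of_real t \<in> tri K L J)"
    if HQ: "HQ I J K L" and t: "0 \<le> t" "t \<le> l" and q: "of_real t \<in> tri I J K \<or> of_real t \<in> tri I J L" for I J K L t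
    using reach[OF HQ t quadrilateral_other_diagonal[OF HQ_cr(1)[OF HQ] q]] by blast
  have reach_x: "(x, K, L, I) \<in> S'" if "HQ I J K L" "0 < t" "t < l" "of_real t \<in> tri K L I" for I J K L t
    using reach[OF that(1), of t] that by simp
  have reach_Fx: "(F x, K, L, J) \<in> S'" if "HQ I J K L" "0 < t" "t < l" "of_real t \<in> tri K L J" for I J K L t
    using reach[OF that(1), of t] that by simp

  have HQ_of: "\<exists>I J K L. HQ I J K L \<and> (orbit T' x K L I \<subseteq> S' \<and> (z, P, Q, R) \<in> orbit T' x K L I \<or>
      orbit T' (F x) K L J \<subseteq> S' \<and> (z, P, Q, R) \<in> orbit T' (F x) K L J)"
    if mem: "(z, P, Q, R) \<in> S'" and z: "z \<in> hinge_flags" for z P Q R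
  proof -
    obtain I J K L where h: "hinge T d x I J K L" and o: "(z, P, Q, R) \<in> orbit T' x K L I \<union> orbit T' (F x) K L J"
      using placed_hinge_cases[OF trackD(1)[OF tr mem] z] .
    have cl: "\<And>z P Q R. (z, P, Q, R) \<in> S' \<Longrightarrow> (chg_vertex T' z, Q, P, R) \<in> S' \<and> (E' z, P, R, Q) \<in> S'"
      using closed' by simp
    have sub: "orbit T' y A B C \<subseteq> S'" if "(z, P, Q, R) \<in> orbit T' y A B C" for y A B C
      by (rule T'.orbit_subset[OF cl that mem])
    have rep: "(y, A, B, C) \<in> orbit T' y A B C" for y and A B C :: "lifted" by (simp add: orbit_def Let_def)
    from o show ?thesis
    proof
      assume o: "(z, P, Q, R) \<in> orbit T' x K L I"
      then have "HQ I J K L" using h sub[OF o] rep[of x K L I] by (auto simp: HQ_def)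
      then show ?thesis using o sub[OF o] by blast
    next
      assume o: "(z, P, Q, R) \<in> orbit T' (F x) K L J"
      then have "HQ I J K L" using h sub[OF o] rep[of "F x" K L J] by (auto simp: HQ_def)
      then show ?thesis using o sub[OF o] by blast
    qed
  qed

  have S2_cases: "\<exists>I J K L. HQ I J K L \<and> ((z, P, Q, R) \<in> orbit T x I J K \<and> touches l I J K \<or> (z, P, Q, R) \<in> orbit T (F x) I J L \<and> touches l I J L)"
    if "(z, P, Q, R) \<in> S2" for z P Q R
    using that by (simp add: S2_def)
  have S2I: "(z, P, Q, R) \<in> S2" if "HQ I J K L" "(z, P, Q, R) \<in> orbit T x I J K \<and> touches l I J K \<or> (z, P, Q, R) \<in> orbit T (F x) I J L \<and> touches l I J L"
    for z P Q R I J K L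
    unfolding S2_def using that by blast
  have S2_hinge: "z \<in> hinge_flags" if "(z, P, Q, R) \<in> S2" for z P Q R
    using that unfolding S2_def orbit_T hinge_flags_def by (elim CollectE exE conjE disjE insertE emptyE) simp_all

  have touchI: "touches l I J K" if "0 < t" "t < l" "of_real t \<in> closed_segment (fst P) (fst Q)" "(z, P, Q, R) \<in> orbit T y I J K" for z P Q R y I J K t
    using that side_subset_tri[of P Q R] orbit_tri(1)[OF that(4)] unfolding touches_def by blast
  have seg: "closed_segment (fst I) (fst K) \<subseteq> tri K L I" "closed_segment (fst I) (fst L) \<subseteq> tri K L I"
    "closed_segment (fst J) (fst K) \<subseteq> tri K L J" "closed_segment (fst J) (fst L) \<subseteq> tri K L J" for I J K L
    using side_subset_tri[of I K L] side_subset_tri[of I L K] side_subset_tri[of J K L] side_subset_tri[of J L K]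
    by (auto simp: tri_perm(5)[of I K L] tri_perm(3)[of I L K] tri_perm(5)[of J K L] tri_perm(3)[of J L K])
  have sub_x: "(E x, I, K, L) \<in> S'" "(V (E x), K, I, L) \<in> S'" "(E (F x), I, L, K) \<in> S'" "(V (E (F x)), L, I, K) \<in> S'"
    if "(x, K, L, I) \<in> S'" for I K L
  proof -
    have 1: "(V (E x), K, I, L) \<in> S'" "(V (E (F x)), L, I, K) \<in> S'"
      using closed'[OF that] closed'[of "V x" L K I] by auto
    show "(E x, I, K, L) \<in> S'" "(V (E x), K, I, L) \<in> S'" "(E (F x), I, L, K) \<in> S'" "(V (E (F x)), L, I, K) \<in> S'"
      using 1 closed'[OF 1(1)] closed'[OF 1(2)] by simp_all
  qed
  have sub_Fx: "(E (V x), J, K, L) \<in> S'" "(V (E (V x)), K, J, L) \<in> S'" "(E (V (F x)), J, L, K) \<in> S'" "(V (E (V (F x))), L, J, K) \<in> S'"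
    if "(F x, K, L, J) \<in> S'" for J K L
  proof -
    have 1: "(V (E (V x)), K, J, L) \<in> S'" "(V (E (V (F x))), L, J, K) \<in> S'"
      using closed'[OF that] closed'[of "V (F x)" L K J] by auto
    show "(E (V x), J, K, L) \<in> S'" "(V (E (V x)), K, J, L) \<in> S'" "(E (V (F x)), J, L, K) \<in> S'" "(V (E (V (F x))), L, J, K) \<in> S'"
      using 1 closed'[OF 1(1)] closed'[OF 1(2)] by simp_all
  qed
  have side: "0 < area I K J * area I K L" "0 < area K I J * area K I L" "0 < area I L J * area I L K" "0 < area L I J * area L I K"
    "0 < area J K I * area J K L" "0 < area K J I * area K J L" "0 < area J L I * area J L K" "0 < area L J I * area L J K"
    if "HQ I J K L" for I J K L
    using same_side_crossing[OF HQ_cr(1)[OF that]]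
    unfolding area_swap(1)[where Q = K and P = I] area_swap(1)[where Q = L and P = I]
      area_swap(1)[where Q = K and P = J] area_swap(1)[where Q = L and P = J] by simp_all
  have area_sq: "0 < area P Q R * area P Q R" if "placed T d z P Q R" for z P Q R
    using third_if_placed(2)[OF that] by (auto simp: zero_less_mult_iff linorder_neq_iff)
  have S1_D: "(z, P, Q, R) \<in> S'" "z \<notin> hinge_flags" if "(z, P, Q, R) \<in> S1" for z P Q R
    using that by (simp_all add: S1_def)
  have S1_placed: "placed T d z P Q R" if "(z, P, Q, R) \<in> S1" for z P Q R
    using S1_D[OF that] trackD(1)[OF tr] placed_other by blast
  \<comment> \<open>A crossed edge other than a diagonal belongs to both triangulations, with the
    third corners on the same side of it. \<open>down\<close> passes to the flipped triangulation
    and \<open>up\<close> returns.\<close>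
  have down: "\<exists>R1. (z, P, Q, R1) \<in> S' \<and> 0 < area P Q R * area P Q R1"
    if mem: "(z, P, Q, R) \<in> S" and z: "z \<notin> diag" and t: "0 < t" "t < l" "of_real t \<in> closed_segment (fst P) (fst Q)" for z P Q R t
  proof (cases "(z, P, Q, R) \<in> S1")
    case True
    then show ?thesis using area_sq[OF S1_placed[OF True]] S1_D[OF True] by blast
  next
    case False
    then have "(z, P, Q, R) \<in> S2" using mem by (simp add: S_def)
    then obtain I J K L where HQ: "HQ I J K L" and o: "(z, P, Q, R) \<in> orbit T x I J K \<union> orbit T (F x) I J L"
      using S2_cases by blast
    have X: "(x, K, L, I) \<in> S'" if "of_real t \<in> closed_segment (fst I) (fst K) \<or> of_real t \<in> closed_segment (fst I) (fst L)"
      using reach_x[OF HQ t(1,2)] seg that by blast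
    have Y: "(F x, K, L, J) \<in> S'" if "of_real t \<in> closed_segment (fst J) (fst K) \<or> of_real t \<in> closed_segment (fst J) (fst L)"
      using reach_Fx[OF HQ t(1,2)] seg that by blast
    have "z \<noteq> x" "z \<noteq> V x" "z \<noteq> F x" "z \<noteq> V (F x)" using z by (auto simp: diag_def)
    with o have "(z, P, Q, R) \<in> {(E x, I, K, J), (V (E x), K, I, J)} \<union> {(E (V x), J, K, I), (V (E (V x)), K, J, I)} \<union>
      {(E (F x), I, L, J), (V (E (F x)), L, I, J)} \<union> {(E (V (F x)), J, L, I), (V (E (V (F x))), L, J, I)}"
      unfolding orbit_T by auto
    then show ?thesis
    proof (elim UnE)
      assume 1: "(z, P, Q, R) \<in> {(E x, I, K, J), (V (E x), K, I, J)}"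
      then have "of_real t \<in> closed_segment (fst I) (fst K)" using t(3) by (auto simp: closed_segment_commute)
      then have "(x, K, L, I) \<in> S'" by (intro X) simp
      from 1 sub_x[OF this] side[OF HQ] show ?thesis
        by (elim insertE emptyE; elim Pair_inject; hypsubst; intro exI[of _ L]) simp_all
    next
      assume 2: "(z, P, Q, R) \<in> {(E (V x), J, K, I), (V (E (V x)), K, J, I)}"
      then have "of_real t \<in> closed_segment (fst J) (fst K)" using t(3) by (auto simp: closed_segment_commute)
      then have "(F x, K, L, J) \<in> S'" by (intro Y) simp
      from 2 sub_Fx[OF this] side[OF HQ] show ?thesis
        by (elim insertE emptyE; elim Pair_inject; hypsubst; intro exI[of _ L]) simp_all
    next
      assume 3: "(z, P, Q, R) \<in> {(E (F x), I, L, J), (V (E (F x)), L, I, J)}"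
      then have "of_real t \<in> closed_segment (fst I) (fst L)" using t(3) by (auto simp: closed_segment_commute)
      then have "(x, K, L, I) \<in> S'" by (intro X) simp
      from 3 sub_x[OF this] side[OF HQ] show ?thesis
        by (elim insertE emptyE; elim Pair_inject; hypsubst; intro exI[of _ K]) simp_all
    next
      assume 4: "(z, P, Q, R) \<in> {(E (V (F x)), J, L, I), (V (E (V (F x))), L, J, I)}"
      then have "of_real t \<in> closed_segment (fst J) (fst L)" using t(3) by (auto simp: closed_segment_commute)
      then have "(F x, K, L, J) \<in> S'" by (intro Y) simp
      from 4 sub_Fx[OF this] side[OF HQ] show ?thesis
        by (elim insertE emptyE; elim Pair_inject; hypsubst; intro exI[of _ K]) simp_all
    qed
  qed
  have up: "\<exists>R. (z, P, Q, R) \<in> S \<and> 0 < area P Q R * area P Q R1"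
    if mem: "(z, P, Q, R1) \<in> S'" and z: "z \<notin> diag" and t: "0 < t" "t < l" "of_real t \<in> closed_segment (fst P) (fst Q)" for z P Q R1 t
  proof (cases "z \<in> hinge_flags")
    case False
    then have 1: "(z, P, Q, R1) \<in> S1" using mem by (simp add: S1_def)
    then have "(z, P, Q, R1) \<in> S" by (simp add: S_def)
    then show ?thesis using area_sq[OF S1_placed[OF 1]] by blast
  next
    case True
    obtain I J K L where HQ: "HQ I J K L" and o: "(z, P, Q, R1) \<in> orbit T' x K L I \<union> orbit T' (F x) K L J"
      using HQ_of[OF mem True] by blast
    have old: "(z, P, Q, R) \<in> S" if "(z, P, Q, R) \<in> orbit T x I J K \<union> orbit T (F x) I J L" for R
      using that S2I[OF HQ, of z P Q R] touchI[OF t] unfolding S_def by blast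
    have "z \<noteq> x" "z \<noteq> V x" "z \<noteq> F x" "z \<noteq> V (F x)" using z by (auto simp: diag_def)
    with o have "(z, P, Q, R1) \<in> {(E x, I, K, L), (V (E x), K, I, L), (E (F x), I, L, K), (V (E (F x)), L, I, K)} \<union>
      {(E (V x), J, K, L), (V (E (V x)), K, J, L), (E (V (F x)), J, L, K), (V (E (V (F x))), L, J, K)}"
      unfolding orbit_T'_x orbit_T'_Fx by auto
    then show ?thesis
    proof (elim UnE)
      assume "(z, P, Q, R1) \<in> {(E x, I, K, L), (V (E x), K, I, L), (E (F x), I, L, K), (V (E (F x)), L, I, K)}"
      then show ?thesis using old[of J] side[OF HQ]
        by (elim insertE emptyE; elim Pair_inject; hypsubst; intro exI[of _ J]) (simp_all add: orbit_T)
    next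
      assume "(z, P, Q, R1) \<in> {(E (V x), J, K, L), (V (E (V x)), K, J, L), (E (V (F x)), J, L, K), (V (E (V (F x))), L, J, K)}"
      then show ?thesis using old[of I] side[OF HQ]
        by (elim insertE emptyE; elim Pair_inject; hypsubst; intro exI[of _ I]) (simp_all add: orbit_T)
    qed
  qed

  have track1: "placed T d z P Q R \<and> (V z, Q, P, R) \<in> S \<and> (E z, P, R, Q) \<in> S \<and> touches l P Q R"
    if mem: "(z, P, Q, R) \<in> S" for z P Q R
  proof (cases "(z, P, Q, R) \<in> S1")
    case True
    then have 1: "(z, P, Q, R) \<in> S'" "z \<notin> hinge_flags" by (simp_all add: S1_def)
    then have "(V z, Q, P, R) \<in> S1" "(E z, P, R, Q) \<in> S1"
      using closed'[OF 1(1)] by (simp_all add: S1_def)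
    then show ?thesis
      using S1_placed[OF True] trackD(4)[OF tr 1(1)] by (simp add: S_def touches_def)
  next
    case False
    then have "(z, P, Q, R) \<in> S2" using mem by (simp add: S_def)
    then obtain I J K L where HQ: "HQ I J K L"
      and o: "(z, P, Q, R) \<in> orbit T x I J K \<and> touches l I J K \<or> (z, P, Q, R) \<in> orbit T (F x) I J L \<and> touches l I J L"
      using S2_cases by blast
    from o show ?thesis
    proof
      assume o: "(z, P, Q, R) \<in> orbit T x I J K \<and> touches l I J K"
      then have "(V z, Q, P, R) \<in> S2" "(E z, P, R, Q) \<in> S2"
        using orbit_closed[of z P Q R x I J K] by (auto intro!: S2I[OF HQ])
      then show ?thesis
        using o orbit_placed[OF HQ_old(1)[OF HQ]] orbit_tri(1)[of z P Q R T x I J K] by (simp add: S_def touches_def)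
    next
      assume o: "(z, P, Q, R) \<in> orbit T (F x) I J L \<and> touches l I J L"
      then have "(V z, Q, P, R) \<in> S2" "(E z, P, R, Q) \<in> S2"
        using orbit_closed[of z P Q R "F x" I J L] by (auto intro!: S2I[OF HQ])
      then show ?thesis
        using o orbit_placed[OF HQ_old(2)[OF HQ]] orbit_tri(1)[of z P Q R T "F x" I J L] by (simp add: S_def touches_def)
    qed
  qed

  have track2: "(F z, P, Q, R') \<in> S"
    if mem: "(z, P, Q, R) \<in> S" and t: "0 < t" "t < l" "of_real t \<in> closed_segment (fst P) (fst Q)"
      and p: "placed T d (F z) P Q R'" and opp: "area P Q R * area P Q R' < 0" for z P Q R R' t
  proof (cases "z \<in> diag")
    case True
    then have "(z, P, Q, R) \<in> S2" using mem diag_hinge by (auto simp: S_def S1_def)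
    then obtain I J K L where HQ: "HQ I J K L"
      and o: "(z, P, Q, R) \<in> orbit T x I J K \<union> orbit T (F x) I J L"
      using S2_cases by blast
    note old = HQ_old[OF HQ]
    have uniq: "R' = R''" if "placed T d (F z) P Q R''" "area P Q R * area P Q R'' < 0" for R''
      using placed_unique[OF p that(1)] opp that(2) by (auto simp: zero_less_mult_iff mult_less_0_iff)
    have "(z, P, Q, R) \<in> {(x, I, J, K), (V x, J, I, K), (F x, I, J, L), (V (F x), J, I, L)}"
    proof -
      have "z \<notin> {E x, V (E x), E (V x), V (E (V x)), E (F x), V (E (F x)), E (V (F x)), V (E (V (F x)))}"
        using True by (intro notI) (elim insertE emptyE; simp)
      then show ?thesis using o unfolding orbit_T by auto
    qed
    then have "(F z, P, Q, R') \<in> orbit T x I J K \<union> orbit T (F x) I J L"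
    proof (elim insertE emptyE)
      assume "(z, P, Q, R) = (x, I, J, K)"
      then have [simp]: "z = x" "P = I" "Q = J" "R = K" by simp_all
      show ?thesis using uniq[of L] old by (simp add: orbit_T)
    next
      assume "(z, P, Q, R) = (V x, J, I, K)"
      then have [simp]: "z = V x" "P = J" "Q = I" "R = K" by simp_all
      show ?thesis using uniq[of L] placed_V[OF old(2)] old(3)
        by (simp add: orbit_T area_swap(1)[of I J])
    next
      assume "(z, P, Q, R) = (F x, I, J, L)"
      then have [simp]: "z = F x" "P = I" "Q = J" "R = L" by simp_all
      show ?thesis using uniq[of K] old by (simp add: orbit_T mult.commute)
    next
      assume "(z, P, Q, R) = (V (F x), J, I, L)"
      then have [simp]: "z = V (F x)" "P = J" "Q = I" "R = L" by simp_all
      show ?thesis using uniq[of K] placed_V[OF old(1)] old(3)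
        by (simp add: orbit_T area_swap(1)[of I J] mult.commute)
    qed
    then have "(F z, P, Q, R') \<in> S2"
      using S2I[OF HQ] touchI[OF t] by blast
    then show ?thesis by (simp add: S_def)
  next
    case False
    \<comment> \<open>The edge is crossed in the flipped triangulation and the neighbour is carried
      back; it is the given one by uniqueness, as an even number of changes of the side is
      made.\<close>
    obtain R1 where R1: "(z, P, Q, R1) \<in> S'" "0 < area P Q R * area P Q R1"
      using down[OF mem False t] by blast
    obtain R2 where R2: "placed T' d' (chg_triangle T' z) P Q R2" "area P Q R1 * area P Q R2 < 0"
      by (rule T'.placed_opposite_exists[OF trackD(1)[OF tr R1(1)]])
    have "(F z, P, Q, R2) \<in> S'"
      using trackD(5)[OF tr R1(1) t R2] by simp
    moreover have "F z \<notin> diag" using False by simp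
    ultimately obtain R3 where R3: "(F z, P, Q, R3) \<in> S" "0 < area P Q R3 * area P Q R2"
      using up[OF _ _ t] by blast
    have "0 < area P Q R3 * area P Q R'"
      using R1 R2 R3 opp by (auto simp: zero_less_mult_iff mult_less_0_iff)
    then have "R3 = R'" using placed_unique[OF _ p] track1[OF R3(1)] by blast
    then show ?thesis using R3 by simp
  qed

  have corner: "ends_at_corners l a b t P Q R"
    if mem: "(z, P, Q, R) \<in> S'" and t: "0 \<le> t" "t \<le> l" "of_real t \<in> tri P Q R" for z P Q R t
    using trackD(6-8)[OF tr mem] t l unfolding ends_at_corners_def by auto
  have track3: "ends_at_corners l a b t P Q R"
    if mem: "(z, P, Q, R) \<in> S" and t: "0 \<le> t" "t \<le> l" "of_real t \<in> tri P Q R" for z P Q R t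
  proof (cases "(z, P, Q, R) \<in> S1")
    case True
    then show ?thesis using corner t unfolding S1_def by blast
  next
    case False
    then have "(z, P, Q, R) \<in> S2" using mem by (simp add: S_def)
    then obtain I J K L where HQ: "HQ I J K L"
      and o: "(z, P, Q, R) \<in> orbit T x I J K \<or> (z, P, Q, R) \<in> orbit T (F x) I J L"
      using S2_cases by blast
    \<comment> \<open>The new triangles show that an end of the segment is one of the four corners.
      The corner missing in an old triangle is not a point of that triangle, so an end inside it is
      one of its own corners.\<close>
    have J: "fst J \<notin> tri K L I" by (rule not_in_opposite_tri[OF HQ_new(3)[OF HQ]])
    have I: "fst I \<notin> tri K L J"
      by (rule not_in_opposite_tri) (use HQ_new(3)[OF HQ] in \<open>simp add: mult.commute\<close>)
    have L: "fst L \<notin> tri I J K" by (rule not_in_opposite_tri[OF HQ_old(3)[OF HQ]])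
    have K: "fst K \<notin> tri I J L"
      by (rule not_in_opposite_tri) (use HQ_old(3)[OF HQ] in \<open>simp add: mult.commute\<close>)
    have o': "tri P Q R = tri I J K \<and> {P, Q, R} = {I, J, K} \<and> {fst P, fst Q, fst R} = {fst I, fst J, fst K} \<or>
        tri P Q R = tri I J L \<and> {P, Q, R} = {I, J, L} \<and> {fst P, fst Q, fst R} = {fst I, fst J, fst L}"
      using o by (elim disjE) (intro disjI1 conjI orbit_tri, assumption+, intro disjI2 conjI orbit_tri, assumption+)
    then have "of_real t \<in> tri I J K \<or> of_real t \<in> tri I J L" using t(3) by auto
    from reach_old[OF HQ t(1,2) this]
    consider "(x, K, L, I) \<in> S'" "of_real t \<in> tri K L I" | "(F x, K, L, J) \<in> S'" "of_real t \<in> tri K L J"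
      by auto
    then have quad: "(t = 0 \<longrightarrow> (0, a) \<in> {I, J, K, L}) \<and> (t = l \<longrightarrow> (complex_of_real l, b) \<in> {I, J, K, L}) \<and>
      (0 < t \<longrightarrow> t < l \<longrightarrow> of_real t \<notin> {fst I, fst J, fst K, fst L})"
    proof cases
      case 1
      then show ?thesis using corner[OF 1(1) t(1,2) 1(2)] J unfolding ends_at_corners_def by auto
    next
      case 2
      then show ?thesis using corner[OF 2(1) t(1,2) 2(2)] I unfolding ends_at_corners_def by auto
    qed
    from o' show ?thesis
    proof
      assume o': "tri P Q R = tri I J K \<and> {P, Q, R} = {I, J, K} \<and> {fst P, fst Q, fst R} = {fst I, fst J, fst K}"
      have "(0, a) \<noteq> L" if "t = 0" using L o' t(3) that by auto
      moreover have "(complex_of_real l, b) \<noteq> L" if "t = l" using L o' t(3) that by auto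
      ultimately show ?thesis using quad o' unfolding ends_at_corners_def by auto
    next
      assume o': "tri P Q R = tri I J L \<and> {P, Q, R} = {I, J, L} \<and> {fst P, fst Q, fst R} = {fst I, fst J, fst L}"
      have "(0, a) \<noteq> K" if "t = 0" using K o' t(3) that by auto
      moreover have "(complex_of_real l, b) \<noteq> K" if "t = l" using K o' t(3) that by auto
      ultimately show ?thesis using quad o' unfolding ends_at_corners_def by auto
    qed
  qed

  have track4: "\<exists>z P Q R t. (z, P, Q, R) \<in> S \<and> 0 < t \<and> t \<le> l \<and> 0 \<in> tri P Q R \<and> of_real t \<in> tri P Q R"
  proof -
    obtain z P Q R t where mem: "(z, P, Q, R) \<in> S'" and t: "0 < t" "t \<le> l" "0 \<in> tri P Q R" "of_real t \<in> tri P Q R"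
      using tr[unfolded track_def, THEN conjunct2, THEN conjunct2, THEN conjunct2] by (elim exE conjE)
    show ?thesis
    proof (cases "z \<in> hinge_flags")
      case False
      then show ?thesis using mem t unfolding S_def S1_def by blast
    next
      case True
      obtain I J K L where HQ: "HQ I J K L" and o: "(z, P, Q, R) \<in> orbit T' x K L I \<or> (z, P, Q, R) \<in> orbit T' (F x) K L J"
        using HQ_of[OF mem True] by blast
      have "tri P Q R = tri K L I \<or> tri P Q R = tri K L J"
        using o by (elim disjE) (rule disjI1, erule orbit_tri, rule disjI2, erule orbit_tri)
      then have q: "of_real u \<in> tri I J K \<or> of_real u \<in> tri I J L" if "of_real u \<in> tri P Q R" for u
        using quadrilateral_other_diagonal[OF HQ_cr(2)[OF HQ]] that by blast
      have touch0: "touches l A B C" if "0 < u" "u \<le> l" "0 \<in> tri A B C" "of_real u \<in> tri A B C" for A B C u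
      proof -
        have "closed_segment 0 (complex_of_real u) \<subseteq> tri A B C"
          using that convex_tri by (intro closed_segment_subset) auto
        moreover have "of_real (u / 2) \<in> closed_segment 0 (complex_of_real u)"
          unfolding in_segment by (intro exI[of _ "1/2"]) (auto simp: scaleR_conv_of_real)
        ultimately show ?thesis unfolding touches_def using that(1,2) by (intro exI[of _ "u / 2"]) auto
      qed
      have fin: ?thesis if "0 < u" "u \<le> l" "0 \<in> tri I J K \<and> of_real u \<in> tri I J K \<or> 0 \<in> tri I J L \<and> of_real u \<in> tri I J L" for u
        using that(3)
      proof
        assume u: "0 \<in> tri I J K \<and> of_real u \<in> tri I J K"
        then have "(x, I, J, K) \<in> S" using touch0[of u I J K] that(1,2) S2I[OF HQ, of x I J K] by (simp add: S_def orbit_T)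
        then show ?thesis using that(1,2) u by blast
      next
        assume u: "0 \<in> tri I J L \<and> of_real u \<in> tri I J L"
        then have "(F x, I, J, L) \<in> S" using touch0[of u I J L] that(1,2) S2I[OF HQ, of "F x" I J L] by (simp add: S_def orbit_T)
        then show ?thesis using that(1,2) u by blast
      qed
      \<comment> \<open>If the old diagonal cuts the initial piece at \<open>y > 0\<close>, the
        piece up to \<open>y\<close> has both ends in the old triangle that contains
        \<open>0\<close>. If \<open>y = 0\<close>, the start lies in both old triangles, and the one
        that contains \<open>t\<close> is taken.\<close>
      have mixed: ?thesis if m: "m \<in> closed_segment 0 (complex_of_real t)" "m \<in> closed_segment (fst I) (fst J)" for m
      proof -
        obtain y where y: "m = complex_of_real y" "0 \<le> y" "y \<le> t" using real_segment[of m 0 t] m(1) t(1) by auto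
        have yI: "of_real y \<in> tri I J K" "of_real y \<in> tri I J L"
          using m(2) y(1) side_subset_tri by blast+
        show ?thesis
        proof (cases "y = 0")
          case True
          then show ?thesis using fin[OF t(1,2)] yI q[OF t(4)] by auto
        next
          case False
          then show ?thesis using fin[of y] yI q[of 0] t y by auto
        qed
      qed
      have "0 \<in> tri I J K \<or> 0 \<in> tri I J L" using q[of 0] t(3) by simp
      then consider "0 \<in> tri I J K \<and> of_real t \<in> tri I J K \<or> 0 \<in> tri I J L \<and> of_real t \<in> tri I J L"
        | "0 \<in> tri I J K" "of_real t \<in> tri I J L" | "0 \<in> tri I J L" "of_real t \<in> tri I J K"
        using q[OF t(4)] by blast
      then show ?thesis
      proof cases
        case 1
        then show ?thesis using fin t by blast
      next
        case 2
        then show ?thesis using segment_meets_diagonal[OF HQ_cr(1)[OF HQ] 2] mixed by blast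
      next
        case 3
        then show ?thesis using segment_meets_diagonal[OF HQ_cr(1)[OF HQ] 3(2,1)] mixed
          closed_segment_commute[of 0 "complex_of_real t"] by blast
      qed
    qed
  qed

  have "track T d l a b S"
    by (rule trackI[OF track1 track2 track3 track4])
  then show ?thesis by (rule that)
qed

end

section \<open>Segments cross a bounded number of triangles\<close>

context duality begin

text \<open>The edge is laid on the real axis. Boundary points count in \<open>touches\<close>, so
  it touches the triangles on both of its sides; their third corners are off the axis, whence no
  other side contains an inner point of the segment.\<close>

lemma track_edge: obtains S where "track T d (len x) 0 (- om x) S"
proof -
  define l where "l = len x"
  have l: "0 < l" by (simp add: l_def)
  define I J where "I = (0::complex, 0::real)" and "J = (complex_of_real l, - om x)"
  define K L where "K = third 1 x I J" and "L = third (-1) (F x) I J"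
  have IJ: "dist (fst I) (fst J) = len x" "snd I - snd J = om x"
    using l by (simp_all add: I_def J_def l_def abs_of_pos)
  have K: "placed T d x I J K" and L: "placed T d (F x) I J L"
    unfolding K_def L_def using IJ by (auto intro!: placed_third)
  have im: "Im (fst K) = vv x" "Im (fst L) = - vv (F x)"
    using l by (simp_all add: K_def L_def third_def I_def J_def l_def)
  have aK: "area I J K = vv x * l" and aL: "area I J L = - (vv (F x) * l)"
    unfolding K_def L_def using area_third[of I J x 1] area_third[of I J "F x" "-1"] IJ by (simp_all add: l_def)
  have opp: "area I J K * area I J L < 0" unfolding aK aL using l by simp
  define S where "S = orbit T x I J K \<union> orbit T (F x) I J L"
  have imne: "Im (fst K) \<noteq> 0" "Im (fst L) \<noteq> 0" using im vv_pos[of x] vv_pos[of "F x"] by auto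
  have no_seg: False if "of_real t \<in> closed_segment (fst P) (fst R)" "0 < t" "t < l" "P = I \<or> P = J" "R = K \<or> R = L" for t P R
  proof -
    from that(1) obtain u where "0 \<le> u" "u \<le> 1" and u: "complex_of_real t = (1 - u) *\<^sub>R fst P + u *\<^sub>R fst R"
      unfolding in_segment by (elim exE conjE)
    have "Im (fst P) = 0" using that(4) by (auto simp: I_def J_def)
    then have "u * Im (fst R) = 0" using arg_cong[OF u, of Im] by simp
    then have "u = 0" using imne that(5) by auto
    then have "complex_of_real t = fst P" using u by simp
    then show False using that(2,3,4) by (auto simp: I_def J_def)
  qed
  have SI: "(x, I, J, K) \<in> S" "(F x, I, J, L) \<in> S" "(V x, J, I, K) \<in> S" "(V (F x), J, I, L) \<in> S"
    by (simp_all add: S_def orbit_def Let_def)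
  have half: "of_real (l / 2) \<in> tri I J K" "of_real (l / 2) \<in> tri I J L"
  proof -
    have "of_real (l / 2) \<in> closed_segment (fst I) (fst J)"
      unfolding in_segment using l by (intro exI[of _ "1/2"]) (auto simp: I_def J_def scaleR_conv_of_real)
    then show "of_real (l / 2) \<in> tri I J K" "of_real (l / 2) \<in> tri I J L"
      using side_subset_tri by blast+
  qed
  have "track T d l 0 (- om x) S"
  proof (rule trackI)
    fix z P Q R assume mem: "(z, P, Q, R) \<in> S"
    have "placed T d z P Q R" using mem orbit_placed[OF K] orbit_placed[OF L] unfolding S_def by blast
    moreover have "(V z, Q, P, R) \<in> S" "(E z, P, R, Q) \<in> S"
      using mem orbit_closed[of z P Q R x I J K] orbit_closed[of z P Q R "F x" I J L] unfolding S_def by blast+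
    moreover have "tri P Q R = tri I J K \<or> tri P Q R = tri I J L"
      using mem orbit_tri(1)[of z P Q R T x I J K] orbit_tri(1)[of z P Q R T "F x" I J L] unfolding S_def by blast
    then have "of_real (l / 2) \<in> tri P Q R" using half by auto
    then have "touches l P Q R" unfolding touches_def using l by (intro exI[of _ "l / 2"]) auto
    ultimately show "placed T d z P Q R \<and> (V z, Q, P, R) \<in> S \<and> (E z, P, R, Q) \<in> S \<and> touches l P Q R" by blast
  next
    fix z P Q R R' t
    assume mem: "(z, P, Q, R) \<in> S" and t: "0 < t" "t < l" and seg: "of_real t \<in> closed_segment (fst P) (fst Q)"
      and p: "placed T d (F z) P Q R'" and o: "area P Q R * area P Q R' < 0"
    have uniq: "R' = R''" if "placed T d (F z) P Q R''" "area P Q R * area P Q R'' < 0" for R''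
      using placed_unique[OF p that(1)] o that(2) by (auto simp: zero_less_mult_iff mult_less_0_iff)
    have "(P, Q) \<notin> {I, J} \<times> {K, L} \<union> {K, L} \<times> {I, J}"
      using no_seg[OF seg t] no_seg[of t Q P] seg t by (auto simp: closed_segment_commute)
    then have "(z, P, Q, R) = (x, I, J, K) \<or> (z, P, Q, R) = (V x, J, I, K) \<or> (z, P, Q, R) = (F x, I, J, L) \<or> (z, P, Q, R) = (V (F x), J, I, L)"
      using mem unfolding S_def orbit_def Let_def by auto
    then show "(F z, P, Q, R') \<in> S"
    proof (elim disjE)
      assume "(z, P, Q, R) = (x, I, J, K)"
      then have [simp]: "z = x" "P = I" "Q = J" "R = K" by simp_all
      show ?thesis using uniq[of L] L opp SI by simp
    next
      assume "(z, P, Q, R) = (V x, J, I, K)"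
      then have [simp]: "z = V x" "P = J" "Q = I" "R = K" by simp_all
      show ?thesis using uniq[of L] placed_V[OF L] opp SI by (simp add: area_swap(1)[of I J])
    next
      assume "(z, P, Q, R) = (F x, I, J, L)"
      then have [simp]: "z = F x" "P = I" "Q = J" "R = L" by simp_all
      show ?thesis using uniq[of K] K opp SI by (simp add: mult.commute)
    next
      assume "(z, P, Q, R) = (V (F x), J, I, L)"
      then have [simp]: "z = V (F x)" "P = J" "Q = I" "R = L" by simp_all
      show ?thesis using uniq[of K] placed_V[OF K] opp SI by (simp add: area_swap(1)[of I J] mult.commute)
    qed
  next
    fix z P Q R and t :: real
    assume mem: "(z, P, Q, R) \<in> S"
    have "{P, Q, R} = {I, J, K} \<and> {fst P, fst Q, fst R} = {fst I, fst J, fst K} \<or>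
        {P, Q, R} = {I, J, L} \<and> {fst P, fst Q, fst R} = {fst I, fst J, fst L}"
      using mem unfolding S_def
      by (elim UnE) (intro disjI1 conjI orbit_tri, assumption+, intro disjI2 conjI orbit_tri, assumption+)
    moreover have "of_real t \<noteq> fst K" "of_real t \<noteq> fst L"
      using imne by (metis Im_complex_of_real)+
    moreover have "of_real t \<noteq> fst I" if "0 < t" using that by (simp add: I_def)
    moreover have "of_real t \<noteq> fst J" if "t < l" using that by (simp add: J_def)
    moreover have "(0, 0) = I" "(complex_of_real l, - om x) = J" by (simp_all add: I_def J_def)
    ultimately show "ends_at_corners l 0 (- om x) t P Q R"
      unfolding ends_at_corners_def by auto
  next
    have "0 \<in> tri I J K" "of_real l \<in> tri I J K"
      using corner_in_tri[of I J K] corner_in_tri(2)[where P = I and Q = J and R = K] by (simp_all add: I_def J_def)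
    then show "\<exists>z P Q R t. (z, P, Q, R) \<in> S \<and> 0 < t \<and> t \<le> l \<and> 0 \<in> tri P Q R \<and> of_real t \<in> tri P Q R"
      using SI(1) l by blast
  qed
  then show ?thesis using that by (simp add: l_def)
qed

end

text \<open>The point where the line through \<open>p\<close> and \<open>q\<close> meets the real axis, and the cotangent of its angle there.\<close>

definition hit :: "complex \<Rightarrow> complex \<Rightarrow> real" where
  "hit p q = (Im p * Re q - Im q * Re p) / (Im p - Im q)"

definition slant :: "complex \<Rightarrow> complex \<Rightarrow> real" where
  "slant p q = (Re q - Re p) / (Im p - Im q)"

lemma hit_in_segment:
  assumes "0 < Im p" "Im q < 0"
  shows "of_real (hit p q) \<in> closed_segment p q"
  unfolding in_segment
proof (intro exI conjI)
  define u where "u = Im p / (Im p - Im q)"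
  have u: "1 - u = - Im q / (Im p - Im q)" using assms by (simp add: u_def field_simps)
  show "complex_of_real (hit p q) = (1 - u) *\<^sub>R p + u *\<^sub>R q"
    unfolding u unfolding u_def hit_def
    by (simp add: complex_eq_iff add_divide_distrib diff_divide_distrib mult.commute)
  show "0 \<le> u" "u \<le> 1" using assms by (auto simp: u_def divide_le_eq)
qed

text \<open>With \<open>p\<close> above and \<open>q\<close> below the axis, a line along the axis
  that enters the triangle through \<open>pq\<close> leaves it through \<open>pr\<close> or
  \<open>rq\<close>, according to the side of \<open>r\<close>. The cross product is twice the
  signed area.\<close>

lemma hit_advance:
  assumes "0 < Im p" "Im q < 0"
  shows "Im r < 0 \<Longrightarrow> hit p r - hit p q = Im p * cross (q - p) (r - p) / ((Im p - Im q) * (Im p - Im r))"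
    and "0 < Im r \<Longrightarrow> hit r q - hit p q = - Im q * cross (q - p) (r - p) / ((Im p - Im q) * (Im r - Im q))"
proof -
  have "Im p - Im q \<noteq> 0" using assms by auto
  then show "hit p r - hit p q = Im p * cross (q - p) (r - p) / ((Im p - Im q) * (Im p - Im r))" if "Im r < 0"
  proof -
    have "Im p - Im r \<noteq> 0" using assms that by auto
    from diff_frac_eq[OF this \<open>Im p - Im q \<noteq> 0\<close>] show ?thesis
      unfolding hit_def by (simp only:) (rule arg_cong2[where f = "(/)"], simp_all add: cross_def algebra_simps)
  qed
  show "hit r q - hit p q = - Im q * cross (q - p) (r - p) / ((Im p - Im q) * (Im r - Im q))" if "0 < Im r"
  proof -
    have "Im r - Im q \<noteq> 0" using assms that by auto
    from diff_frac_eq[OF this \<open>Im p - Im q \<noteq> 0\<close>] show ?thesis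
      unfolding hit_def by (simp only:) (rule arg_cong2[where f = "(/)"], simp_all add: cross_def algebra_simps)
  qed
qed

lemma slant_advance:
  assumes "0 < Im p" "Im q < 0"
  shows "Im r < 0 \<Longrightarrow> slant p r - slant p q = cross (q - p) (r - p) / ((Im p - Im q) * (Im p - Im r))"
    and "0 < Im r \<Longrightarrow> slant p q - slant r q = cross (q - p) (r - p) / ((Im p - Im q) * (Im r - Im q))"
proof -
  have "Im p - Im q \<noteq> 0" using assms by auto
  then show "slant p r - slant p q = cross (q - p) (r - p) / ((Im p - Im q) * (Im p - Im r))" if "Im r < 0"
  proof -
    have "Im p - Im r \<noteq> 0" using assms that by auto
    from diff_frac_eq[OF this \<open>Im p - Im q \<noteq> 0\<close>] show ?thesis
      unfolding slant_def by (simp only:) (rule arg_cong2[where f = "(/)"], simp_all add: cross_def algebra_simps)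
  qed
  show "slant p q - slant r q = cross (q - p) (r - p) / ((Im p - Im q) * (Im r - Im q))" if "0 < Im r"
  proof -
    have "Im r - Im q \<noteq> 0" using assms that by auto
    from diff_frac_eq[OF \<open>Im p - Im q \<noteq> 0\<close> this] show ?thesis
      unfolding slant_def by (simp only:) (rule arg_cong2[where f = "(/)"], simp_all add: cross_def algebra_simps)
  qed
qed

text \<open>The left-hand side is the sine of the right-hand side.\<close>

lemma arctan_diff_ge:
  fixes x y :: real
  assumes "x \<le> y"
  shows "(y - x) / (sqrt (1 + x\<^sup>2) * sqrt (1 + y\<^sup>2)) \<le> arctan y - arctan x"
proof -
  have "sin (arctan y - arctan x) = (y - x) / (sqrt (1 + x\<^sup>2) * sqrt (1 + y\<^sup>2))"
    by (simp add: sin_diff sin_arctan cos_arctan diff_divide_distrib mult.commute)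
  moreover have "sin (arctan y - arctan x) \<le> arctan y - arctan x"
    using assms by (intro sin_x_le_x) (simp add: arctan_le_iff)
  ultimately show ?thesis by simp
qed

lemma sqrt_slant:
  assumes "Im q < Im p"
  shows "sqrt (1 + (slant p q)\<^sup>2) = norm (q - p) / (Im p - Im q)"
proof -
  have "1 + (slant p q)\<^sup>2 = ((Re q - Re p)\<^sup>2 + (Im q - Im p)\<^sup>2) / (Im p - Im q)\<^sup>2"
    using assms by (simp add: slant_def power_divide add_divide_distrib power2_commute[of "Im q"])
  then show ?thesis
    using assms by (simp add: real_sqrt_divide cmod_def)
qed

text \<open>The cross product divided by the lengths of both crossed sides is the sine of the angle
  by which the side turns about the common corner; \<open>arctan_diff_ge\<close> passes from the
  sine to the angle.\<close>

lemma angle_advance: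
  assumes "0 < Im p" "Im q < 0" and X: "\<kappa> \<le> cross (q - p) (r - p)" "0 < \<kappa>"
    and le: "norm (q - p) \<le> m" "norm (r - p) \<le> m" "norm (r - q) \<le> m"
  shows "Im r < 0 \<Longrightarrow> \<kappa> / m\<^sup>2 \<le> arctan (slant p r) - arctan (slant p q)"
    and "0 < Im r \<Longrightarrow> \<kappa> / m\<^sup>2 \<le> arctan (slant p q) - arctan (slant r q)"
proof -
  have pq: "0 < Im p - Im q" using assms by simp
  have cancel: "X / (a * b) / ((c / a) * (e / b)) = X / (c * e)" if "a \<noteq> 0" "b \<noteq> 0" for a b c e X :: real
    using that by simp
  have frac: "\<kappa> / m\<^sup>2 \<le> X / (a * b)" if "\<kappa> \<le> X" "0 < a" "0 < b" "a \<le> m" "b \<le> m" for X a b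
  proof -
    have "a * b \<le> m\<^sup>2" using that by (simp add: power2_eq_square mult_mono)
    then show ?thesis using that X(2) by (intro frac_le) auto
  qed
  show "\<kappa> / m\<^sup>2 \<le> arctan (slant p r) - arctan (slant p q)" if r: "Im r < 0"
  proof -
    have pr: "0 < Im p - Im r" using assms r by simp
    have n: "0 < norm (q - p)" "0 < norm (r - p)" using pq pr by auto
    have "slant p q \<le> slant p r"
      using slant_advance(1)[OF assms(1,2) r] X pq pr
      by (smt (verit) divide_nonneg_pos mult_pos_pos)
    have "(slant p r - slant p q) / (sqrt (1 + (slant p q)\<^sup>2) * sqrt (1 + (slant p r)\<^sup>2)) =
        cross (q - p) (r - p) / (norm (q - p) * norm (r - p))"
      unfolding slant_advance(1)[OF assms(1,2) r] using pq pr cancel by (simp add: sqrt_slant)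
    then show ?thesis
      using arctan_diff_ge[OF \<open>slant p q \<le> slant p r\<close>] frac[OF X(1) n le(1,2)] by simp
  qed
  show "\<kappa> / m\<^sup>2 \<le> arctan (slant p q) - arctan (slant r q)" if r: "0 < Im r"
  proof -
    have rq: "0 < Im r - Im q" using assms r by simp
    have n: "0 < norm (q - p)" "0 < norm (r - q)" using pq rq by auto
    have "slant r q \<le> slant p q"
      using slant_advance(2)[OF assms(1,2) r] X pq rq
      by (smt (verit) divide_nonneg_pos mult_pos_pos)
    have "(slant p q - slant r q) / (sqrt (1 + (slant r q)\<^sup>2) * sqrt (1 + (slant p q)\<^sup>2)) =
        cross (q - p) (r - p) / (norm (q - p) * norm (r - q))"
      unfolding slant_advance(2)[OF assms(1,2) r] mult.commute[of "sqrt (1 + (slant r q)\<^sup>2)"]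
      using pq rq cancel[of "Im p - Im q" "Im r - Im q"] by (simp add: sqrt_slant norm_minus_commute[of r q])
    then show ?thesis
      using arctan_diff_ge[OF \<open>slant r q \<le> slant p q\<close>] frac[OF X(1) n le(1,3)] by simp
  qed
qed

text \<open>
  A line that crosses triangles runs around one vertex for some time and then around another one on
  its other side.  A change of the vertex advances the line by a fixed length, and otherwise the angle
  of the crossed side grows by a fixed amount; the coefficient \<open>N\<close> is chosen such that the advance
  outweighs the range of the angle.
\<close>

definition potential :: "real \<Rightarrow> complex \<Rightarrow> complex \<Rightarrow> complex \<Rightarrow> real" where
  "potential N p q r = (if Im r < 0 then N * (hit p q + hit p r) + arctan (slant p q)
     else N * (hit p q + hit r q) - arctan (slant p q))"

text \<open>The triangle lies ahead of the crossed side \<open>pq\<close> for a motion to the right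
  along the axis; \<kappa> bounds twice its area from below and \<open>m\<close> its sides from
  above.\<close>

definition wedge :: "real \<Rightarrow> real \<Rightarrow> complex \<Rightarrow> complex \<Rightarrow> complex \<Rightarrow> bool" where
  "wedge \<kappa> m p q r \<longleftrightarrow> 0 < Im p \<and> Im q < 0 \<and> \<kappa> \<le> cross (q - p) (r - p) \<and> 0 < \<kappa> \<and>
     norm (q - p) \<le> m \<and> norm (r - p) \<le> m \<and> norm (r - q) \<le> m"

text \<open>The advance is measured relative to the height of the new or of the old crossed side.
  Two consecutive steps share a side, and the fractions of this side above and below the axis add up
  to \<open>1\<close>.\<close>

lemma wedge_hit:
  assumes w: "wedge \<kappa> m p q r"
  shows "Im r < 0 \<Longrightarrow> hit p q + Im p / (Im p - Im r) * (\<kappa> / m) \<le> hit p r"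
    and "Im r < 0 \<Longrightarrow> hit p q + Im p / (Im p - Im q) * (\<kappa> / m) \<le> hit p r"
    and "0 < Im r \<Longrightarrow> hit p q + - Im q / (Im r - Im q) * (\<kappa> / m) \<le> hit r q"
    and "0 < Im r \<Longrightarrow> hit p q + - Im q / (Im p - Im q) * (\<kappa> / m) \<le> hit r q"
proof -
  have w: "0 < Im p" "Im q < 0" "\<kappa> \<le> cross (q - p) (r - p)" "0 < \<kappa>" "norm (q - p) \<le> m" "norm (r - p) \<le> m" "norm (r - q) \<le> m"
    using w by (auto simp: wedge_def)
  define X where "X = cross (q - p) (r - p)"
  have bound: "c / b * (\<kappa> / m) \<le> c * X / (a * b)" "c / b * (\<kappa> / m) \<le> c * X / (b * a)"
    if "0 \<le> c" "0 < a" "a \<le> m" "0 < b" for a b c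
  proof -
    have "\<kappa> / m \<le> X / a" using w that by (intro frac_le) (auto simp: X_def)
    then have "c / b * (\<kappa> / m) \<le> c / b * (X / a)" using that by (intro mult_left_mono) auto
    then show "c / b * (\<kappa> / m) \<le> c * X / (a * b)" "c / b * (\<kappa> / m) \<le> c * X / (b * a)" by (simp_all add: mult.commute)
  qed
  have le: "Im p - Im q \<le> m" "Im p - Im r \<le> m" "Im r - Im q \<le> m"
    using w abs_Im_le_cmod[of "q - p"] abs_Im_le_cmod[of "r - p"] abs_Im_le_cmod[of "r - q"] by auto
  show "hit p q + Im p / (Im p - Im r) * (\<kappa> / m) \<le> hit p r" if "Im r < 0"
    using hit_advance(1)[OF w(1,2) that, folded X_def] bound(1)[of "Im p" "Im p - Im q" "Im p - Im r"] le w(1,2) that by linarith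
  show "hit p q + Im p / (Im p - Im q) * (\<kappa> / m) \<le> hit p r" if "Im r < 0"
    using hit_advance(1)[OF w(1,2) that, folded X_def] bound(2)[of "Im p" "Im p - Im r" "Im p - Im q"] le w(1,2) that by linarith
  show "hit p q + - Im q / (Im r - Im q) * (\<kappa> / m) \<le> hit r q" if "0 < Im r"
    using hit_advance(2)[OF w(1,2) that, folded X_def] bound(1)[of "- Im q" "Im p - Im q" "Im r - Im q"] le w(1,2) that by linarith
  show "hit p q + - Im q / (Im p - Im q) * (\<kappa> / m) \<le> hit r q" if "0 < Im r"
    using hit_advance(2)[OF w(1,2) that, folded X_def] bound(2)[of "- Im q" "Im r - Im q" "Im p - Im q"] le w(1,2) that by linarith
qed

lemma wedge_hit_less:
  assumes "wedge \<kappa> m p q r"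
  shows "Im r < 0 \<Longrightarrow> hit p q < hit p r" and "0 < Im r \<Longrightarrow> hit p q < hit r q"
proof -
  have w: "0 < Im p" "Im q < 0" "0 < \<kappa>" "norm (q - p) \<le> m"
    using assms by (auto simp: wedge_def)
  then have m: "0 < m" using abs_Im_le_cmod[of "q - p"] by auto
  show "hit p q < hit p r" if "Im r < 0"
  proof -
    have "0 < Im p / (Im p - Im r) * (\<kappa> / m)" using w m that by simp
    then show ?thesis using wedge_hit(1)[OF assms that] by linarith
  qed
  show "hit p q < hit r q" if "0 < Im r"
  proof -
    have "0 < - Im q / (Im r - Im q) * (\<kappa> / m)" using w m that by (intro mult_pos_pos divide_pos_pos) auto
    then show ?thesis using wedge_hit(3)[OF assms that] by linarith
  qed
qed

text \<open>The potential adds the hits of two consecutive sides because a single step may advance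
  arbitrarily little. Two steps with a change of the pivot between them advance by at least
  \<open>\<kappa> / m\<close>, which \<open>N\<close> turns into the range \<pi> of the angle plus
  the claimed gain; with the same pivot the angle supplies the gain.\<close>

lemma potential_increases:
  assumes w: "wedge \<kappa> m p q r" and N: "0 \<le> N" "pi + \<kappa> / m\<^sup>2 \<le> N * (\<kappa> / m)"
  shows "\<lbrakk>Im r < 0; wedge \<kappa> m p r s; Im s \<noteq> 0\<rbrakk> \<Longrightarrow> potential N p q r + \<kappa> / m\<^sup>2 \<le> potential N p r s"
    and "\<lbrakk>0 < Im r; wedge \<kappa> m r q s; Im s \<noteq> 0\<rbrakk> \<Longrightarrow> potential N p q r + \<kappa> / m\<^sup>2 \<le> potential N r q s"
proof -
  have w': "0 < Im p" "Im q < 0" "\<kappa> \<le> cross (q - p) (r - p)" "0 < \<kappa>" "norm (q - p) \<le> m" "norm (r - p) \<le> m" "norm (r - q) \<le> m"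
    using w by (auto simp: wedge_def)
  have two_steps: "N * hit p q + (pi + \<kappa> / m\<^sup>2) \<le> N * h" if "hit p q + \<kappa> / m \<le> h" for h
    using mult_left_mono[OF that N(1)] N(2) by (simp add: distrib_left)
  note bounds = arctan_bounded[of "slant p q"] arctan_bounded[of "slant p r"] arctan_bounded[of "slant r q"]
  show "potential N p q r + \<kappa> / m\<^sup>2 \<le> potential N p r s" if r: "Im r < 0" and ws: "wedge \<kappa> m p r s" and s: "Im s \<noteq> 0"
  proof (cases "Im s < 0")
    case True
    have "hit p q \<le> hit p s" using wedge_hit_less(1)[OF w r] wedge_hit_less(1)[OF ws True] by simp
    then have "N * hit p q \<le> N * hit p s" using N by (simp add: mult_left_mono)
    then show ?thesis
      using angle_advance(1)[OF w'(1-4) w'(5-7) r] True r by (simp add: potential_def distrib_left)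
  next
    case False
    then have s: "0 < Im s" using s by simp
    have "(Im p / (Im p - Im r) + - Im r / (Im p - Im r)) * (\<kappa> / m) = \<kappa> / m"
      using w' r by (simp add: add_divide_distrib[symmetric] diff_divide_distrib[symmetric])
    then have "hit p q + \<kappa> / m \<le> hit s r"
      using wedge_hit(1)[OF w r] wedge_hit(4)[OF ws s] unfolding distrib_right by linarith
    then show ?thesis
      using two_steps[of "hit s r"] bounds False r unfolding potential_def distrib_left by simp
  qed
  show "potential N p q r + \<kappa> / m\<^sup>2 \<le> potential N r q s" if r: "0 < Im r" and ws: "wedge \<kappa> m r q s" and s: "Im s \<noteq> 0"
  proof (cases "Im s < 0")
    case False
    then have s: "0 < Im s" using s by simp
    have "hit p q \<le> hit s q" using wedge_hit_less(2)[OF w r] wedge_hit_less(2)[OF ws s] by simp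
    then have "N * hit p q \<le> N * hit s q" using N by (simp add: mult_left_mono)
    then show ?thesis
      using angle_advance(2)[OF w'(1-4) w'(5-7) r] False r by (simp add: potential_def distrib_left)
  next
    case True
    have "(Im r / (Im r - Im q) + - Im q / (Im r - Im q)) * (\<kappa> / m) = \<kappa> / m"
      using w' r by (simp add: add_divide_distrib[symmetric] diff_divide_distrib[symmetric])
    then have "hit p q + \<kappa> / m \<le> hit r s"
      using wedge_hit(3)[OF w r] wedge_hit(2)[OF ws True] unfolding distrib_right by linarith
    then show ?thesis
      using two_steps[of "hit r s"] bounds True r unfolding potential_def distrib_left by simp
  qed
qed

section \<open>Enumeration of the geodesics that start in a corner\<close>

definition motion :: "complex \<Rightarrow> real \<Rightarrow> lifted \<Rightarrow> lifted" where
  "motion m a P = (m * fst P, a + snd P)"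

context duality begin

text \<open>The direction of the first side and the weight of the start vary from track to track. To
  get finite sets, \<open>walk\<close> uses one normal position for each flag, and a
  \<open>motion\<close> carries it to the track.\<close>

lemma third_motion: "third \<sigma> z (motion m a P) (motion m a Q) = motion m a (third \<sigma> z P Q)"
  by (simp add: third_def motion_def algebra_simps)

definition second_corner :: "'f \<Rightarrow> lifted" where
  "second_corner z = (complex_of_real (len z), - om z)"

text \<open>The sides crossed by geodesics that start in a corner of a triangle, in a normal position, together
  with the flag of the triangle behind the side; a geodesic that crosses a side leaves through one of the
  other two sides.\<close>

fun walk :: "nat \<Rightarrow> ('f \<times> lifted \<times> lifted) set" where
  "walk 0 = (\<lambda>z. (F (E (V z)), second_corner z, third (-1) z (0, 0) (second_corner z))) ` UNIV"
| "walk (Suc n) = (\<lambda>(y, A, B). (F (E y), A, third 1 y A B)) ` walk n \<union>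
     (\<lambda>(y, A, B). (F (V (E (V y))), third 1 y A B, B)) ` walk n"

text \<open>Candidates for the length and the weight difference of a geodesic: those of an edge, or
  of the vector from the starting corner \<open>(0, 0)\<close> to the corner behind a crossed
  side.\<close>

definition targets :: "nat \<Rightarrow> (real \<times> real) set" where
  "targets n = range (\<lambda>z. (len z, om z)) \<union>
     (\<Union>k\<le>n. (\<lambda>(y, A, B). (norm (fst (third 1 y A B)), - snd (third 1 y A B))) ` walk k)"

lemma finite_targets: "finite (targets n)"
proof -
  have "finite (walk k)" for k by (induction k) auto
  then show ?thesis by (auto simp: targets_def)
qed

lemma targets_mono: "n \<le> k \<Longrightarrow> targets n \<subseteq> targets k"
  unfolding targets_def by (intro Un_mono UN_mono) auto

text \<open>With \<open>max_len\<close>, the constants \<kappa> and \<open>m\<close> of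
  \<open>wedge\<close>; \<open>vv z * len z\<close> is twice the area of the triangle.\<close>

definition "min_area = Min (range (\<lambda>z. vv z * len z))"
definition "max_len = Max (range len)"

lemma min_area: "0 < min_area" "min_area \<le> vv z * len z"
  by (simp_all add: min_area_def Min_gr_iff)

lemma max_len: "len z \<le> max_len"
  by (simp add: max_len_def)

lemma wedge_placed:
  assumes "placed T d y A B C" "0 < Im (fst A)" "Im (fst B) < 0" "0 < area A B C"
  shows "wedge min_area max_len (fst A) (fst B) (fst C)"
  using assms abs_area_placed[OF assms(1)] min_area max_len
  by (auto simp: wedge_def placed_iff area_def dist_norm norm_minus_commute)

lemma real_tri_between:
  assumes "of_real r \<in> tri A B C" "of_real s \<in> tri A B C" "r \<le> t" "t \<le> s"
  shows "of_real t \<in> tri A B C"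
proof -
  have "t \<in> closed_segment r s" using assms(3,4) by (simp add: closed_segment_eq_real_ivl)
  then obtain u where u: "0 \<le> u" "u \<le> 1" "t = (1 - u) * r + u * s" unfolding in_segment by auto
  then have "of_real t \<in> closed_segment (complex_of_real r) (complex_of_real s)"
    unfolding in_segment by (intro exI[of _ u]) (simp add: scaleR_conv_of_real)
  then show ?thesis
    using closed_segment_subset[OF assms(1,2) convex_tri] by blast
qed

text \<open>If the corner ahead is on the axis, it is the end, as no inner point of the segment is a
  corner. If it is off the axis, no corner is an end point, so the segment cannot stop inside the
  triangle and crosses the next side before \<open>l\<close>.\<close>

lemma track_step:
  assumes tr: "track T d l a b S" and l: "0 < l" and mem: "(y, A, B, C) \<in> S"
    and up: "0 < Im (fst A)" and down: "Im (fst B) < 0" and pos: "0 < area A B C"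
    and hit: "0 < hit (fst A) (fst B)" "hit (fst A) (fst B) < l"
  shows "Im (fst C) = 0 \<Longrightarrow> C = (complex_of_real l, b)"
    and "Im (fst C) < 0 \<Longrightarrow> hit (fst A) (fst C) < l \<and> (\<exists>D. (F (E y), A, C, D) \<in> S \<and> 0 < area A C D)"
    and "0 < Im (fst C) \<Longrightarrow> hit (fst C) (fst B) < l \<and> (\<exists>D. (F (V (E (V y))), C, B, D) \<in> S \<and> 0 < area C B D)"
proof -
  note p = trackD(1)[OF tr mem]
  note w = wedge_placed[OF p up down pos]
  have c: "complex_of_real (hit (fst A) (fst B)) \<in> tri A B C"
    using hit_in_segment[OF up down] side_subset_tri by blast
  have end_point: "(complex_of_real l, b) \<in> {A, B, C}" if "of_real s \<in> tri A B C" "l \<le> s" for s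
    using trackD(7)[OF tr mem] real_tri_between[OF c that(1)] hit that(2) l by auto
  have not_AB: "(complex_of_real l, b) \<noteq> A" "(complex_of_real l, b) \<noteq> B" using up down by auto
  show "C = (complex_of_real l, b)" if C: "Im (fst C) = 0"
  proof -
    have C_real: "fst C = complex_of_real (Re (fst C))" using C by (simp add: complex_eq_iff)
    have "0 < Im (fst A) - Im (fst B)" using up down by simp
    moreover have "area A B C = (Re (fst C) - hit (fst A) (fst B)) * (Im (fst A) - Im (fst B))"
    proof -
      have "hit (fst A) (fst B) * (Im (fst A) - Im (fst B)) = Im (fst A) * Re (fst B) - Im (fst B) * Re (fst A)"
        using calculation by (simp add: hit_def)
      then show ?thesis using C unfolding left_diff_distrib by (simp add: area_def cross_def algebra_simps)
    qed
    ultimately have "hit (fst A) (fst B) < Re (fst C)" using pos by (simp add: zero_less_mult_iff)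
    moreover have "complex_of_real (Re (fst C)) \<in> tri A B C"
      using corner_in_tri(3) C_real by metis
    ultimately have "l \<le> Re (fst C)"
      using trackD(8)[OF tr mem, of "Re (fst C)"] hit C_real by force
    then show ?thesis using end_point[OF \<open>complex_of_real (Re (fst C)) \<in> tri A B C\<close>] not_AB by auto
  qed
  show "hit (fst A) (fst C) < l \<and> (\<exists>D. (F (E y), A, C, D) \<in> S \<and> 0 < area A C D)" if C: "Im (fst C) < 0"
  proof -
    have c': "complex_of_real (hit (fst A) (fst C)) \<in> closed_segment (fst A) (fst C)"
      using up C by (rule hit_in_segment)
    then have c'_tri: "complex_of_real (hit (fst A) (fst C)) \<in> tri A B C"
      using side_subset_tri[of A C B] tri_perm(2)[of A B C] by blast
    have "(complex_of_real l, b) \<noteq> C" using C by auto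
    then have less: "hit (fst A) (fst C) < l" using end_point[OF c'_tri] not_AB by force
    have mem': "(E y, A, C, B) \<in> S" by (rule trackD(3)[OF tr mem])
    obtain D where D: "placed T d (F (E y)) A C D" "area A C B * area A C D < 0"
      by (rule placed_opposite_exists[OF trackD(1)[OF tr mem']])
    have "0 < hit (fst A) (fst C)" using wedge_hit_less(1)[OF w C] hit by simp
    then have "(F (E y), A, C, D) \<in> S" using trackD(5)[OF tr mem' _ less c' D] by simp
    moreover have "0 < area A C D" using D(2) pos area_swap(2)[of A C B] by (auto simp: mult_less_0_iff zero_less_mult_iff)
    ultimately show ?thesis using less by blast
  qed
  show "hit (fst C) (fst B) < l \<and> (\<exists>D. (F (V (E (V y))), C, B, D) \<in> S \<and> 0 < area C B D)" if C: "0 < Im (fst C)"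
  proof -
    have c': "complex_of_real (hit (fst C) (fst B)) \<in> closed_segment (fst C) (fst B)"
      using C down by (rule hit_in_segment)
    then have c'_tri: "complex_of_real (hit (fst C) (fst B)) \<in> tri A B C"
      using side_subset_tri[of C B A] tri_perm(3)[of A B C] by blast
    have "(complex_of_real l, b) \<noteq> C" using C by auto
    then have less: "hit (fst C) (fst B) < l" using end_point[OF c'_tri] not_AB by force
    have mem': "(V (E (V y)), C, B, A) \<in> S"
      using trackD(2)[OF tr trackD(3)[OF tr trackD(2)[OF tr mem]]] .
    obtain D where D: "placed T d (F (V (E (V y)))) C B D" "area C B A * area C B D < 0"
      by (rule placed_opposite_exists[OF trackD(1)[OF tr mem']])
    have "0 < hit (fst C) (fst B)" using wedge_hit_less(2)[OF w C] hit by simp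
    then have "(F (V (E (V y))), C, B, D) \<in> S" using trackD(5)[OF tr mem' _ less c' D] by simp
    moreover have "0 < area C B D" using D(2) pos area_swap(3)[of C B A] by (auto simp: mult_less_0_iff zero_less_mult_iff)
    ultimately show ?thesis using less by blast
  qed
qed

text \<open>\<open>AB\<close> is the side just crossed and \<open>C\<close> the corner ahead. Only
  \<open>AB\<close> is required to come from \<open>walk n\<close>, since \<open>walk_third\<close>
  recovers \<open>C\<close> from it.\<close>

definition walk_state where
  "walk_state S m a l n y A B C \<longleftrightarrow> (y, A, B, C) \<in> S \<and> 0 < Im (fst A) \<and> Im (fst B) < 0 \<and> 0 < area A B C \<and>
     0 < hit (fst A) (fst B) \<and> hit (fst A) (fst B) < l \<and>
     (\<exists>A0 B0. A = motion m a A0 \<and> B = motion m a B0 \<and> (y, A0, B0) \<in> walk n)"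

lemma walk_third:
  assumes tr: "track T d l a b S" and "(y, motion m a A0, motion m a B0, C) \<in> S" "0 < area (motion m a A0) (motion m a B0) C"
  shows "C = motion m a (third 1 y A0 B0)"
  using third_if_placed(1)[OF trackD(1)[OF tr assms(2)]] assms(3) third_motion by (simp add: sgn_real_def)

lemma walk_end:
  assumes tr: "track T d l a b S" and l: "0 < l" and m: "norm m = 1"
    and st: "walk_state S m a l n y A B C" and C: "Im (fst C) = 0"
  shows "(l, a - b) \<in> targets n"
proof -
  obtain A0 B0 where AB: "A = motion m a A0" "B = motion m a B0" "(y, A0, B0) \<in> walk n"
    using st by (auto simp: walk_state_def)
  have s: "(y, A, B, C) \<in> S" "0 < Im (fst A)" "Im (fst B) < 0" "0 < area A B C"
    "0 < hit (fst A) (fst B)" "hit (fst A) (fst B) < l" using st by (auto simp: walk_state_def)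
  have C': "C = (complex_of_real l, b)"
    by (rule track_step(1)[OF tr l s C])
  have "motion m a (third 1 y A0 B0) = (complex_of_real l, b)"
    using walk_third[OF tr, of y m A0 B0 C] s C' AB by simp
  then have "m * fst (third 1 y A0 B0) = complex_of_real l" "a + snd (third 1 y A0 B0) = b"
    by (simp_all add: motion_def)
  then have "norm (m * fst (third 1 y A0 B0)) = l" "a - b = - snd (third 1 y A0 B0)"
    using l by auto
  then have "(l, a - b) = (\<lambda>(y, A, B). (norm (fst (third 1 y A B)), - snd (third 1 y A B))) (y, A0, B0)"
    using m by (simp add: norm_mult)
  then show ?thesis using AB(3) unfolding targets_def by blast
qed

lemma walk_next:
  assumes tr: "track T d l a b S" and l: "0 < l" and st: "walk_state S m a l n y A B C" and C: "Im (fst C) \<noteq> 0"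
    and N: "0 \<le> N" "pi + min_area / max_len\<^sup>2 \<le> N * (min_area / max_len)"
  shows "\<exists>y' A' B' D. walk_state S m a l (Suc n) y' A' B' D \<and> (Im (fst D) \<noteq> 0 \<longrightarrow>
    potential N (fst A) (fst B) (fst C) + min_area / max_len\<^sup>2 \<le> potential N (fst A') (fst B') (fst D))"
proof -
  obtain A0 B0 where AB: "A = motion m a A0" "B = motion m a B0" "(y, A0, B0) \<in> walk n"
    using st by (auto simp: walk_state_def)
  have s: "(y, A, B, C) \<in> S" "0 < Im (fst A)" "Im (fst B) < 0" "0 < area A B C"
    "0 < hit (fst A) (fst B)" "hit (fst A) (fst B) < l" using st by (auto simp: walk_state_def)
  note step = track_step[OF tr l s]
  have C': "C = motion m a (third 1 y A0 B0)"
    using walk_third[OF tr, of y m A0 B0 C] s AB by simp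
  have w: "wedge min_area max_len (fst A) (fst B) (fst C)" by (rule wedge_placed[OF trackD(1)[OF tr s(1)] s(2-4)])
  consider "Im (fst C) < 0" | "0 < Im (fst C)" using C by linarith
  then show ?thesis
  proof cases
    case 1
    obtain D where D: "(F (E y), A, C, D) \<in> S" "0 < area A C D" "hit (fst A) (fst C) < l"
      using step(2)[OF 1] by blast
    have "(F (E y), A0, third 1 y A0 B0) \<in> walk (Suc n)" using AB(3) by force
    then have "\<exists>A0 B0. A = motion m a A0 \<and> C = motion m a B0 \<and> (F (E y), A0, B0) \<in> walk (Suc n)"
      using AB(1) C' by blast
    then have "walk_state S m a l (Suc n) (F (E y)) A C D"
      unfolding walk_state_def using D s(2,5) 1 wedge_hit_less(1)[OF w 1] by (intro conjI) auto
    moreover have "wedge min_area max_len (fst A) (fst C) (fst D)"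
      by (rule wedge_placed[OF trackD(1)[OF tr D(1)] s(2) 1 D(2)])
    ultimately show ?thesis using potential_increases(1)[OF w N 1] by blast
  next
    case 2
    obtain D where D: "(F (V (E (V y))), C, B, D) \<in> S" "0 < area C B D" "hit (fst C) (fst B) < l"
      using step(3)[OF 2] by blast
    have "(F (V (E (V y))), third 1 y A0 B0, B0) \<in> walk (Suc n)" using AB(3) by force
    then have "\<exists>A0 B0. C = motion m a A0 \<and> B = motion m a B0 \<and> (F (V (E (V y))), A0, B0) \<in> walk (Suc n)"
      using AB(2) C' by blast
    then have "walk_state S m a l (Suc n) (F (V (E (V y)))) C B D"
      unfolding walk_state_def using D s(3,5) 2 wedge_hit_less(2)[OF w 2] by (intro conjI) auto
    moreover have "wedge min_area max_len (fst C) (fst B) (fst D)"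
      by (rule wedge_placed[OF trackD(1)[OF tr D(1)] 2 s(3) D(2)])
    ultimately show ?thesis using potential_increases(2)[OF w N 2] by blast
  qed
qed

lemma potential_less:
  assumes tr: "track T d l a b S" and l: "0 < l" "l \<le> c" and st: "walk_state S m a l n y A B C" and C: "Im (fst C) \<noteq> 0"
    and N: "0 < N"
  shows "potential N (fst A) (fst B) (fst C) < 2 * N * c + pi / 2"
proof -
  have s: "(y, A, B, C) \<in> S" "0 < Im (fst A)" "Im (fst B) < 0" "0 < area A B C"
    "0 < hit (fst A) (fst B)" "hit (fst A) (fst B) < l" using st by (auto simp: walk_state_def)
  note step = track_step[OF tr l(1) s]
  have *: "N * (h + h') < 2 * N * c" if "h < l" "h' < l" for h h'
  proof -
    have "N * (h + h') < N * (2 * c)" using that l N by (intro mult_strict_left_mono) auto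
    then show ?thesis by (simp add: mult_ac)
  qed
  have at: "- (pi / 2) < arctan (slant (fst A) (fst B))" "arctan (slant (fst A) (fst B)) < pi / 2"
    using arctan_bounded by auto
  show ?thesis
  proof (cases "Im (fst C) < 0")
    case True
    then show ?thesis using *[OF s(6)] step(2) at unfolding potential_def by fastforce
  next
    case False
    then have "hit (fst C) (fst B) < l" using step(3) C by simp
    then show ?thesis using False *[OF s(6), of "hit (fst C) (fst B)"] at unfolding potential_def by simp
  qed
qed

text \<open>Induction on the number \<open>k\<close> of steps that the remaining potential allows.
  At \<open>k = 0\<close> a corner ahead off the axis would contradict the upper bound
  \<open>potential_less\<close>, so this corner is the end.\<close>

lemma track_walk:
  assumes tr: "track T d l a b S" and l: "0 < l" "l \<le> c" and m: "norm m = 1"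
    and N: "0 < N" "pi + min_area / max_len\<^sup>2 \<le> N * (min_area / max_len)"
    and "walk_state S m a l n y A B C"
    and "Im (fst C) \<noteq> 0 \<Longrightarrow> 2 * N * c + pi / 2 - potential N (fst A) (fst B) (fst C) \<le> of_nat k * (min_area / max_len\<^sup>2)"
  shows "(l, a - b) \<in> targets (n + k)"
  using assms(7-)
proof (induction k arbitrary: n y A B C)
  case 0
  have "Im (fst C) = 0"
    using potential_less[OF tr l 0(1) _ N(1)] 0(2) by force
  then show ?case using walk_end[OF tr l(1) m 0(1)] by simp
next
  case (Suc k)
  show ?case
  proof (cases "Im (fst C) = 0")
    case True
    then show ?thesis using walk_end[OF tr l(1) m Suc.prems(1)] targets_mono[of n "n + Suc k"] by auto
  next
    case False
    obtain y' A' B' D where st: "walk_state S m a l (Suc n) y' A' B' D"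
      and pot: "Im (fst D) \<noteq> 0 \<longrightarrow> potential N (fst A) (fst B) (fst C) + min_area / max_len\<^sup>2 \<le> potential N (fst A') (fst B') (fst D)"
      using walk_next[OF tr l(1) Suc.prems(1) False less_imp_le[OF N(1)] N(2)] by blast
    have "(l, a - b) \<in> targets (Suc n + k)"
    proof (rule Suc.IH[OF st])
      assume "Im (fst D) \<noteq> 0"
      with pot Suc.prems(2)[OF False]
      show "2 * N * c + pi / 2 - potential N (fst A') (fst B') (fst D) \<le> of_nat k * (min_area / max_len\<^sup>2)"
        unfolding of_nat_Suc distrib_right mult_1 by linarith
    qed
    then show ?thesis by simp
  qed
qed

lemma potential_nonneg:
  assumes tr: "track T d l a b S" and l: "0 < l" and st: "walk_state S m a l n y A B C" and N: "0 \<le> N"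
    and C: "Im (fst C) \<noteq> 0"
  shows "- pi / 2 \<le> potential N (fst A) (fst B) (fst C)"
proof -
  have s: "(y, A, B, C) \<in> S" "0 < Im (fst A)" "Im (fst B) < 0" "0 < area A B C"
    "0 < hit (fst A) (fst B)" using st by (auto simp: walk_state_def)
  have w: "wedge min_area max_len (fst A) (fst B) (fst C)" by (rule wedge_placed[OF trackD(1)[OF tr s(1)] s(2-4)])
  have at: "- (pi / 2) < arctan (slant (fst A) (fst B))" "arctan (slant (fst A) (fst B)) < pi / 2"
    using arctan_bounded by auto
  show ?thesis
  proof (cases "Im (fst C) < 0")
    case True
    then have "0 \<le> N * (hit (fst A) (fst B) + hit (fst A) (fst C))" using wedge_hit_less(1)[OF w] s(5) N by auto
    then show ?thesis using True at by (simp add: potential_def)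
  next
    case False
    then have "0 \<le> N * (hit (fst A) (fst B) + hit (fst C) (fst B))" using wedge_hit_less(2)[OF w] C s(5) N by auto
    then show ?thesis using False at by (simp add: potential_def)
  qed
qed

text \<open>The last condition on a track provides a triangle with the start as a corner and a
  further point \<open>t\<close> of the segment. Either the segment runs along a side at this
  corner, or it leaves through the opposite side.\<close>

lemma track_start:
  assumes tr: "track T d l a b S" and l: "0 < l"
  shows "(l, a - b) \<in> range (\<lambda>z. (len z, om z)) \<or> (\<exists>m y A B C. norm m = 1 \<and> walk_state S m a l 0 y A B C)"
proof -
  obtain z0 P0 Q0 R0 t where mem0: "(z0, P0, Q0, R0) \<in> S" and t: "0 < t" "t \<le> l" and t0: "0 \<in> tri P0 Q0 R0"
    and tt: "of_real t \<in> tri P0 Q0 R0"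
    using tr[unfolded track_def, THEN conjunct2, THEN conjunct2, THEN conjunct2] by (elim exE conjE)
  have "(0, a) \<in> {P0, Q0, R0}" using trackD(6)[OF tr mem0] t0 l by simp
  then obtain z P Q R where mem: "(z, P, Q, R) \<in> S" and P: "P = (0, a)" and tri_t: "of_real t \<in> tri P Q R"
  proof (elim insertE emptyE)
    assume "(0, a) = P0"
    then show ?thesis using that[OF mem0] tt by simp
  next
    assume "(0, a) = Q0"
    then show ?thesis using that[OF trackD(2)[OF tr mem0]] tt tri_perm(1)[of P0 Q0 R0] by simp
  next
    assume "(0, a) = R0"
    then show ?thesis using that[OF trackD(2)[OF tr trackD(3)[OF tr mem0]]] tt tri_perm(5)[of R0 P0 Q0] by simp
  qed
  have edge: "(l, a - b) \<in> range (\<lambda>z. (len z, om z))"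
    if mem: "(z, P, Q, R) \<in> S" and tri_t: "of_real t \<in> tri P Q R" and Q: "Im (fst Q) = 0" for z Q R
  proof -
    have p: "placed T d z P Q R" by (rule trackD(1)[OF tr mem])
    have ar: "Re (fst Q) * Im (fst R) \<noteq> 0"
      using third_if_placed(2)[OF p] Q by (simp add: area_def cross_def P)
    obtain u v w where uvw: "0 \<le> u" "0 \<le> v" "0 \<le> w" "complex_of_real t = u *\<^sub>R fst P + v *\<^sub>R fst Q + w *\<^sub>R fst R"
      using tri_t unfolding tri_iff by (elim exE conjE)
    have "w * Im (fst R) = 0" using arg_cong[OF uvw(4), of Im] P Q by simp
    then have "w = 0" using ar by simp
    \<comment> \<open>With \<open>Q\<close> on the axis and \<open>R\<close> off it,
      \<open>t\<close> is on the side \<open>PQ\<close>; so \<open>Q\<close> lies ahead of the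
      start, and it is the end because no corner comes before \<open>l\<close>.\<close>
    then have "t = v * Re (fst Q)" using arg_cong[OF uvw(4), of Re] P by simp
    then have q: "0 < Re (fst Q)" using t uvw(2) by (simp add: zero_less_mult_iff)
    have Qr: "fst Q = complex_of_real (Re (fst Q))" using Q by (simp add: complex_eq_iff)
    have Qt: "complex_of_real (Re (fst Q)) \<in> tri P Q R" using corner_in_tri(2) Qr by metis
    have "l \<le> Re (fst Q)" using trackD(8)[OF tr mem q _ Qt] Qr by force
    moreover have "of_real 0 \<in> tri P Q R" using corner_in_tri(1)[of P Q R] by (simp add: P)
    note real_tri_between[OF this Qt, of l]
    ultimately have "of_real l \<in> tri P Q R" using l by simp
    then have "(complex_of_real l, b) \<in> {P, Q, R}" using trackD(7)[OF tr mem] l by simp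
    moreover have "(complex_of_real l, b) \<noteq> P" "(complex_of_real l, b) \<noteq> R" using l ar by (auto simp: P)
    ultimately have "Q = (complex_of_real l, b)" by auto
    then have "l = len z" "a - b = om z" using p l by (auto simp: placed_iff P)
    then show ?thesis by blast
  qed
  have walk0: "\<exists>m y A B C. norm m = 1 \<and> walk_state S m a l 0 y A B C"
    if mem: "(z, P, Q, R) \<in> S" and tri_t: "of_real t \<in> tri P Q R" and im: "0 < Im (fst Q)" "Im (fst R) < 0" for z Q R
  proof -
    have p: "placed T d z P Q R" by (rule trackD(1)[OF tr mem])
    obtain u v w where uvw: "0 \<le> u" "0 \<le> v" "0 \<le> w" "complex_of_real t = u *\<^sub>R fst P + v *\<^sub>R fst Q + w *\<^sub>R fst R"
      using tri_t unfolding tri_iff by (elim exE conjE)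
    have 0: "v * Im (fst Q) + w * Im (fst R) = 0" and 1: "v * Re (fst Q) + w * Re (fst R) = t"
      using arg_cong[OF uvw(4), of Im] arg_cong[OF uvw(4), of Re] P by simp_all
    have a: "area P Q R = Re (fst Q) * Im (fst R) - Im (fst Q) * Re (fst R)"
      by (simp add: area_def cross_def P)
    \<comment> \<open>\<open>Q\<close> is above and \<open>R\<close> below the axis, ahead of
      \<open>P\<close>, so the triangle is negatively oriented; hence the \<open>-1\<close> in
      \<open>walk 0\<close>.\<close>
    have "t * Im (fst Q) = - w * area P Q R"
      unfolding a 1[symmetric] using 0 by algebra
    then have "0 < - w * area P Q R" using t im by (metis mult_pos_pos)
    then have neg: "area P Q R < 0" using uvw(3) by (simp add: zero_less_mult_iff mult_less_0_iff)
    define h where "h = hit (fst Q) (fst R)"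
    have h: "0 < h"
      using neg im by (simp add: h_def hit_def a algebra_simps)
    have h_seg: "of_real h \<in> closed_segment (fst Q) (fst R)" unfolding h_def using im by (rule hit_in_segment)
    then have h_tri: "of_real h \<in> tri P Q R" using side_subset_tri[of Q R P] tri_perm(4)[where P = P and Q = Q and R = R] by blast
    have hl: "h < l"
    proof (rule ccontr)
      assume "\<not> h < l"
      moreover have "of_real 0 \<in> tri P Q R" using corner_in_tri(1)[of P Q R] by (simp add: P)
      note real_tri_between[OF this h_tri, of l]
      ultimately have "of_real l \<in> tri P Q R" using l by simp
      then have "(complex_of_real l, b) \<in> {P, Q, R}" using trackD(7)[OF tr mem] l by simp
      then show False using l im by (auto simp: P)
    qed
    have mem': "(E (V z), Q, R, P) \<in> S" by (rule trackD(3)[OF tr trackD(2)[OF tr mem]])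
    obtain C where C: "placed T d (F (E (V z))) Q R C" "area Q R P * area Q R C < 0"
      by (rule placed_opposite_exists[OF trackD(1)[OF tr mem']])
    have mem'': "(F (E (V z)), Q, R, C) \<in> S" by (rule trackD(5)[OF tr mem' h hl h_seg C])
    have pos: "0 < area Q R C" using C(2) neg area_swap(4)[where P = P and Q = Q and R = R] by (auto simp: mult_less_0_iff)
    \<comment> \<open>The rotation that takes the second corner of the normal position to
      \<open>Q\<close>.\<close>
    define m where "m = fst Q / len z"
    have m: "norm m = 1" using p by (simp add: m_def norm_divide placed_iff P dist_norm abs_of_pos)
    have "Q = motion m a (second_corner z)"
      using p by (simp add: motion_def second_corner_def m_def prod_eq_iff placed_iff P)
    moreover have "P = motion m a (0, 0)" by (simp add: P motion_def)
    moreover have "R = third (-1) z P Q" using third_if_placed(1)[OF p] neg by (simp add: sgn_real_def)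
    ultimately have "R = motion m a (third (-1) z (0, 0) (second_corner z))" using third_motion by simp
    moreover have "(F (E (V z)), second_corner z, third (-1) z (0, 0) (second_corner z)) \<in> walk 0" by simp
    ultimately have "\<exists>A0 B0. Q = motion m a A0 \<and> R = motion m a B0 \<and> (F (E (V z)), A0, B0) \<in> walk 0"
      using \<open>Q = motion m a (second_corner z)\<close> by blast
    then have "walk_state S m a l 0 (F (E (V z))) Q R C"
      unfolding walk_state_def using mem'' im pos h hl by (simp only: h_def)
    then show ?thesis using m by blast
  qed
  have mem2: "(E z, P, R, Q) \<in> S" "of_real t \<in> tri P R Q"
    using trackD(3)[OF tr mem] tri_t tri_perm(2)[of P Q R] by auto
  consider "Im (fst Q) = 0" | "Im (fst R) = 0" | "0 < Im (fst Q)" "Im (fst R) < 0" | "0 < Im (fst R)" "Im (fst Q) < 0"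
    | "0 < Im (fst Q) * Im (fst R)"
    by (metis linorder_neqE_linordered_idom mult_pos_pos mult_neg_neg)
  then show ?thesis
  proof cases
    case 1
    then show ?thesis using edge[OF mem tri_t] by blast
  next
    case 2
    then show ?thesis using edge[OF mem2] by blast
  next
    case 3
    then show ?thesis using walk0[OF mem tri_t] by blast
  next
    case 4
    then show ?thesis using walk0[OF mem2] by blast
  next
    case 5
    \<comment> \<open>With \<open>Q\<close> and \<open>R\<close> strictly on the same side, the
      triangle meets the axis only in \<open>P\<close>, which excludes \<open>t > 0\<close>.\<close>
    obtain u v w where uvw: "0 \<le> u" "0 \<le> v" "0 \<le> w" "complex_of_real t = u *\<^sub>R fst P + v *\<^sub>R fst Q + w *\<^sub>R fst R"
      using tri_t unfolding tri_iff by (elim exE conjE)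
    have "v * Im (fst Q) + w * Im (fst R) = 0"
      using arg_cong[OF uvw(4), of Im] P by simp
    then have "v = 0 \<and> w = 0"
      using 5 uvw(2,3) by (auto simp: zero_less_mult_iff add_nonneg_eq_0_iff add_nonpos_eq_0_iff mult_nonneg_nonpos)
    then show ?thesis using arg_cong[OF uvw(4), of Re] P t by simp
  qed
qed

theorem tracks_finite: "finite {(l, a - b) |l a b. 0 < l \<and> l \<le> c \<and> (\<exists>S. track T d l a b S)}"
proof -
  define N where "N = (pi + min_area / max_len\<^sup>2) / (min_area / max_len)"
  have max_len_pos: "0 < max_len" using len_pos max_len by (rule less_le_trans)
  have pos: "0 < min_area / max_len\<^sup>2" "0 < min_area / max_len" using min_area(1) max_len_pos by auto
  have N: "0 < N" "pi + min_area / max_len\<^sup>2 \<le> N * (min_area / max_len)"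
  proof -
    show "0 < N" unfolding N_def using pos pi_gt_zero by (intro divide_pos_pos[OF add_pos_pos])
    have "N * (min_area / max_len) = pi + min_area / max_len\<^sup>2"
      by (rule nonzero_eq_divide_eq[THEN iffD1, OF less_imp_neq[OF pos(2), symmetric] N_def])
    then show "pi + min_area / max_len\<^sup>2 \<le> N * (min_area / max_len)" by simp
  qed
  \<comment> \<open>The potential stays between \<open>- pi / 2\<close> and
    \<open>2 * N * c + pi / 2\<close> and grows by at least
    \<open>min_area / max_len\<^sup>2\<close> in each step.\<close>
  obtain k :: nat where k: "(2 * N * c + pi) / (min_area / max_len\<^sup>2) \<le> k" using real_arch_simple by blast
  have "(l, a - b) \<in> targets k" if l: "0 < l" "l \<le> c" and tr: "track T d l a b S" for l a b S
    using track_start[OF tr l(1)]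
  proof (elim disjE exE conjE)
    assume "(l, a - b) \<in> range (\<lambda>z. (len z, om z))"
    then show ?thesis unfolding targets_def by blast
  next
    fix m y A B C
    assume m: "norm m = 1" and st: "walk_state S m a l 0 y A B C"
    have "2 * N * c + pi / 2 - potential N (fst A) (fst B) (fst C) \<le> of_nat k * (min_area / max_len\<^sup>2)" if "Im (fst C) \<noteq> 0"
    proof -
      have "2 * N * c + pi / 2 - potential N (fst A) (fst B) (fst C) \<le> 2 * N * c + pi"
        using potential_nonneg[OF tr l(1) st less_imp_le[OF N(1)] that] by simp
      also have "\<dots> \<le> of_nat k * (min_area / max_len\<^sup>2)"
        using k pos(1) by (simp only: pos_divide_le_eq)
      finally show ?thesis .
    qed
    from track_walk[OF tr l m N st this] show ?thesis by simp
  qed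
  then have "{(l, a - b) |l a b. 0 < l \<and> l \<le> c \<and> (\<exists>S. track T d l a b S)} \<subseteq> targets k" by blast
  then show ?thesis using finite_targets by (rule finite_subset)
qed

end

section \<open>The edge flip algorithm\<close>

lemma duality_flip:
  assumes "duality_triangulation T d" "flippable T d x"
  shows "flip T d x"
  using assms by unfold_locales

text \<open>The steps of the algorithm are flips, so \<open>d\<close> is still positive where it
  stops; there an edge that is not regular would be flippable and allow a further step. The
  condition \<open>not_reg\<close> covers both notions of regularity.\<close>

lemma stops_only_if_regular:
  assumes "duality_triangulation T d" "edge_positive T d"
    and not_reg: "\<And>T d x. \<not> reg T d x \<Longrightarrow> dual_length T d x \<le> 0"
  shows "algorithm_stops_only_if_regular reg (T, d)"
  unfolding algorithm_stops_only_if_regular_def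
proof (intro allI impI, elim conjE)
  fix T' d' x
  assume steps: "(algorithm_step reg)\<^sup>*\<^sup>* (T, d) (T', d')" and stop: "\<not> (\<exists>S'. algorithm_step reg (T', d') S')"
  have inv: "flip_step\<^sup>*\<^sup>* (T, d) S \<and> duality_triangulation (fst S) (snd S)"
    if "(algorithm_step reg)\<^sup>*\<^sup>* (T, d) S" for S
    using that
  proof (induction rule: rtranclp_induct)
    case base
    then show ?case using assms(1) by simp
  next
    case (step S1 S2)
    obtain x where x: "flippable (fst S1) (snd S1) x" "S2 = (flip_triangulation (fst S1) x, flip_d (fst S1) (snd S1) x)"
      using step.hyps(2) by (auto simp: algorithm_step_def split_beta)
    then have "flip_step S1 S2" by (auto simp: flip_step_def split_beta)
    moreover have "duality_triangulation (fst S1) (snd S1)" using step.IH by simp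
    from flip.duality'[OF duality_flip[OF this x(1)]] have "duality_triangulation (fst S2) (snd S2)"
      using x(2) by simp
    ultimately show ?case using step.IH by (meson rtranclp.rtrancl_into_rtrancl)
  qed
  from inv[OF steps] have dual: "duality_triangulation T' d'" and pos: "\<And>x. 0 < d' x"
    using assms(2) by (auto simp: edge_positive_def)
  interpret duality T' d' by unfold_locales (rule dual)
  show "reg T' d' x"
  proof (rule ccontr)
    assume "\<not> reg T' d' x"
    then have "flippable T' d' x \<and> \<not> reg T' d' x"
      using flippable_if_not_regular[OF pos] not_reg by blast
    then show False using stop by (auto simp: algorithm_step_def)
  qed
qed

lemma no_infinite_flip_sequence:
  fixes T :: "'f::finite triangulation"
  assumes dual: "duality_triangulation T d" and start: "run 0 = (T, d)"
    and step: "\<And>n::nat. \<exists>x. flippable (fst (run n)) (snd (run n)) x \<and> dual_length (fst (run n)) (snd (run n)) x < 0 \<and>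
      run (Suc n) = (flip_triangulation (fst (run n)) x, flip_d (fst (run n)) (snd (run n)) x)"
  shows False
proof -
  interpret T0: duality T d by unfold_locales (rule dual)
  obtain C where C: "cone_bounded C T d" by (rule T0.cone_bounded_exists)
  have inv: "duality_triangulation (fst (run n)) (snd (run n)) \<and> cone_bounded C (fst (run n)) (snd (run n)) \<and>
    (\<forall>l a b S. 0 < l \<longrightarrow> track (fst (run n)) (snd (run n)) l a b S \<longrightarrow> (\<exists>S. track T d l a b S)) \<and>
    (\<exists>e. fst (run n) = T\<lparr>chg_edge := e\<rparr>)" for n
  proof (induction n)
    case 0
    have "T = T\<lparr>chg_edge := chg_edge T\<rparr>" by simp
    then show ?case unfolding start fst_conv snd_conv using dual C by blast
  next
    case (Suc n)
    obtain x where x: "flippable (fst (run n)) (snd (run n)) x" "dual_length (fst (run n)) (snd (run n)) x < 0"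
      and run: "run (Suc n) = (flip_triangulation (fst (run n)) x, flip_d (fst (run n)) (snd (run n)) x)"
      using step by blast
    interpret flip "fst (run n)" "snd (run n)" x using Suc.IH x(1) by (intro duality_flip) auto
    have "\<exists>S. track T d l a b S" if "0 < l" "track T' d' l a b S" for l a b S
      using track_flip[OF that(2,1)] Suc.IH that(1) by metis
    moreover have "\<exists>e. T' = T\<lparr>chg_edge := e\<rparr>"
      using Suc.IH by (auto simp: flip_triangulation_def Let_def)
    moreover have "cone_bounded C T' d'" using cone_bounded_flip Suc.IH x(2) by simp
    ultimately show ?case unfolding run using duality' by simp
  qed
  \<comment> \<open>The moment of an edge divided by its length is \<open>d\<close>. The length is a
    sum of two values of \<open>d\<close>, each at most \<open>C\<close>.\<close>
  define D where "D = (\<lambda>(l, w). (l\<^sup>2 + w) / 2 / l) ` {(l, a - b) |l a b. 0 < l \<and> l \<le> 2 * C \<and> (\<exists>S. track T d l a b S)}"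
  have "finite D" unfolding D_def by (intro finite_imageI T0.tracks_finite)
  have d_in: "snd (run n) x \<in> D" for n x
  proof -
    interpret duality "fst (run n)" "snd (run n)" using inv[of n] by unfold_locales simp
    obtain S where "track (fst (run n)) (snd (run n)) (len x) 0 (- om x) S" by (rule track_edge)
    then obtain S' where "track T d (len x) 0 (- om x) S'" using inv[of n] len_pos by blast
    moreover have "len x \<le> 2 * C"
      using d_le_if_cone_bounded inv[of n] unfolding edge_length_def by (smt (verit))
    ultimately have "(len x, 0 - (- om x)) \<in> {(l, a - b) |l a b. 0 < l \<and> l \<le> 2 * C \<and> (\<exists>S. track T d l a b S)}"
      using len_pos by blast
    moreover have "snd (run n) x = ((len x)\<^sup>2 + (0 - (- om x))) / 2 / len x"
      using em_eq[of x] by (simp add: edge_moment_def field_simps)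
    ultimately show ?thesis unfolding D_def by (intro image_eqI[where x = "(len x, 0 - (- om x))"]) simp_all
  qed
  \<comment> \<open>A flip reuses the flags and changes no involution but \<open>chg_edge\<close>,
    so all states live on one finite set of flags.\<close>
  have "range run \<subseteq> range (\<lambda>e. T\<lparr>chg_edge := e\<rparr>) \<times> (UNIV \<rightarrow>\<^sub>E D)"
  proof
    fix S assume "S \<in> range run"
    then obtain n where "S = run n" by blast
    then show "S \<in> range (\<lambda>e. T\<lparr>chg_edge := e\<rparr>) \<times> (UNIV \<rightarrow>\<^sub>E D)"
      using inv[of n] d_in[of n] by (auto simp: mem_Times_iff)
  qed
  moreover have "finite (range (\<lambda>e. T\<lparr>chg_edge := e\<rparr>) \<times> ((UNIV :: 'f set) \<rightarrow>\<^sub>E D))"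
    using \<open>finite D\<close> by (intro finite_cartesian_product finite_PiE) auto
  ultimately have "finite (range run)" by (rule finite_subset)
  moreover have "inj run"
  proof -
    have "dual_energy (fst (run (Suc n))) (snd (run (Suc n))) < dual_energy (fst (run n)) (snd (run n))" for n
    proof -
      obtain x where x: "flippable (fst (run n)) (snd (run n)) x" "dual_length (fst (run n)) (snd (run n)) x < 0"
        and run: "run (Suc n) = (flip_triangulation (fst (run n)) x, flip_d (fst (run n)) (snd (run n)) x)"
        using step by blast
      interpret flip "fst (run n)" "snd (run n)" x using inv[of n] x(1) by (intro duality_flip) auto
      show ?thesis unfolding run using dual_energy_decreases[OF x(2)] by simp
    qed
    then have "strict_mono (\<lambda>n. - dual_energy (fst (run n)) (snd (run n)))"
      by (intro strict_mono_Suc_iff[THEN iffD2]) simp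
    then have "inj (\<lambda>n. - dual_energy (fst (run n)) (snd (run n)))" by (rule strict_mono_imp_inj_on)
    then show ?thesis unfolding inj_on_def by metis
  qed
  ultimately show False using range_inj_infinite by blast
qed

text \<open>An edge that is not weakly regular has negative dual length, so its flip decreases the
  energy strictly. For the strict notion the dual length of a flipped edge might be
  \<open>0\<close>; \<open>no_degenerate_hinges\<close> excludes this along the whole run.\<close>

theorem theorem26:
  fixes T :: "'f::finite triangulation" and d :: "'f \<Rightarrow> real"
  assumes "duality_triangulation T d"
    and "edge_positive T d"
  shows "algorithm_stops_only_if_regular regular_edge (T, d) \<and>
         (no_degenerate_hinges T d \<longrightarrow> algorithm_terminates regular_edge (T, d)) \<and>
         algorithm_stops_only_if_regular weakly_regular_edge (T, d) \<and>
         algorithm_terminates weakly_regular_edge (T, d)"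
proof (intro conjI impI)
  show "algorithm_stops_only_if_regular regular_edge (T, d)"
    "algorithm_stops_only_if_regular weakly_regular_edge (T, d)"
    using assms by (auto intro!: stops_only_if_regular simp: regular_edge_def weakly_regular_edge_def)
  show "algorithm_terminates weakly_regular_edge (T, d)"
    unfolding algorithm_terminates_def
  proof (rule notI, elim exE conjE)
    fix run assume "run 0 = (T, d)" "\<forall>n::nat. algorithm_step weakly_regular_edge (run n) (run (Suc n))"
    then show False
      using no_infinite_flip_sequence[OF assms(1), of run]
      by (force simp: algorithm_step_def split_beta weakly_regular_edge_def)
  qed
  assume nd: "no_degenerate_hinges T d"
  show "algorithm_terminates regular_edge (T, d)"
    unfolding algorithm_terminates_def
  proof (rule notI, elim exE conjE)
    fix run assume run: "run 0 = (T, d)" and step: "\<forall>n::nat. algorithm_step regular_edge (run n) (run (Suc n))"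
    have reach: "(algorithm_step regular_edge)\<^sup>*\<^sup>* (T, d) (run n)" for n
      by (induction n) (use run step in \<open>auto intro: rtranclp.rtrancl_into_rtrancl\<close>)
    show False
    proof (rule no_infinite_flip_sequence[where run = run, OF assms(1) run])
      fix n
      obtain x where x: "flippable (fst (run n)) (snd (run n)) x" "\<not> 0 < dual_length (fst (run n)) (snd (run n)) x"
        "run (Suc n) = (flip_triangulation (fst (run n)) x, flip_d (fst (run n)) (snd (run n)) x)"
        using step[rule_format, of n] by (auto simp: algorithm_step_def split_beta regular_edge_def)
      moreover have "dual_length (fst (run n)) (snd (run n)) x \<noteq> 0"
        using nd reach[of n] unfolding no_degenerate_hinges_def by (metis prod.collapse)
      ultimately show "\<exists>x. flippable (fst (run n)) (snd (run n)) x \<and> dual_length (fst (run n)) (snd (run n)) x < 0 \<and>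
        run (Suc n) = (flip_triangulation (fst (run n)) x, flip_d (fst (run n)) (snd (run n)) x)"
        by (intro exI[of _ x]) auto
    qed
  qed
qed

end
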